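(* Let $A$ be an associative unital ring, $S\subset A[t]$ a multiplicative set of monic centric polynomials, and $m$ an integer. Given an $m$-connected map $X\to Y$ of $A$-perfect, $S$-torsion $A[t]$-chain complexes, there is a factorization in $A[t]$-chain complexes $$X\to X_{m+1}\to X_{m+2}\to\cdots\to X_n\xrightarrow{\ \sim\ }Y$$ in which, with $X_m:=X$, the maps $X_{q-1}\to X_q$ ($m<q\le n$) are levelwise injective, each $X_q/X_{q-1}$ has homology that is $S$-torsion, finitely generated projective over $A$, and concentrated in degree $q$, and the last map $X_n\to Y$ is a quasi-isomorphism. (Therefore every term of the factorization is $A$-perfect and $S$-torsion.)
   Context: Modules are right modules; in $A[t]$ the indeterminate commutes with $A$; a polynomial is centric if it lies in the center $Z(A[t])=Z(A)[t]$. Chain complexes are non-negatively graded. A complex of $A$-modules is strictly perfect if it is bounded and finitely generated projective over $A$ in each degree. An $A[t]$-chain complex is $A$-perfect if it is connected by a zig-zag of $A$-linear quasi-isomorphisms to a strictly perfect $A$-complex. An $A$-perfect $A[t]$-complex is $S$-torsion if there is a single $p(t)\in S$ acting as zero on its homology; an $A[t]$-module is $S$-torsion if it is annihilated by some $p(t)\in S$. A map of chain complexes $X\to Y$ is $m$-connected if $H_q(Y,X)=0$ for all $q\le m$, where $H_*(Y,X)$ is the homology of the mapping cone. *)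

theory Defs
  imports "HOL-Algebra.UnivPoly" "HOL-Algebra.AbelCoset"
begin

section \<open>Right modules\<close>

text \<open>
  The library locale for modules requires a commutative ring of scalars and acts from the left.
  Right modules reuse its record type: \<open>a \<odot>\<^bsub>M\<^esub> x\<close> stands for the product \<open>x \<cdot> a\<close>, which is why the
  associativity law reverses the factors.  The fields \<open>mult\<close> and \<open>one\<close> which the record inherits
  from rings carry no meaning.
\<close>

locale right_module = R?: ring R + M?: abelian_group M
  for R (structure) and M :: "('r, 'm) module" (structure) +
  assumes smult_closed:
      "\<lbrakk>a \<in> carrier R; x \<in> carrier M\<rbrakk> \<Longrightarrow> a \<odot>\<^bsub>M\<^esub> x \<in> carrier M"
    and smult_l_distr:
      "\<lbrakk>a \<in> carrier R; b \<in> carrier R; x \<in> carrier M\<rbrakk> \<Longrightarrow>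
        (a \<oplus>\<^bsub>R\<^esub> b) \<odot>\<^bsub>M\<^esub> x = a \<odot>\<^bsub>M\<^esub> x \<oplus>\<^bsub>M\<^esub> b \<odot>\<^bsub>M\<^esub> x"
    and smult_r_distr:
      "\<lbrakk>a \<in> carrier R; x \<in> carrier M; y \<in> carrier M\<rbrakk> \<Longrightarrow>
        a \<odot>\<^bsub>M\<^esub> (x \<oplus>\<^bsub>M\<^esub> y) = a \<odot>\<^bsub>M\<^esub> x \<oplus>\<^bsub>M\<^esub> a \<odot>\<^bsub>M\<^esub> y"
    and smult_assoc:
      "\<lbrakk>a \<in> carrier R; b \<in> carrier R; x \<in> carrier M\<rbrakk> \<Longrightarrow>
        (a \<otimes>\<^bsub>R\<^esub> b) \<odot>\<^bsub>M\<^esub> x = b \<odot>\<^bsub>M\<^esub> (a \<odot>\<^bsub>M\<^esub> x)"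
    and smult_one:
      "x \<in> carrier M \<Longrightarrow> \<one>\<^bsub>R\<^esub> \<odot>\<^bsub>M\<^esub> x = x"

definition lin_maps ::
    "('r, 'k) ring_scheme \<Rightarrow> ('r, 'm) module \<Rightarrow> ('r, 'n) module \<Rightarrow> ('m \<Rightarrow> 'n) set" where
  "lin_maps R M N = {h \<in> carrier M \<rightarrow> carrier N.
     (\<forall>x\<in>carrier M. \<forall>y\<in>carrier M. h (x \<oplus>\<^bsub>M\<^esub> y) = h x \<oplus>\<^bsub>N\<^esub> h y) \<and>
     (\<forall>a\<in>carrier R. \<forall>x\<in>carrier M. h (a \<odot>\<^bsub>M\<^esub> x) = a \<odot>\<^bsub>N\<^esub> h x)}"

definition trivial_module :: "('r, 'm) module \<Rightarrow> bool" where
  "trivial_module M \<longleftrightarrow> carrier M = {\<zero>\<^bsub>M\<^esub>}"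

definition dsum_module :: "('r, 'm) module \<Rightarrow> ('r, 'n) module \<Rightarrow> ('r, 'm \<times> 'n) module" where
  "dsum_module M N = \<lparr>carrier = carrier M \<times> carrier N, mult = undefined, one = undefined,
     zero = (\<zero>\<^bsub>M\<^esub>, \<zero>\<^bsub>N\<^esub>),
     add = (\<lambda>(x, y) (x', y'). (x \<oplus>\<^bsub>M\<^esub> x', y \<oplus>\<^bsub>N\<^esub> y')),
     smult = (\<lambda>a (x, y). (a \<odot>\<^bsub>M\<^esub> x, a \<odot>\<^bsub>N\<^esub> y))\<rparr>"

text \<open>
  The elements of \<open>M / U\<close> are the cosets of \<open>U\<close>.  The scalar action and, below, maps induced on
  quotients are given by pushing a coset forward and adding the submodule of the target:
  \<open>(U + x) \<cdot> a = U + (U + x) a\<close>.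
\<close>

definition quot_module :: "('r, 'm) module \<Rightarrow> 'm set \<Rightarrow> ('r, 'm set) module" where
  "quot_module M U = \<lparr>carrier = a_rcosets\<^bsub>M\<^esub> U, mult = undefined, one = undefined,
     zero = U, add = set_add M,
     smult = (\<lambda>a K. U <+>\<^bsub>M\<^esub> ((\<lambda>x. a \<odot>\<^bsub>M\<^esub> x) ` K))\<rparr>"

text \<open>The free right module \<open>R\<^bsup>(I)\<^esup>\<close> of finitely supported families.\<close>

definition free_module :: "('r, 'k) ring_scheme \<Rightarrow> 'i set \<Rightarrow> ('r, 'i \<Rightarrow> 'r) module" where
  "free_module R I = \<lparr>
     carrier = {c. (\<forall>i. c i \<in> carrier R) \<and> finite {i. c i \<noteq> \<zero>\<^bsub>R\<^esub>} \<and> (\<forall>i. i \<notin> I \<longrightarrow> c i = \<zero>\<^bsub>R\<^esub>)},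
     mult = undefined, one = undefined,
     zero = (\<lambda>i. \<zero>\<^bsub>R\<^esub>), add = (\<lambda>c e i. c i \<oplus>\<^bsub>R\<^esub> e i),
     smult = (\<lambda>a c i. c i \<otimes>\<^bsub>R\<^esub> a)\<rparr>"

text \<open>
  A module is projective if it is (isomorphic to) a direct summand of a free module.  A module
  which is a summand of any free module is also a summand of the free module on its own elements,
  so basis sets \<open>I :: 'm set\<close> suffice.
\<close>

definition projective_module :: "('r, 'k) ring_scheme \<Rightarrow> ('r, 'm) module \<Rightarrow> bool" where
  "projective_module R M \<longleftrightarrow> (\<exists>(I :: 'm set) i p.
     i \<in> lin_maps R M (free_module R I) \<and> p \<in> lin_maps R (free_module R I) M \<and>
     (\<forall>x\<in>carrier M. p (i x) = x))"

definition fin_gen_module :: "('r, 'k) ring_scheme \<Rightarrow> ('r, 'm) module \<Rightarrow> bool" where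
  "fin_gen_module R M \<longleftrightarrow> (\<exists>B. finite B \<and> B \<subseteq> carrier M \<and>
     (\<forall>x\<in>carrier M. \<exists>c\<in>B \<rightarrow> carrier R. x = (\<Oplus>\<^bsub>M\<^esub>b\<in>B. c b \<odot>\<^bsub>M\<^esub> b)))"

definition fg_projective :: "('r, 'k) ring_scheme \<Rightarrow> ('r, 'm) module \<Rightarrow> bool" where
  "fg_projective R M \<longleftrightarrow> fin_gen_module R M \<and> projective_module R M"


section \<open>Chain complexes\<close>

text \<open>
  Complexes are indexed by the integers but vanish in negative degrees;
  \<open>dif C k\<close> goes from degree \<open>k\<close> to degree \<open>k - 1\<close>.
\<close>

record ('r, 'm) cplx =
  ob :: "int \<Rightarrow> ('r, 'm) module"
  dif :: "int \<Rightarrow> 'm \<Rightarrow> 'm"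

definition chain_complex :: "('r, 'k) ring_scheme \<Rightarrow> ('r, 'm) cplx \<Rightarrow> bool" where
  "chain_complex R C \<longleftrightarrow>
     (\<forall>k. right_module R (ob C k)) \<and>
     (\<forall>k. dif C k \<in> lin_maps R (ob C k) (ob C (k - 1))) \<and>
     (\<forall>k. \<forall>x\<in>carrier (ob C k). dif C (k - 1) (dif C k x) = \<zero>\<^bsub>ob C (k - 2)\<^esub>) \<and>
     (\<forall>k<0. trivial_module (ob C k))"

definition chain_map ::
    "('r, 'k) ring_scheme \<Rightarrow> ('r, 'm) cplx \<Rightarrow> ('r, 'n) cplx \<Rightarrow> (int \<Rightarrow> 'm \<Rightarrow> 'n) \<Rightarrow> bool" where
  "chain_map R C D f \<longleftrightarrow> chain_complex R C \<and> chain_complex R D \<and>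
     (\<forall>k. f k \<in> lin_maps R (ob C k) (ob D k)) \<and>
     (\<forall>k. \<forall>x\<in>carrier (ob C k). f (k - 1) (dif C k x) = dif D k (f k x))"

definition boundaries :: "('r, 'm) cplx \<Rightarrow> int \<Rightarrow> 'm set" where
  "boundaries C k = dif C (k + 1) ` carrier (ob C (k + 1))"

definition cycles_module :: "('r, 'm) cplx \<Rightarrow> int \<Rightarrow> ('r, 'm) module" where
  "cycles_module C k = (ob C k)\<lparr>carrier := a_kernel (ob C k) (ob C (k - 1)) (dif C k)\<rparr>"

definition homology :: "('r, 'm) cplx \<Rightarrow> int \<Rightarrow> ('r, 'm set) module" where
  "homology C k = quot_module (cycles_module C k) (boundaries C k)"

definition homology_map ::
    "('r, 'n) cplx \<Rightarrow> (int \<Rightarrow> 'm \<Rightarrow> 'n) \<Rightarrow> int \<Rightarrow> 'm set \<Rightarrow> 'n set" where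
  "homology_map D f k K = boundaries D k <+>\<^bsub>ob D k\<^esub> (f k ` K)"

definition quasi_iso ::
    "('r, 'k) ring_scheme \<Rightarrow> ('r, 'm) cplx \<Rightarrow> ('r, 'n) cplx \<Rightarrow> (int \<Rightarrow> 'm \<Rightarrow> 'n) \<Rightarrow> bool" where
  "quasi_iso R C D f \<longleftrightarrow> chain_map R C D f \<and>
     (\<forall>k. bij_betw (homology_map D f k) (carrier (homology C k)) (carrier (homology D k)))"

text \<open>The mapping cone: \<open>C\<^sub>k\<^sub>-\<^sub>1 \<oplus> D\<^sub>k\<close> with differential \<open>(x, y) \<mapsto> (- d x, f x + d y)\<close>.\<close>

definition cone :: "('r, 'm) cplx \<Rightarrow> ('r, 'n) cplx \<Rightarrow> (int \<Rightarrow> 'm \<Rightarrow> 'n) \<Rightarrow> ('r, 'm \<times> 'n) cplx" where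
  "cone C D f = \<lparr>ob = (\<lambda>k. dsum_module (ob C (k - 1)) (ob D k)),
     dif = (\<lambda>k (x, y). (\<ominus>\<^bsub>ob C (k - 2)\<^esub> dif C (k - 1) x, f (k - 1) x \<oplus>\<^bsub>ob D (k - 1)\<^esub> dif D k y))\<rparr>"

definition connected_map :: "int \<Rightarrow> ('r, 'm) cplx \<Rightarrow> ('r, 'n) cplx \<Rightarrow> (int \<Rightarrow> 'm \<Rightarrow> 'n) \<Rightarrow> bool" where
  "connected_map m C D f \<longleftrightarrow> (\<forall>q\<le>m. trivial_module (homology (cone C D f) q))"

definition levelwise_inj :: "('r, 'm) cplx \<Rightarrow> (int \<Rightarrow> 'm \<Rightarrow> 'n) \<Rightarrow> bool" where
  "levelwise_inj C f \<longleftrightarrow> (\<forall>k. inj_on (f k) (carrier (ob C k)))"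

text \<open>The quotient complex \<open>D / f(C)\<close> for a chain map \<open>f\<close> from \<open>C\<close> to \<open>D\<close>.\<close>

definition quot_cplx ::
    "('r, 'm) cplx \<Rightarrow> ('r, 'n) cplx \<Rightarrow> (int \<Rightarrow> 'm \<Rightarrow> 'n) \<Rightarrow> ('r, 'n set) cplx" where
  "quot_cplx C D f = \<lparr>ob = (\<lambda>k. quot_module (ob D k) (f k ` carrier (ob C k))),
     dif = (\<lambda>k K. (f (k - 1) ` carrier (ob C (k - 1))) <+>\<^bsub>ob D (k - 1)\<^esub> (dif D k ` K))\<rparr>"

definition homology_concentrated_in :: "int \<Rightarrow> ('r, 'm) cplx \<Rightarrow> bool" where
  "homology_concentrated_in q C \<longleftrightarrow> (\<forall>k. k \<noteq> q \<longrightarrow> trivial_module (homology C k))"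


section \<open>Perfect complexes\<close>

definition strictly_perfect :: "('r, 'k) ring_scheme \<Rightarrow> ('r, 'm) cplx \<Rightarrow> bool" where
  "strictly_perfect R P \<longleftrightarrow> chain_complex R P \<and>
     (\<exists>N. \<forall>k>N. trivial_module (ob P k)) \<and> (\<forall>k. fg_projective R (ob P k))"

definition quasi_iso_linked :: "('r, 'k) ring_scheme \<Rightarrow> ('r, 'm) cplx \<Rightarrow> ('r, 'n) cplx \<Rightarrow> bool" where
  "quasi_iso_linked R C D \<longleftrightarrow> (\<exists>f. quasi_iso R C D f) \<or> (\<exists>g. quasi_iso R D C g)"

text \<open>Restriction of scalars along \<open>A \<rightarrow> A[t]\<close>.\<close>

definition restrict_module ::
    "('a, 'k) ring_scheme \<Rightarrow> (nat \<Rightarrow> 'a, 'm) module \<Rightarrow> ('a, 'm) module" where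
  "restrict_module A M = \<lparr>carrier = carrier M, mult = mult M, one = one M,
     zero = zero M, add = add M, smult = (\<lambda>a x. monom (UP A) a 0 \<odot>\<^bsub>M\<^esub> x)\<rparr>"

definition restrict_cplx ::
    "('a, 'k) ring_scheme \<Rightarrow> (nat \<Rightarrow> 'a, 'm) cplx \<Rightarrow> ('a, 'm) cplx" where
  "restrict_cplx A C = \<lparr>ob = (\<lambda>k. restrict_module A (ob C k)), dif = dif C\<rparr>"

text \<open>
  A zig-zag starts at the given complex; all its other terms have elements in the type \<open>'u\<close>, which
  plays the role of a universe and is passed explicitly since it cannot be quantified existentially.
\<close>

definition perfect_over ::
    "'u itself \<Rightarrow> ('a, 'k) ring_scheme \<Rightarrow> (nat \<Rightarrow> 'a, 'm) cplx \<Rightarrow> bool" where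
  "perfect_over U A C \<longleftrightarrow> chain_complex (UP A) C \<and>
     (\<exists>(D :: ('a, 'u) cplx) (P :: ('a, 'u) cplx).
        quasi_iso_linked A (restrict_cplx A C) D \<and> (quasi_iso_linked A)\<^sup>*\<^sup>* D P \<and>
        strictly_perfect A P)"


section \<open>Torsion\<close>

definition centric :: "('a, 'k) ring_scheme \<Rightarrow> (nat \<Rightarrow> 'a) \<Rightarrow> bool" where
  "centric A p \<longleftrightarrow> p \<in> carrier (UP A) \<and>
     (\<forall>r\<in>carrier (UP A). p \<otimes>\<^bsub>UP A\<^esub> r = r \<otimes>\<^bsub>UP A\<^esub> p)"

definition monic :: "('a, 'k) ring_scheme \<Rightarrow> (nat \<Rightarrow> 'a) \<Rightarrow> bool" where
  "monic A p \<longleftrightarrow> p \<in> carrier (UP A) \<and> coeff (UP A) p (deg A p) = \<one>\<^bsub>A\<^esub>"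

definition torsion_module :: "'r set \<Rightarrow> ('r, 'm) module \<Rightarrow> bool" where
  "torsion_module S M \<longleftrightarrow> (\<exists>p\<in>S. \<forall>x\<in>carrier M. p \<odot>\<^bsub>M\<^esub> x = \<zero>\<^bsub>M\<^esub>)"

definition torsion_cplx :: "'r set \<Rightarrow> ('r, 'm) cplx \<Rightarrow> bool" where
  "torsion_cplx S C \<longleftrightarrow>
     (\<exists>p\<in>S. \<forall>k. \<forall>x\<in>carrier (homology C k). p \<odot>\<^bsub>homology C k\<^esub> x = \<zero>\<^bsub>homology C k\<^esub>)"


section \<open>Filtrations by elementary extensions\<close>

definition elementary_extension ::
    "('a, 'k) ring_scheme \<Rightarrow> (nat \<Rightarrow> 'a) set \<Rightarrow> int \<Rightarrow>
     (nat \<Rightarrow> 'a, 'm) cplx \<Rightarrow> (nat \<Rightarrow> 'a, 'n) cplx \<Rightarrow> (int \<Rightarrow> 'm \<Rightarrow> 'n) \<Rightarrow> bool" where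
  "elementary_extension A S q C D i \<longleftrightarrow>
     chain_map (UP A) C D i \<and> levelwise_inj C i \<and>
     homology_concentrated_in q (quot_cplx C D i) \<and>
     torsion_module S (homology (quot_cplx C D i) q) \<and>
     fg_projective A (restrict_module A (homology (quot_cplx C D i) q))"

text \<open>
  For \<open>j : X \<rightarrow> Z\<^sub>a\<close> and \<open>i\<^sub>q : Z\<^sub>q\<^sub>-\<^sub>1 \<rightarrow> Z\<^sub>q\<close> the composite \<open>X \<rightarrow> Z\<^sub>a \<rightarrow> \<dots> \<rightarrow> Z\<^bsub>a+l\<^esub>\<close>.
\<close>

primrec composite ::
    "int \<Rightarrow> (int \<Rightarrow> 'x \<Rightarrow> 'z) \<Rightarrow> (int \<Rightarrow> int \<Rightarrow> 'z \<Rightarrow> 'z) \<Rightarrow> nat \<Rightarrow> int \<Rightarrow> 'x \<Rightarrow> 'z" where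
  "composite a j i 0 = j"
| "composite a j i (Suc l) = (\<lambda>k x. i (a + int (Suc l)) k (composite a j i l k x))"

end

theory Submission
  imports Defs
begin

text \<open>
  The homology of the cone of \<open>X \<rightarrow> Y\<close> is killed from the bottom up.  Over \<open>A\<close> the cone is perfect, so
  its lowest homology \<open>H\<^sub>q\<close> is finitely generated over \<open>A\<close>, and it is killed by some \<open>p \<in> S\<close>
  (\<open>perf_low\<close>, \<open>torsion_cone\<close>).  Hence it is a quotient of a sum \<open>M\<close> of copies of \<open>A[t]/(p)\<close>, which is
  \<open>S\<close>-torsion and, as \<open>p\<close> is monic, finitely generated free over \<open>A\<close> (\<open>companion_cover\<close>).

  Any \<open>A[t]\<close>-module \<open>M\<close> that is projective over \<open>A\<close> can be attached in degree \<open>q\<close> along a map from \<open>M\<close>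
  to \<open>H\<^sub>q\<close>.  For this \<open>M\<close> is replaced by the complex \<open>M[t] \<rightarrow> M[t]\<close>, the difference of the two actions
  of \<open>t\<close>, which resolves it (\<open>poly_decomp\<close>, \<open>char_map_inj\<close>).  Its terms are induced from \<open>A\<close>, so to map
  it to the cone only \<open>A\<close>-linear choices have to be made, and these exist because \<open>M\<close> is projective
  (\<open>resolution_map\<close>).  A chain map from a complex \<open>K\<close> to the cone of \<open>W \<rightarrow> Y\<close> is the same as a complex
  containing \<open>W\<close> with quotient \<open>K\<close> and an extension of \<open>W \<rightarrow> Y\<close> to it, and the cone of the extension is
  the cone of that chain map (locale \<open>attaching\<close>).  So if \<open>M \<rightarrow> H\<^sub>q\<close> is onto, the new cone has no
  homology up to degree \<open>q\<close>; if it is bijective and \<open>H\<^sub>q\<close> is the only homology, the new cone is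
  acyclic (\<open>attach_module\<close>).

  The process ends because attaching in degree \<open>q\<close> does not raise the amplitude of the cone above
  \<open>q + 1\<close>.  Once \<open>q\<close> reaches the amplitude of the cone, the lowest homology is the only one and is
  itself projective over \<open>A\<close>, and is attached as it is.

  That perfection survives extensions and can be moved along quasi-isomorphisms in both directions
  (\<open>perf_ses\<close>, \<open>perf_qi_rev\<close>) rests on one fact: a map from a bounded complex of projectives to an
  acyclic complex is null-homotopic (\<open>null_homotopy\<close>).
\<close>

section \<open>Linear maps and submodules\<close>

lemma lin_mapsI:
  assumes "\<And>x. x \<in> carrier M \<Longrightarrow> h x \<in> carrier N"
    and "\<And>x y. \<lbrakk>x \<in> carrier M; y \<in> carrier M\<rbrakk> \<Longrightarrow> h (x \<oplus>\<^bsub>M\<^esub> y) = h x \<oplus>\<^bsub>N\<^esub> h y"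
    and "\<And>a x. \<lbrakk>a \<in> carrier R; x \<in> carrier M\<rbrakk> \<Longrightarrow> h (a \<odot>\<^bsub>M\<^esub> x) = a \<odot>\<^bsub>N\<^esub> h x"
  shows "h \<in> lin_maps R M N"
  using assms by (auto simp: lin_maps_def)

lemma lin_maps_closed: "h \<in> lin_maps R M N \<Longrightarrow> x \<in> carrier M \<Longrightarrow> h x \<in> carrier N"
  and lin_maps_add: "h \<in> lin_maps R M N \<Longrightarrow> x \<in> carrier M \<Longrightarrow> y \<in> carrier M \<Longrightarrow>
    h (x \<oplus>\<^bsub>M\<^esub> y) = h x \<oplus>\<^bsub>N\<^esub> h y"
  and lin_maps_smult: "h \<in> lin_maps R M N \<Longrightarrow> a \<in> carrier R \<Longrightarrow> x \<in> carrier M \<Longrightarrow>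
    h (a \<odot>\<^bsub>M\<^esub> x) = a \<odot>\<^bsub>N\<^esub> h x"
  by (auto simp: lin_maps_def)

lemma right_module_group: "right_module R M \<Longrightarrow> abelian_group M"
  and right_module_ring: "right_module R M \<Longrightarrow> ring R"
  by (auto simp: right_module_def)

lemma right_moduleI':
  assumes "ring R" and "abelian_group M"
    and "\<And>a x. \<lbrakk>a \<in> carrier R; x \<in> carrier M\<rbrakk> \<Longrightarrow> a \<odot>\<^bsub>M\<^esub> x \<in> carrier M"
    and "\<And>a b x. \<lbrakk>a \<in> carrier R; b \<in> carrier R; x \<in> carrier M\<rbrakk> \<Longrightarrow>
        (a \<oplus>\<^bsub>R\<^esub> b) \<odot>\<^bsub>M\<^esub> x = a \<odot>\<^bsub>M\<^esub> x \<oplus>\<^bsub>M\<^esub> b \<odot>\<^bsub>M\<^esub> x"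
    and "\<And>a x y. \<lbrakk>a \<in> carrier R; x \<in> carrier M; y \<in> carrier M\<rbrakk> \<Longrightarrow>
        a \<odot>\<^bsub>M\<^esub> (x \<oplus>\<^bsub>M\<^esub> y) = a \<odot>\<^bsub>M\<^esub> x \<oplus>\<^bsub>M\<^esub> a \<odot>\<^bsub>M\<^esub> y"
    and "\<And>a b x. \<lbrakk>a \<in> carrier R; b \<in> carrier R; x \<in> carrier M\<rbrakk> \<Longrightarrow>
        (a \<otimes>\<^bsub>R\<^esub> b) \<odot>\<^bsub>M\<^esub> x = b \<odot>\<^bsub>M\<^esub> (a \<odot>\<^bsub>M\<^esub> x)"
    and "\<And>x. x \<in> carrier M \<Longrightarrow> \<one>\<^bsub>R\<^esub> \<odot>\<^bsub>M\<^esub> x = x"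
  shows "right_module R M"
  using assms by (auto simp: right_module_def right_module_axioms_def)

text \<open>
  Ordered rewriting of a sum does not bring \<open>x\<close> and \<open>\<ominus> x\<close> together, so the normal form needs rules that
  cancel them across intermediate terms.
\<close>

lemma (in abelian_group) eq_if_minus_zero:
  "x \<in> carrier G \<Longrightarrow> y \<in> carrier G \<Longrightarrow> x \<oplus> \<ominus> y = \<zero> \<Longrightarrow> x = y"
  by (metis a_inv_closed a_inv_inj minus_equality minus_minus)

lemma (in abelian_group) neg_cancel1:
  "x \<in> carrier G \<Longrightarrow> y \<in> carrier G \<Longrightarrow> x \<oplus> (\<ominus> x \<oplus> y) = y"
  by (metis a_assoc a_inv_closed l_zero r_neg)

lemma (in abelian_group) neg_cancel2:
  "x \<in> carrier G \<Longrightarrow> y \<in> carrier G \<Longrightarrow> \<ominus> x \<oplus> (x \<oplus> y) = y"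
  by (metis a_assoc a_inv_closed l_zero l_neg)

lemma (in abelian_group) neg_cancel3:
  assumes "x \<in> carrier G" "y \<in> carrier G"
  shows "x \<oplus> (y \<oplus> \<ominus> x) = y" "\<ominus> x \<oplus> (y \<oplus> x) = y"
    "z \<in> carrier G \<Longrightarrow> x \<oplus> (y \<oplus> (\<ominus> x \<oplus> z)) = y \<oplus> z"
    "z \<in> carrier G \<Longrightarrow> \<ominus> x \<oplus> (y \<oplus> (x \<oplus> z)) = y \<oplus> z"
  using assms
  by (simp_all add: a_comm[of y "\<ominus> x"] a_comm[of y x] a_lcomm[of y "\<ominus> x" z] a_lcomm[of y x z]
      neg_cancel1 neg_cancel2)

lemma (in abelian_group) neg_cancel4:
  assumes "x \<in> carrier G" "y \<in> carrier G" "z \<in> carrier G"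
  shows "x \<oplus> (y \<oplus> (z \<oplus> \<ominus> x)) = y \<oplus> z" "\<ominus> x \<oplus> (y \<oplus> (z \<oplus> x)) = y \<oplus> z"
  using assms neg_cancel3(1,2)[of x "y \<oplus> z"] by (simp_all add: a_assoc)

lemmas (in abelian_group) grp = a_assoc a_comm a_lcomm minus_add minus_minus r_neg l_neg
  neg_cancel1 neg_cancel2 neg_cancel3 neg_cancel4

lemma (in abelian_group) idem_zero: "x \<in> carrier G \<Longrightarrow> x \<oplus> x = x \<Longrightarrow> x = \<zero>"
  by (metis a_assoc a_inv_closed r_neg r_zero)

lemma (in abelian_group) neg_zero [simp]: "\<ominus> \<zero> = \<zero>"
  by (rule minus_equality) simp_all

context right_module
begin

lemma smult_zero_r [simp]: "a \<in> carrier R \<Longrightarrow> a \<odot>\<^bsub>M\<^esub> \<zero>\<^bsub>M\<^esub> = \<zero>\<^bsub>M\<^esub>"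
  by (rule M.idem_zero) (simp_all add: smult_closed flip: smult_r_distr)

lemma smult_zero_l [simp]: "x \<in> carrier M \<Longrightarrow> \<zero>\<^bsub>R\<^esub> \<odot>\<^bsub>M\<^esub> x = \<zero>\<^bsub>M\<^esub>"
  by (rule M.idem_zero) (simp_all add: smult_closed flip: smult_l_distr)

lemma smult_minus_r: "a \<in> carrier R \<Longrightarrow> x \<in> carrier M \<Longrightarrow> a \<odot>\<^bsub>M\<^esub> (\<ominus>\<^bsub>M\<^esub> x) = \<ominus>\<^bsub>M\<^esub> (a \<odot>\<^bsub>M\<^esub> x)"
  by (rule M.minus_equality[symmetric]) (simp_all add: smult_closed M.l_neg flip: smult_r_distr)

lemma smult_minus_l: "a \<in> carrier R \<Longrightarrow> x \<in> carrier M \<Longrightarrow> (\<ominus>\<^bsub>R\<^esub> a) \<odot>\<^bsub>M\<^esub> x = \<ominus>\<^bsub>M\<^esub> (a \<odot>\<^bsub>M\<^esub> x)"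
  by (rule M.minus_equality[symmetric]) (simp_all add: smult_closed R.l_neg flip: smult_l_distr)

lemmas modsimps = smult_closed smult_l_distr smult_r_distr smult_one smult_minus_r smult_minus_l

end

lemma lin_maps_zero:
  assumes "h \<in> lin_maps R M N" "abelian_group M" "abelian_group N"
  shows "h \<zero>\<^bsub>M\<^esub> = \<zero>\<^bsub>N\<^esub>"
proof -
  interpret M: abelian_group M by fact
  interpret N: abelian_group N by fact
  show ?thesis
    by (rule N.idem_zero)
      (auto simp: lin_maps_closed[OF assms(1)] simp flip: lin_maps_add[OF assms(1)])
qed

lemma lin_maps_minus:
  assumes "h \<in> lin_maps R M N" "abelian_group M" "abelian_group N" "x \<in> carrier M"
  shows "h (\<ominus>\<^bsub>M\<^esub> x) = \<ominus>\<^bsub>N\<^esub> h x"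
proof -
  interpret M: abelian_group M by fact
  interpret N: abelian_group N by fact
  show ?thesis
    by (rule N.minus_equality[symmetric])
      (auto simp: lin_maps_closed[OF assms(1)] assms lin_maps_zero[OF assms(1-3)] M.l_neg
        simp flip: lin_maps_add[OF assms(1)])
qed

lemma lin_maps_comp:
  "f \<in> lin_maps R M N \<Longrightarrow> g \<in> lin_maps R N L \<Longrightarrow> (\<lambda>x. g (f x)) \<in> lin_maps R M L"
  by (rule lin_mapsI) (simp_all add: lin_maps_closed lin_maps_add lin_maps_smult)

lemma lin_maps_id: "(\<lambda>x. x) \<in> lin_maps R M M"
  by (auto simp: lin_maps_def)

lemma lin_maps_zero_map: "right_module R N \<Longrightarrow> (\<lambda>x. \<zero>\<^bsub>N\<^esub>) \<in> lin_maps R M N"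
proof -
  assume "right_module R N"
  then interpret N: right_module R N .
  show ?thesis by (auto simp: lin_maps_def)
qed

lemma lin_maps_plus:
  assumes "right_module R N" "f \<in> lin_maps R M N" "g \<in> lin_maps R M N"
  shows "(\<lambda>x. f x \<oplus>\<^bsub>N\<^esub> g x) \<in> lin_maps R M N"
proof -
  interpret N: right_module R N by fact
  note [simp] = lin_maps_closed[OF assms(2)] lin_maps_closed[OF assms(3)]
    lin_maps_add[OF assms(2)] lin_maps_add[OF assms(3)]
    lin_maps_smult[OF assms(2)] lin_maps_smult[OF assms(3)]
  show ?thesis by (rule lin_mapsI) (auto simp: N.modsimps N.M.grp)
qed

lemma lin_maps_neg:
  assumes "right_module R N" "f \<in> lin_maps R M N"
  shows "(\<lambda>x. \<ominus>\<^bsub>N\<^esub> f x) \<in> lin_maps R M N"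
proof -
  interpret N: right_module R N by fact
  note [simp] = lin_maps_closed[OF assms(2)]
    lin_maps_add[OF assms(2)]
    lin_maps_smult[OF assms(2)]
  show ?thesis by (rule lin_mapsI) (auto simp: N.modsimps N.M.grp)
qed

lemma lin_maps_inv:
  assumes "right_module R M" "right_module R N" "f \<in> lin_maps R M N"
    and bij: "bij_betw f (carrier M) (carrier N)"
  shows "inv_into (carrier M) f \<in> lin_maps R N M"
proof -
  interpret M: right_module R M by fact
  interpret N: right_module R N by fact
  let ?g = "inv_into (carrier M) f"
  have g: "?g y \<in> carrier M" "f (?g y) = y" if "y \<in> carrier N" for y
    using bij that by (auto simp: bij_betw_def f_inv_into_f inv_into_into)
  have eq: "?g y = x" if "x \<in> carrier M" "y = f x" for x y
    using bij that by (auto simp: bij_betw_def)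
  show ?thesis
    by (rule lin_mapsI; (rule eq)?)
      (auto simp: g lin_maps_add[OF assms(3)] lin_maps_smult[OF assms(3)] M.modsimps)
qed

lemma lin_maps_finsum:
  assumes "h \<in> lin_maps R M N" "abelian_group M" "abelian_group N"
    and "finite I" "f \<in> I \<rightarrow> carrier M"
  shows "h (\<Oplus>\<^bsub>M\<^esub>i\<in>I. f i) = (\<Oplus>\<^bsub>N\<^esub>i\<in>I. h (f i))"
proof -
  interpret M: abelian_group M by fact
  interpret N: abelian_group N by fact
  show ?thesis using assms(4,5)
  proof (induction I)
    case empty then show ?case using lin_maps_zero[OF assms(1-3)] by simp
  next
    case (insert i I)
    then have "f \<in> I \<rightarrow> carrier M" "f i \<in> carrier M" by auto
    with insert show ?case
      by (simp add: M.finsum_insert N.finsum_insert lin_maps_add[OF assms(1)]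
          lin_maps_closed[OF assms(1)] Pi_iff M.finsum_closed)
  qed
qed

lemma (in right_module) smult_finsum:
  assumes "a \<in> carrier R" "finite I" "f \<in> I \<rightarrow> carrier M"
  shows "a \<odot>\<^bsub>M\<^esub> (\<Oplus>\<^bsub>M\<^esub>i\<in>I. f i) = (\<Oplus>\<^bsub>M\<^esub>i\<in>I. a \<odot>\<^bsub>M\<^esub> f i)"
  \<comment> \<open>multiplication by \<open>a\<close> is additive, hence linear over the ring with no scalars\<close>
  using assms
  by (intro lin_maps_finsum[where R = "R\<lparr>carrier := {}\<rparr>"])
    (auto simp: modsimps abelian_group_axioms intro!: lin_mapsI)

definition submodule :: "('r, 'k) ring_scheme \<Rightarrow> ('r, 'm) module \<Rightarrow> 'm set \<Rightarrow> bool" where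
  "submodule R M U \<longleftrightarrow> U \<subseteq> carrier M \<and> \<zero>\<^bsub>M\<^esub> \<in> U \<and> (\<forall>x\<in>U. \<forall>y\<in>U. x \<oplus>\<^bsub>M\<^esub> y \<in> U) \<and>
     (\<forall>a\<in>carrier R. \<forall>x\<in>U. a \<odot>\<^bsub>M\<^esub> x \<in> U)"

lemma submodule_neg:
  assumes "right_module R M" "submodule R M U" "x \<in> U"
  shows "\<ominus>\<^bsub>M\<^esub> x \<in> U"
proof -
  interpret M: right_module R M by fact
  have x: "x \<in> carrier M" using assms by (auto simp: submodule_def)
  have "(\<ominus>\<^bsub>R\<^esub> \<one>\<^bsub>R\<^esub>) \<odot>\<^bsub>M\<^esub> x \<in> U" using assms by (auto simp: submodule_def)
  with x show ?thesis by (simp add: M.modsimps)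
qed

lemma right_module_submodule:
  assumes "right_module R M" "submodule R M U"
  shows "right_module R (M\<lparr>carrier := U\<rparr>)"
proof -
  interpret M: right_module R M by fact
  have U: "x \<in> U \<Longrightarrow> x \<in> carrier M" "\<zero>\<^bsub>M\<^esub> \<in> U" "x \<in> U \<Longrightarrow> y \<in> U \<Longrightarrow> x \<oplus>\<^bsub>M\<^esub> y \<in> U"
    "a \<in> carrier R \<Longrightarrow> x \<in> U \<Longrightarrow> a \<odot>\<^bsub>M\<^esub> x \<in> U" for a x y
    using assms(2) by (auto simp: submodule_def)
  have "abelian_group (M\<lparr>carrier := U\<rparr>)"
  proof (rule abelian_groupI)
    fix x assume "x \<in> carrier (M\<lparr>carrier := U\<rparr>)"
    then show "\<exists>y\<in>carrier (M\<lparr>carrier := U\<rparr>). y \<oplus>\<^bsub>M\<lparr>carrier := U\<rparr>\<^esub> x = \<zero>\<^bsub>M\<lparr>carrier := U\<rparr>\<^esub>"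
      using submodule_neg[OF assms] U by (auto intro!: bexI[of _ "\<ominus>\<^bsub>M\<^esub> x"] simp: M.M.l_neg)
  qed (auto simp: U M.M.a_assoc intro!: M.M.a_comm)
  then show ?thesis
    by (intro right_moduleI') (auto simp: U M.modsimps M.smult_assoc M.R.ring_axioms)
qed

lemma coset_mem:
  "y \<in> U +>\<^bsub>M\<^esub> x \<longleftrightarrow> (\<exists>u\<in>U. y = u \<oplus>\<^bsub>M\<^esub> x)"
  by (auto simp: a_r_coset_def')

lemma coset_eq_iff:
  assumes "right_module R M" "submodule R M U" "x \<in> carrier M" "y \<in> carrier M"
  shows "U +>\<^bsub>M\<^esub> x = U +>\<^bsub>M\<^esub> y \<longleftrightarrow> (\<exists>u\<in>U. x = u \<oplus>\<^bsub>M\<^esub> y)"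
proof -
  interpret M: right_module R M by fact
  have U: "u \<in> U \<Longrightarrow> u \<in> carrier M" "\<zero>\<^bsub>M\<^esub> \<in> U" "u \<in> U \<Longrightarrow> v \<in> U \<Longrightarrow> u \<oplus>\<^bsub>M\<^esub> v \<in> U" for u v
    using assms(2) by (auto simp: submodule_def)
  have sub: "U +>\<^bsub>M\<^esub> x \<subseteq> U +>\<^bsub>M\<^esub> y" if "u \<in> U" "x = u \<oplus>\<^bsub>M\<^esub> y" "y \<in> carrier M" for u x y
  proof
    fix z assume "z \<in> U +>\<^bsub>M\<^esub> x"
    then obtain v where "v \<in> U" "z = v \<oplus>\<^bsub>M\<^esub> x" by (auto simp: coset_mem)
    then show "z \<in> U +>\<^bsub>M\<^esub> y" unfolding coset_mem
      by (intro bexI[of _ "v \<oplus>\<^bsub>M\<^esub> u"]) (auto simp: U that M.M.a_assoc)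
  qed
  show ?thesis
  proof
    assume "U +>\<^bsub>M\<^esub> x = U +>\<^bsub>M\<^esub> y"
    moreover have "x \<in> U +>\<^bsub>M\<^esub> x" unfolding coset_mem using U assms by (auto intro!: bexI[of _ "\<zero>\<^bsub>M\<^esub>"])
    ultimately show "\<exists>u\<in>U. x = u \<oplus>\<^bsub>M\<^esub> y" by (simp add: coset_mem)
  next
    assume "\<exists>u\<in>U. x = u \<oplus>\<^bsub>M\<^esub> y"
    then obtain u where u: "u \<in> U" "x = u \<oplus>\<^bsub>M\<^esub> y" by auto
    then have "y = (\<ominus>\<^bsub>M\<^esub> u) \<oplus>\<^bsub>M\<^esub> x" using U assms by (simp add: M.M.neg_cancel2)
    then show "U +>\<^bsub>M\<^esub> x = U +>\<^bsub>M\<^esub> y"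
      using sub[OF u assms(4)] sub[OF submodule_neg[OF assms(1,2) u(1)] _ assms(3)] by auto
  qed
qed

text \<open>
  Scalar multiplication on a quotient, its differential and the maps induced on homology are all given
  by pushing a coset forward and adding the submodule of the target, so they are computed together.
\<close>

lemma coset_push:
  assumes "right_module R N" "submodule R N V" "U \<subseteq> carrier M" "\<zero>\<^bsub>M\<^esub> \<in> U" "abelian_group M"
    and "\<And>x. x \<in> carrier M \<Longrightarrow> h x \<in> carrier N"
    and add: "\<And>x y. x \<in> carrier M \<Longrightarrow> y \<in> carrier M \<Longrightarrow> h (x \<oplus>\<^bsub>M\<^esub> y) = h x \<oplus>\<^bsub>N\<^esub> h y"
    and "h ` U \<subseteq> V" and x: "x \<in> carrier M"
  shows "V <+>\<^bsub>N\<^esub> (h ` (U +>\<^bsub>M\<^esub> x)) = V +>\<^bsub>N\<^esub> h x"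
proof (intro equalityI subsetI)
  interpret N: right_module R N by fact
  interpret M: abelian_group M by fact
  have V: "v \<in> V \<Longrightarrow> v \<in> carrier N" "v \<in> V \<Longrightarrow> w \<in> V \<Longrightarrow> v \<oplus>\<^bsub>N\<^esub> w \<in> V" for v w
    using assms(2) by (auto simp: submodule_def)
  have U: "u \<in> U \<Longrightarrow> u \<in> carrier M" "u \<in> U \<Longrightarrow> h u \<in> V" for u using assms(3,8) by auto
  {
    fix z assume "z \<in> V <+>\<^bsub>N\<^esub> (h ` (U +>\<^bsub>M\<^esub> x))"
    then obtain v u where "v \<in> V" "u \<in> U" "z = v \<oplus>\<^bsub>N\<^esub> h (u \<oplus>\<^bsub>M\<^esub> x)"
      by (auto simp: set_add_def' coset_mem)
    then show "z \<in> V +>\<^bsub>N\<^esub> h x" unfolding coset_mem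
      by (intro bexI[of _ "v \<oplus>\<^bsub>N\<^esub> h u"]) (simp_all add: U V add x assms(6) N.M.a_assoc)
  next
    fix z assume "z \<in> V +>\<^bsub>N\<^esub> h x"
    then obtain v where v: "v \<in> V" "z = v \<oplus>\<^bsub>N\<^esub> h x" by (auto simp: coset_mem)
    have "x \<in> U +>\<^bsub>M\<^esub> x" unfolding coset_mem using assms(4) x by (auto intro!: bexI[of _ "\<zero>\<^bsub>M\<^esub>"])
    with v show "z \<in> V <+>\<^bsub>N\<^esub> (h ` (U +>\<^bsub>M\<^esub> x))" unfolding set_add_def' by auto
  }
qed

lemma coset_add:
  assumes "right_module R M" "submodule R M U" "x \<in> carrier M" "y \<in> carrier M"
  shows "(U +>\<^bsub>M\<^esub> x) <+>\<^bsub>M\<^esub> (U +>\<^bsub>M\<^esub> y) = U +>\<^bsub>M\<^esub> (x \<oplus>\<^bsub>M\<^esub> y)"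
proof -
  interpret M: right_module R M by fact
  have U: "u \<in> U \<Longrightarrow> u \<in> carrier M" "\<zero>\<^bsub>M\<^esub> \<in> U" "u \<in> U \<Longrightarrow> v \<in> U \<Longrightarrow> u \<oplus>\<^bsub>M\<^esub> v \<in> U" for u v
    using assms(2) by (auto simp: submodule_def)
  note xy = assms(3,4)
  show ?thesis
  proof (intro equalityI subsetI)
    fix z assume "z \<in> (U +>\<^bsub>M\<^esub> x) <+>\<^bsub>M\<^esub> (U +>\<^bsub>M\<^esub> y)"
    then obtain u v where "u \<in> U" "v \<in> U" "z = (u \<oplus>\<^bsub>M\<^esub> x) \<oplus>\<^bsub>M\<^esub> (v \<oplus>\<^bsub>M\<^esub> y)"
      by (auto simp: set_add_def' coset_mem)
    then show "z \<in> U +>\<^bsub>M\<^esub> (x \<oplus>\<^bsub>M\<^esub> y)" unfolding coset_mem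
      by (intro bexI[of _ "u \<oplus>\<^bsub>M\<^esub> v"]) (auto simp: U xy M.M.grp)
  next
    fix z assume "z \<in> U +>\<^bsub>M\<^esub> (x \<oplus>\<^bsub>M\<^esub> y)"
    then obtain u where "u \<in> U" "z = u \<oplus>\<^bsub>M\<^esub> (x \<oplus>\<^bsub>M\<^esub> y)" by (auto simp: coset_mem)
    then have "z = (u \<oplus>\<^bsub>M\<^esub> x) \<oplus>\<^bsub>M\<^esub> (\<zero>\<^bsub>M\<^esub> \<oplus>\<^bsub>M\<^esub> y)" using U xy by (auto simp: M.M.grp)
    with \<open>u \<in> U\<close> show "z \<in> (U +>\<^bsub>M\<^esub> x) <+>\<^bsub>M\<^esub> (U +>\<^bsub>M\<^esub> y)"
      unfolding set_add_def' coset_mem using U(2) by (blast intro: coset_mem[THEN iffD2])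
  qed
qed

lemma coset_smult:
  assumes "right_module R M" "submodule R M U" "x \<in> carrier M" "a \<in> carrier R"
  shows "U <+>\<^bsub>M\<^esub> ((\<lambda>x. a \<odot>\<^bsub>M\<^esub> x) ` (U +>\<^bsub>M\<^esub> x)) = U +>\<^bsub>M\<^esub> (a \<odot>\<^bsub>M\<^esub> x)"
proof -
  interpret M: right_module R M by fact
  show ?thesis
    by (rule coset_push[OF assms(1,2)])
      (use assms(2-4) in \<open>auto simp: submodule_def M.modsimps M.M.abelian_group_axioms\<close>)
qed

lemma quot_module_sel [simp]:
  "carrier (quot_module M U) = {U +>\<^bsub>M\<^esub> x | x. x \<in> carrier M}"
  "\<zero>\<^bsub>quot_module M U\<^esub> = U" "K \<oplus>\<^bsub>quot_module M U\<^esub> L = K <+>\<^bsub>M\<^esub> L"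
  "a \<odot>\<^bsub>quot_module M U\<^esub> K = U <+>\<^bsub>M\<^esub> ((\<lambda>x. a \<odot>\<^bsub>M\<^esub> x) ` K)"
  by (auto simp: quot_module_def A_RCOSETS_def')

lemma coset_zero:
  assumes "right_module R M" "submodule R M U"
  shows "U +>\<^bsub>M\<^esub> \<zero>\<^bsub>M\<^esub> = U"
proof -
  interpret M: right_module R M by fact
  have "u \<oplus>\<^bsub>M\<^esub> \<zero>\<^bsub>M\<^esub> = u" if "u \<in> U" for u
    using that assms(2) by (auto simp: submodule_def)
  then show ?thesis unfolding a_r_coset_def' by auto
qed

lemma right_module_quot:
  assumes "right_module R M" "submodule R M U"
  shows "right_module R (quot_module M U)"
proof -
  interpret M: right_module R M by fact
  have plus: "(U +>\<^bsub>M\<^esub> x) <+>\<^bsub>M\<^esub> (U +>\<^bsub>M\<^esub> y) = U +>\<^bsub>M\<^esub> (x \<oplus>\<^bsub>M\<^esub> y)"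
    if "x \<in> carrier M" "y \<in> carrier M" for x y using coset_add[OF assms that] .
  have smul: "U <+>\<^bsub>M\<^esub> ((\<lambda>x. a \<odot>\<^bsub>M\<^esub> x) ` (U +>\<^bsub>M\<^esub> x)) = U +>\<^bsub>M\<^esub> (a \<odot>\<^bsub>M\<^esub> x)"
    if "x \<in> carrier M" "a \<in> carrier R" for x a using coset_smult[OF assms that] .
  have z: "\<exists>x. U = U +>\<^bsub>M\<^esub> x \<and> x \<in> carrier M"
    using coset_zero[OF assms] M.M.zero_closed by metis
  have zplus: "U <+>\<^bsub>M\<^esub> (U +>\<^bsub>M\<^esub> x) = U +>\<^bsub>M\<^esub> x" if "x \<in> carrier M" for x
    using plus[OF M.M.zero_closed that] that by (simp add: coset_zero[OF assms])
  have E: "\<exists>x\<in>carrier M. K = U +>\<^bsub>M\<^esub> x" if "K \<in> carrier (quot_module M U)" for K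
    using that by auto
  have I: "U +>\<^bsub>M\<^esub> x \<in> carrier (quot_module M U)" if "x \<in> carrier M" for x
    using that by auto
  have "abelian_group (quot_module M U)"
  proof (rule abelian_groupI)
    fix K assume "K \<in> carrier (quot_module M U)"
    then obtain x where x: "x \<in> carrier M" "K = U +>\<^bsub>M\<^esub> x" by auto
    then have "(U +>\<^bsub>M\<^esub> (\<ominus>\<^bsub>M\<^esub> x)) \<oplus>\<^bsub>quot_module M U\<^esub> K = \<zero>\<^bsub>quot_module M U\<^esub>"
      by (simp add: plus M.M.l_neg coset_zero[OF assms])
    moreover have "U +>\<^bsub>M\<^esub> (\<ominus>\<^bsub>M\<^esub> x) \<in> carrier (quot_module M U)" using x by auto
    ultimately show "\<exists>L\<in>carrier (quot_module M U). L \<oplus>\<^bsub>quot_module M U\<^esub> K = \<zero>\<^bsub>quot_module M U\<^esub>"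
      by blast
  next
    fix x y assume "x \<in> carrier (quot_module M U)" "y \<in> carrier (quot_module M U)"
    then show "x \<oplus>\<^bsub>quot_module M U\<^esub> y = y \<oplus>\<^bsub>quot_module M U\<^esub> x" by (auto simp: plus M.M.a_comm)
  next
    show "\<zero>\<^bsub>quot_module M U\<^esub> \<in> carrier (quot_module M U)" using z by auto
  qed (auto simp: plus M.M.a_assoc zplus simp del: quot_module_sel(1) dest!: E intro!: I)
  moreover have "right_module_axioms R (quot_module M U)"
  proof (rule right_module_axioms.intro)
    fix a K assume a: "a \<in> carrier R" and "K \<in> carrier (quot_module M U)"
    then obtain x where x: "x \<in> carrier M" "K = U +>\<^bsub>M\<^esub> x" by auto
    then show "a \<odot>\<^bsub>quot_module M U\<^esub> K \<in> carrier (quot_module M U)"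
      using I[OF M.smult_closed[OF a x(1)]] a by (simp add: smul del: quot_module_sel(1))
    fix b assume b: "b \<in> carrier R"
    show "(a \<oplus>\<^bsub>R\<^esub> b) \<odot>\<^bsub>quot_module M U\<^esub> K
      = a \<odot>\<^bsub>quot_module M U\<^esub> K \<oplus>\<^bsub>quot_module M U\<^esub> b \<odot>\<^bsub>quot_module M U\<^esub> K"
      "(a \<otimes>\<^bsub>R\<^esub> b) \<odot>\<^bsub>quot_module M U\<^esub> K
      = b \<odot>\<^bsub>quot_module M U\<^esub> (a \<odot>\<^bsub>quot_module M U\<^esub> K)"
      using a b x by (simp_all add: smul plus M.modsimps M.smult_assoc)
  next
    fix a K L assume a: "a \<in> carrier R"
      and "K \<in> carrier (quot_module M U)" "L \<in> carrier (quot_module M U)"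
    then obtain x y where "x \<in> carrier M" "K = U +>\<^bsub>M\<^esub> x" "y \<in> carrier M" "L = U +>\<^bsub>M\<^esub> y" by auto
    with a show "a \<odot>\<^bsub>quot_module M U\<^esub> (K \<oplus>\<^bsub>quot_module M U\<^esub> L)
      = a \<odot>\<^bsub>quot_module M U\<^esub> K \<oplus>\<^bsub>quot_module M U\<^esub> a \<odot>\<^bsub>quot_module M U\<^esub> L"
      by (simp add: smul plus M.modsimps)
  next
    fix K assume "K \<in> carrier (quot_module M U)"
    then obtain x where "x \<in> carrier M" "K = U +>\<^bsub>M\<^esub> x" by auto
    then show "\<one>\<^bsub>R\<^esub> \<odot>\<^bsub>quot_module M U\<^esub> K = K" by (simp add: smul M.modsimps)
  qed
  ultimately show ?thesis by (simp add: right_module_def M.R.ring_axioms)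
qed

lemma lin_maps_coset:
  assumes "right_module R M" "submodule R M U"
  shows "(\<lambda>x. U +>\<^bsub>M\<^esub> x) \<in> lin_maps R M (quot_module M U)"
proof -
  interpret M: right_module R M by fact
  show ?thesis
    by (rule lin_mapsI) (auto simp: coset_add[OF assms] coset_smult[OF assms])
qed

section \<open>Finitely generated projective modules\<close>

lemma free_module_sel [simp]:
  "c \<in> carrier (free_module R I) \<longleftrightarrow>
     (\<forall>i. c i \<in> carrier R) \<and> finite {i. c i \<noteq> \<zero>\<^bsub>R\<^esub>} \<and> (\<forall>i. i \<notin> I \<longrightarrow> c i = \<zero>\<^bsub>R\<^esub>)"
  "\<zero>\<^bsub>free_module R I\<^esub> = (\<lambda>i. \<zero>\<^bsub>R\<^esub>)"
  "c \<oplus>\<^bsub>free_module R I\<^esub> e = (\<lambda>i. c i \<oplus>\<^bsub>R\<^esub> e i)"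
  "a \<odot>\<^bsub>free_module R I\<^esub> c = (\<lambda>i. c i \<otimes>\<^bsub>R\<^esub> a)"
  by (simp_all add: free_module_def)

lemma right_module_free:
  assumes "ring R"
  shows "right_module R (free_module R I)"
proof -
  interpret ring R by fact
  have fin: "finite {i. c i \<oplus>\<^bsub>R\<^esub> e i \<noteq> \<zero>\<^bsub>R\<^esub>}"
    if "finite {i. c i \<noteq> \<zero>\<^bsub>R\<^esub>}" "finite {i. e i \<noteq> \<zero>\<^bsub>R\<^esub>}" "\<forall>i. e i \<in> carrier R" for c e :: "'c \<Rightarrow> 'a"
    by (rule finite_subset[of _ "{i. c i \<noteq> \<zero>\<^bsub>R\<^esub>} \<union> {i. e i \<noteq> \<zero>\<^bsub>R\<^esub>}"]) (use that in auto)
  have fin': "finite {i. c i \<otimes>\<^bsub>R\<^esub> a \<noteq> \<zero>\<^bsub>R\<^esub>}"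
    if "finite {i. c i \<noteq> \<zero>\<^bsub>R\<^esub>}" "a \<in> carrier R" for c :: "'c \<Rightarrow> 'a" and a
    by (rule finite_subset[OF _ that(1)]) (use that in auto)
  have "abelian_group (free_module R I)"
  proof (rule abelian_groupI)
    fix c assume c: "c \<in> carrier (free_module R I)"
    have "finite {i. \<ominus>\<^bsub>R\<^esub> c i \<noteq> \<zero>\<^bsub>R\<^esub>}"
      by (rule finite_subset[of _ "{i. c i \<noteq> \<zero>\<^bsub>R\<^esub>}"]) (use c in auto)
    with c show "\<exists>e\<in>carrier (free_module R I). e \<oplus>\<^bsub>free_module R I\<^esub> c = \<zero>\<^bsub>free_module R I\<^esub>"
      by (intro bexI[of _ "\<lambda>i. \<ominus>\<^bsub>R\<^esub> c i"]) (auto simp: l_neg)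
  qed (auto simp: a_ac fin)
  then show ?thesis
    by (intro right_moduleI') (auto simp: assms fin' l_distr r_distr m_assoc)
qed

definition basis_vec :: "('r, 'k) ring_scheme \<Rightarrow> 'i \<Rightarrow> 'i \<Rightarrow> 'r" where
  "basis_vec R i = (\<lambda>j. if j = i then \<one>\<^bsub>R\<^esub> else \<zero>\<^bsub>R\<^esub>)"

lemma basis_vec_closed:
  assumes "ring R" "i \<in> I"
  shows "basis_vec R i \<in> carrier (free_module R I)"
proof -
  interpret ring R by fact
  show ?thesis using assms(2) by (auto simp: basis_vec_def)
qed

lemma free_module_expand:
  assumes "right_module R N" "finite I" "h \<in> lin_maps R (free_module R I) N"
    "c \<in> carrier (free_module R I)"
  shows "h c = (\<Oplus>\<^bsub>N\<^esub>i\<in>I. c i \<odot>\<^bsub>N\<^esub> h (basis_vec R i))"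
proof -
  interpret N: right_module R N by fact
  let ?F = "free_module R I"
  interpret F: right_module R ?F by (rule right_module_free) (rule N.R.ring_axioms)
  have hb: "i \<in> I \<Longrightarrow> h (basis_vec R i) \<in> carrier N" for i
    by (rule lin_maps_closed[OF assms(3)]) (rule basis_vec_closed[OF N.R.ring_axioms])
  have *: "h (\<lambda>i. if i \<in> J then c i else \<zero>\<^bsub>R\<^esub>) = (\<Oplus>\<^bsub>N\<^esub>i\<in>J. c i \<odot>\<^bsub>N\<^esub> h (basis_vec R i))"
    if "finite J" "J \<subseteq> I" for J
    using that
  proof (induction J)
    case empty
    show ?case
      using lin_maps_zero[OF assms(3) F.abelian_group_axioms N.abelian_group_axioms] by simp
  next
    case (insert j J)
    let ?c' = "\<lambda>i. if i \<in> J then c i else \<zero>\<^bsub>R\<^esub>"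
    have c': "?c' \<in> carrier ?F" using assms(4) insert.prems
      by (auto intro: finite_subset[of _ "{i. c i \<noteq> \<zero>\<^bsub>R\<^esub>}"])
    have b: "basis_vec R j \<in> carrier ?F"
      using insert.prems by (intro basis_vec_closed) (auto simp: N.R.ring_axioms)
    have cj: "c j \<in> carrier R" using assms(4) by auto
    have "(\<lambda>i. if i \<in> insert j J then c i else \<zero>\<^bsub>R\<^esub>)
        = c j \<odot>\<^bsub>?F\<^esub> basis_vec R j \<oplus>\<^bsub>?F\<^esub> ?c'"
      using assms(4) insert.hyps by (auto simp: basis_vec_def fun_eq_iff)
    then have "h (\<lambda>i. if i \<in> insert j J then c i else \<zero>\<^bsub>R\<^esub>)
        = h (c j \<odot>\<^bsub>?F\<^esub> basis_vec R j) \<oplus>\<^bsub>N\<^esub> h ?c'"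
      using lin_maps_add[OF assms(3) F.smult_closed[OF cj b] c'] by simp
    also have "h (c j \<odot>\<^bsub>?F\<^esub> basis_vec R j) = c j \<odot>\<^bsub>N\<^esub> h (basis_vec R j)"
      by (rule lin_maps_smult[OF assms(3) cj b])
    finally show ?case using insert assms(4) hb
      by (auto simp: N.M.finsum_insert N.smult_closed Pi_iff subset_iff)
  qed
  have "(\<lambda>i. if i \<in> I then c i else \<zero>\<^bsub>R\<^esub>) = c" using assms(4) by auto
  then show ?thesis using *[OF assms(2)] by simp
qed

definition free_ext :: "'i set \<Rightarrow> ('r, 'n) module \<Rightarrow> ('i \<Rightarrow> 'n) \<Rightarrow> ('i \<Rightarrow> 'r) \<Rightarrow> 'n" where
  "free_ext I N s c = (\<Oplus>\<^bsub>N\<^esub>i\<in>I. c i \<odot>\<^bsub>N\<^esub> s i)"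

lemma free_ext_lin:
  assumes "right_module R N" "finite I" "s \<in> I \<rightarrow> carrier N"
  shows "free_ext I N s \<in> lin_maps R (free_module R I) N"
proof -
  interpret N: right_module R N by fact
  show ?thesis
  proof (rule lin_mapsI)
    fix a c assume *: "a \<in> carrier R" "c \<in> carrier (free_module R I)"
    have "a \<odot>\<^bsub>N\<^esub> (\<Oplus>\<^bsub>N\<^esub>i\<in>I. c i \<odot>\<^bsub>N\<^esub> s i) = (\<Oplus>\<^bsub>N\<^esub>i\<in>I. a \<odot>\<^bsub>N\<^esub> (c i \<odot>\<^bsub>N\<^esub> s i))"
      using * assms by (intro N.smult_finsum) (auto simp: N.smult_closed Pi_iff)
    then show "free_ext I N s (a \<odot>\<^bsub>free_module R I\<^esub> c) = a \<odot>\<^bsub>N\<^esub> free_ext I N s c"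
      using * assms(3) unfolding free_ext_def
      by (auto simp: N.smult_assoc N.modsimps Pi_iff intro!: N.M.finsum_cong')
  next
    fix c e assume "c \<in> carrier (free_module R I)" "e \<in> carrier (free_module R I)"
    with assms(3) have "(\<Oplus>\<^bsub>N\<^esub>i\<in>I. (c i \<oplus>\<^bsub>R\<^esub> e i) \<odot>\<^bsub>N\<^esub> s i)
      = (\<Oplus>\<^bsub>N\<^esub>i\<in>I. c i \<odot>\<^bsub>N\<^esub> s i \<oplus>\<^bsub>N\<^esub> e i \<odot>\<^bsub>N\<^esub> s i)"
      by (intro N.M.finsum_cong') (auto simp: N.modsimps Pi_iff)
    with \<open>c \<in> _\<close> \<open>e \<in> _\<close> show "free_ext I N s (c \<oplus>\<^bsub>free_module R I\<^esub> e)
      = free_ext I N s c \<oplus>\<^bsub>N\<^esub> free_ext I N s e"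
      using assms(3) unfolding free_ext_def
      by (simp add: N.M.finsum_addf N.modsimps Pi_iff)
  qed (use assms(3) in \<open>auto simp: free_ext_def N.smult_closed Pi_iff intro!: N.M.finsum_closed\<close>)
qed

lemma free_ext_basis:
  assumes "right_module R N" "finite I" "s \<in> I \<rightarrow> carrier N" "i \<in> I"
  shows "free_ext I N s (basis_vec R i) = s i"
proof -
  interpret N: right_module R N by fact
  have "free_ext I N s (basis_vec R i) = (\<Oplus>\<^bsub>N\<^esub>j\<in>I. if i = j then s j else \<zero>\<^bsub>N\<^esub>)"
    unfolding free_ext_def basis_vec_def using assms
    by (intro N.M.finsum_cong') (auto simp: N.modsimps Pi_iff)
  also have "\<dots> = s i" using assms by (intro N.M.finsum_singleton) auto
  finally show ?thesis .
qed

lemma free_module_eqI: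
  assumes "right_module R N" "finite I" "h \<in> lin_maps R (free_module R I) N"
    "h' \<in> lin_maps R (free_module R I) N" "c \<in> carrier (free_module R I)"
    "\<And>i. i \<in> I \<Longrightarrow> h (basis_vec R i) = h' (basis_vec R i)"
  shows "h c = h' c"
proof -
  interpret N: right_module R N by fact
  have "h' (basis_vec R i) \<in> carrier N" if "i \<in> I" for i
    using that by (intro lin_maps_closed[OF assms(4)] basis_vec_closed N.R.ring_axioms)
  then show ?thesis
    using assms(5,6)
    unfolding free_module_expand[OF assms(1-3,5)] free_module_expand[OF assms(1,2,4,5)]
    by (intro N.M.finsum_cong') (auto simp: N.smult_closed Pi_iff)
qed

text \<open>
  Finitely generated projective modules are the retracts of the modules \<open>R\<^sup>n\<close>.  This description
  does not depend on the type of the elements, and lifting problems are solved in it by choosing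
  images for finitely many basis vectors.
\<close>

definition finite_retract :: "('r, 'k) ring_scheme \<Rightarrow> ('r, 'm) module \<Rightarrow> bool" where
  "finite_retract R M \<longleftrightarrow> (\<exists>(n :: nat) i p. i \<in> lin_maps R M (free_module R {..<n}) \<and>
     p \<in> lin_maps R (free_module R {..<n}) M \<and> (\<forall>x\<in>carrier M. p (i x) = x))"

lemma finite_retract_retract:
  assumes "finite_retract R N" "i \<in> lin_maps R M N" "p \<in> lin_maps R N M"
    "\<And>x. x \<in> carrier M \<Longrightarrow> p (i x) = x"
  shows "finite_retract R M"
proof -
  obtain n :: nat and j r where "j \<in> lin_maps R N (free_module R {..<n})"
    "r \<in> lin_maps R (free_module R {..<n}) N" "\<forall>x\<in>carrier N. r (j x) = x"
    using assms(1) by (auto simp: finite_retract_def)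
  then show ?thesis using assms(2-4) lin_maps_closed[OF assms(2)] unfolding finite_retract_def
    by (intro exI[of _ n] exI[of _ "\<lambda>x. j (i x)"] exI[of _ "\<lambda>x. p (r x)"])
      (auto intro: lin_maps_comp)
qed

lemma finite_retract_iso:
  assumes "right_module R M" "right_module R N" "f \<in> lin_maps R M N"
    "bij_betw f (carrier M) (carrier N)"
  shows "finite_retract R M \<longleftrightarrow> finite_retract R N"
  using finite_retract_retract[OF _ assms(3) lin_maps_inv[OF assms]]
    finite_retract_retract[OF _ lin_maps_inv[OF assms] assms(3)] assms(4)
  by (auto simp: bij_betw_def f_inv_into_f)

lemma finite_retract_free:
  assumes "ring R" "finite I"
  shows "finite_retract R (free_module R I)"
proof -
  interpret ring R by fact
  obtain b where b: "bij_betw b {..<card I} I"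
    using ex_bij_betw_nat_finite[OF assms(2)] by (auto simp: atLeast0LessThan)
  let ?inv = "inv_into {..<card I} b"
  have 1: "j < card I \<Longrightarrow> b j \<in> I" for j using b by (auto simp: bij_betw_def)
  have 2: "i \<in> I \<Longrightarrow> ?inv i < card I" "i \<in> I \<Longrightarrow> b (?inv i) = i" for i
    using b inv_into_into[of i b "{..<card I}"] by (auto simp: bij_betw_def f_inv_into_f)
  show ?thesis unfolding finite_retract_def
  proof (intro exI conjI ballI)
    show "(\<lambda>c j. if j < card I then c (b j) else \<zero>\<^bsub>R\<^esub>)
      \<in> lin_maps R (free_module R I) (free_module R {..<card I})"
      by (rule lin_mapsI)
        (auto simp: fun_eq_iff intro!: finite_subset[of "{_. _}" "{..<card I}"] split: if_splits)
    show "(\<lambda>c i. if i \<in> I then c (?inv i) else \<zero>\<^bsub>R\<^esub>)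
      \<in> lin_maps R (free_module R {..<card I}) (free_module R I)"
      by (rule lin_mapsI)
        (auto simp: fun_eq_iff assms intro!: finite_subset[of "{_. _}" I] split: if_splits)
  qed (auto simp: 2)
qed

lemma finite_retract_lift:
  assumes "finite_retract R M" "right_module R M" "right_module R N" "right_module R N'"
    and "f \<in> lin_maps R M N" "g \<in> lin_maps R N' N"
    and lift: "\<And>x. x \<in> carrier M \<Longrightarrow> \<exists>y\<in>carrier N'. g y = f x"
  obtains f' where "f' \<in> lin_maps R M N'" "\<And>x. x \<in> carrier M \<Longrightarrow> g (f' x) = f x"
proof -
  obtain n :: nat and i p where i: "i \<in> lin_maps R M (free_module R {..<n})"
    and p: "p \<in> lin_maps R (free_module R {..<n}) M" and pi: "\<And>x. x \<in> carrier M \<Longrightarrow> p (i x) = x"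
    using assms(1) by (auto simp: finite_retract_def)
  note R = right_module_ring[OF assms(2)]
  have pb: "p (basis_vec R j) \<in> carrier M" if "j < n" for j
    using that by (intro lin_maps_closed[OF p] basis_vec_closed R) auto
  obtain y where y: "\<And>j. j < n \<Longrightarrow> y j \<in> carrier N' \<and> g (y j) = f (p (basis_vec R j))"
    using lift[OF pb] by metis
  let ?e = "free_ext {..<n} N' y"
  have e: "?e \<in> lin_maps R (free_module R {..<n}) N'"
    using y by (intro free_ext_lin assms) auto
  have eq: "g (?e c) = f (p c)" if "c \<in> carrier (free_module R {..<n})" for c
    using that
    by (rule free_module_eqI[OF assms(3) _ lin_maps_comp[OF e assms(6)] lin_maps_comp[OF p assms(5)], rotated])
      (use y in \<open>auto simp: free_ext_basis[OF assms(4)] Pi_iff\<close>)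
  show thesis
    by (rule that[OF lin_maps_comp[OF i e]]) (use eq[OF lin_maps_closed[OF i]] pi in auto)
qed

lemma finite_retract_dsum:
  assumes "ring R" "finite_retract R M" "finite_retract R N"
  shows "finite_retract R (dsum_module M N)"
proof -
  interpret ring R by fact
  obtain m :: nat and i p where i: "i \<in> lin_maps R M (free_module R {..<m})"
    and p: "p \<in> lin_maps R (free_module R {..<m}) M" and pi: "\<And>x. x \<in> carrier M \<Longrightarrow> p (i x) = x"
    using assms(2) by (auto simp: finite_retract_def)
  obtain n :: nat and j q where j: "j \<in> lin_maps R N (free_module R {..<n})"
    and q: "q \<in> lin_maps R (free_module R {..<n}) N" and qj: "\<And>x. x \<in> carrier N \<Longrightarrow> q (j x) = x"
    using assms(3) by (auto simp: finite_retract_def)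
  let ?I = "{..<m} <+> {..<n}"
  have *: "i x k \<in> carrier R" "k \<ge> m \<Longrightarrow> i x k = \<zero>\<^bsub>R\<^esub>" if "x \<in> carrier M" for x k
    using lin_maps_closed[OF i that] by auto
  have **: "j x k \<in> carrier R" "k \<ge> n \<Longrightarrow> j x k = \<zero>\<^bsub>R\<^esub>" if "x \<in> carrier N" for x k
    using lin_maps_closed[OF j that] by auto
  have "(\<lambda>(x, y). case_sum (i x) (j y)) \<in> lin_maps R (dsum_module M N) (free_module R ?I)"
  proof (rule lin_mapsI)
    fix z assume "z \<in> carrier (dsum_module M N)"
    then obtain x y where z: "z = (x, y)" "x \<in> carrier M" "y \<in> carrier N"
      by (auto simp: dsum_module_def)
    have "{k. case_sum (i x) (j y) k \<noteq> \<zero>\<^bsub>R\<^esub>} \<subseteq> ?I"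
    proof
      fix k assume "k \<in> {k. case_sum (i x) (j y) k \<noteq> \<zero>\<^bsub>R\<^esub>}"
      then show "k \<in> ?I" using * ** z by (cases k) (force simp: not_le[symmetric])+
    qed
    then have "finite {k. case_sum (i x) (j y) k \<noteq> \<zero>\<^bsub>R\<^esub>}" by (rule finite_subset) auto
    moreover have "case_sum (i x) (j y) k \<in> carrier R" "k \<notin> ?I \<Longrightarrow> case_sum (i x) (j y) k = \<zero>\<^bsub>R\<^esub>" for k
      by (cases k; use * ** z in \<open>simp add: InlI InrI not_less\<close>)
        (cases k; use * ** z in \<open>simp add: image_iff Plus_def not_less\<close>)
    ultimately show "(case z of (x, y) \<Rightarrow> case_sum (i x) (j y)) \<in> carrier (free_module R ?I)"
      using z by auto
  qed (auto simp: dsum_module_def fun_eq_iff lin_maps_add[OF i] lin_maps_add[OF j]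
      lin_maps_smult[OF i] lin_maps_smult[OF j] split: sum.split)
  moreover have cl: "(\<lambda>k. c (Inl k)) \<in> carrier (free_module R {..<m})"
    "(\<lambda>k. c (Inr k)) \<in> carrier (free_module R {..<n})" if "c \<in> carrier (free_module R ?I)" for c
  proof -
    have "{k. c (Inl k) \<noteq> \<zero>\<^bsub>R\<^esub>} \<subseteq> {..<m}" "{k. c (Inr k) \<noteq> \<zero>\<^bsub>R\<^esub>} \<subseteq> {..<n}"
      using that by auto
    then show "(\<lambda>k. c (Inl k)) \<in> carrier (free_module R {..<m})"
      "(\<lambda>k. c (Inr k)) \<in> carrier (free_module R {..<n})"
      using that by (auto intro: finite_subset)
  qed
  moreover have "(\<lambda>c. (p (\<lambda>k. c (Inl k)), q (\<lambda>k. c (Inr k))))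
    \<in> lin_maps R (free_module R ?I) (dsum_module M N)"
    using lin_maps_add[OF p cl(1) cl(1)] lin_maps_add[OF q cl(2) cl(2)]
      lin_maps_smult[OF p _ cl(1)] lin_maps_smult[OF q _ cl(2)]
    by (intro lin_mapsI) (auto simp: dsum_module_def lin_maps_closed[OF p cl(1)]
      lin_maps_closed[OF q cl(2)] simp del: free_module_sel(1))
  ultimately show ?thesis
    by (intro finite_retract_retract[OF finite_retract_free[OF assms(1), of ?I]])
      (auto simp: dsum_module_def pi qj)
qed

lemma trivial_finite_retract:
  assumes "right_module R M" "trivial_module M"
  shows "finite_retract R M"
proof -
  interpret M: right_module R M by fact
  have "(\<lambda>x i. \<zero>\<^bsub>R\<^esub>) \<in> lin_maps R M (free_module R {..<0::nat})"
    by (rule lin_mapsI) auto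
  then show ?thesis using lin_maps_zero_map[OF assms(1), of "free_module R {..<0::nat}"] assms(2)
    unfolding finite_retract_def trivial_module_def
    by (intro exI[of _ "0::nat"] exI[of _ "\<lambda>x i. \<zero>\<^bsub>R\<^esub>"] exI[of _ "\<lambda>x. \<zero>\<^bsub>M\<^esub>"]) auto
qed

lemma fg_projective_iff:
  assumes "right_module R M"
  shows "fg_projective R M \<longleftrightarrow> finite_retract R M"
proof
  interpret M: right_module R M by fact
  assume "fg_projective R M"
  then obtain B and I :: "'c set" and i p where B: "finite B" "B \<subseteq> carrier M"
    "\<And>x. x \<in> carrier M \<Longrightarrow> \<exists>c\<in>B \<rightarrow> carrier R. x = (\<Oplus>\<^bsub>M\<^esub>b\<in>B. c b \<odot>\<^bsub>M\<^esub> b)"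
    and i: "i \<in> lin_maps R M (free_module R I)" and p: "p \<in> lin_maps R (free_module R I) M"
    and pi: "\<And>x. x \<in> carrier M \<Longrightarrow> p (i x) = x"
    unfolding fg_projective_def fin_gen_module_def projective_module_def by blast
  interpret F: right_module R "free_module R I" by (rule right_module_free[OF M.R.ring_axioms])
  \<comment> \<open>finitely many coordinates suffice: those in which some generator is non-zero\<close>
  define I0 where "I0 = (\<Union>b\<in>B. {k. i b k \<noteq> \<zero>\<^bsub>R\<^esub>})"
  have I0: "finite I0" "I0 \<subseteq> I"
  proof -
    have "i b \<in> carrier (free_module R I)" if "b \<in> B" for b
      using that B(2) lin_maps_closed[OF i] by blast
    then show "finite I0" "I0 \<subseteq> I" using B(1) unfolding I0_def by fastforce+
  qed
  let ?U = "{c \<in> carrier (free_module R I). \<forall>k. k \<notin> I0 \<longrightarrow> c k = \<zero>\<^bsub>R\<^esub>}"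
  have sum_in: "(\<Oplus>\<^bsub>free_module R I\<^esub>b\<in>C. e b) \<in> ?U" if "finite C" "\<And>b. b \<in> C \<Longrightarrow> e b \<in> ?U" for C e
    using that
  proof (induction C)
    case (insert b C)
    have *: "e \<in> C \<rightarrow> carrier (free_module R I)" "e b \<in> carrier (free_module R I)"
      using insert.prems by auto
    show ?case
      using insert F.M.a_closed[OF *(2) F.M.finsum_closed[OF *(1)]]
      by (simp add: F.M.finsum_insert * del: free_module_sel(1))
  qed (use F.M.zero_closed in auto)
  have supp: "i x k = \<zero>\<^bsub>R\<^esub>" if x: "x \<in> carrier M" and k: "k \<notin> I0" for x k
  proof -
    obtain c where c: "c \<in> B \<rightarrow> carrier R" "x = (\<Oplus>\<^bsub>M\<^esub>b\<in>B. c b \<odot>\<^bsub>M\<^esub> b)" using B(3)[OF x] by auto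
    have cb: "c b \<odot>\<^bsub>M\<^esub> b \<in> carrier M" "c b \<in> carrier R" "b \<in> carrier M" if "b \<in> B" for b
      using c B that by (auto simp: M.smult_closed Pi_iff subset_iff)
    have "i x = (\<Oplus>\<^bsub>free_module R I\<^esub>b\<in>B. i (c b \<odot>\<^bsub>M\<^esub> b))" unfolding c(2)
      using cb by (intro lin_maps_finsum[OF i] M.abelian_group_axioms F.abelian_group_axioms B) auto
    also have "\<dots> \<in> ?U"
    proof (rule sum_in[OF B(1)])
      fix b assume b: "b \<in> B"
      have "i (c b \<odot>\<^bsub>M\<^esub> b) k = \<zero>\<^bsub>R\<^esub>" if "k \<notin> I0" for k
        using that b cb[OF b] by (auto simp: lin_maps_smult[OF i] I0_def)
      then show "i (c b \<odot>\<^bsub>M\<^esub> b) \<in> ?U" using lin_maps_closed[OF i cb(1)[OF b]] by auto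
    qed
    finally show ?thesis using k by simp
  qed
  have "i \<in> lin_maps R M (free_module R I0)"
    using supp lin_maps_closed[OF i] lin_maps_add[OF i] lin_maps_smult[OF i] by (intro lin_mapsI) auto
  moreover have "p \<in> lin_maps R (free_module R I0) M"
  proof -
    have "c \<in> carrier (free_module R I)" if "c \<in> carrier (free_module R I0)" for c
      using that I0 by auto
    then show ?thesis
      using lin_maps_closed[OF p] lin_maps_add[OF p] lin_maps_smult[OF p]
      by (intro lin_mapsI) (auto simp del: free_module_sel(1) simp: free_module_sel(3,4)[abs_def])
  qed
  ultimately show "finite_retract R M"
    using finite_retract_retract[OF finite_retract_free[OF M.R.ring_axioms I0(1)]] pi by blast
next
  interpret M: right_module R M by fact
  assume "finite_retract R M"
  then obtain n :: nat and i p where i: "i \<in> lin_maps R M (free_module R {..<n})"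
    and p: "p \<in> lin_maps R (free_module R {..<n}) M" and pi: "\<And>x. x \<in> carrier M \<Longrightarrow> p (i x) = x"
    by (auto simp: finite_retract_def)
  define s where "s k = p (basis_vec R k)" for k
  let ?B = "s ` {..<n}"
  have s: "k < n \<Longrightarrow> s k \<in> carrier M" for k
    unfolding s_def by (intro lin_maps_closed[OF p] basis_vec_closed M.R.ring_axioms) auto
  let ?FB = "free_module R ?B"
  interpret FB: right_module R ?FB by (rule right_module_free[OF M.R.ring_axioms])
  let ?r = "free_ext ?B M (\<lambda>b. b)" and ?u = "free_ext {..<n} ?FB (\<lambda>k. basis_vec R (s k))"
  have r: "?r \<in> lin_maps R ?FB M" using s by (intro free_ext_lin M.right_module_axioms) auto
  have bs: "(\<lambda>k. basis_vec R (s k)) \<in> {..<n} \<rightarrow> carrier ?FB"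
    by (intro funcsetI basis_vec_closed M.R.ring_axioms) auto
  have u: "?u \<in> lin_maps R (free_module R {..<n}) ?FB"
    by (intro free_ext_lin FB.right_module_axioms finite_lessThan bs)
  have rub: "?r (?u (basis_vec R k)) = p (basis_vec R k)" if "k < n" for k
  proof -
    have "?u (basis_vec R k) = basis_vec R (s k)"
      using that by (intro free_ext_basis[OF FB.right_module_axioms finite_lessThan bs]) auto
    moreover have "?r (basis_vec R (s k)) = s k"
      using that s by (intro free_ext_basis[OF M.right_module_axioms]) auto
    ultimately show ?thesis by (simp add: s_def)
  qed
  have ru: "?r (?u c) = p c" if "c \<in> carrier (free_module R {..<n})" for c
    by (rule free_module_eqI[OF M.right_module_axioms finite_lessThan lin_maps_comp[OF u r] p that])
      (use rub in simp)
  have fin: "\<exists>c\<in>?B \<rightarrow> carrier R. x = (\<Oplus>\<^bsub>M\<^esub>b\<in>?B. c b \<odot>\<^bsub>M\<^esub> b)" if x: "x \<in> carrier M" for x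
  proof -
    have "?u (i x) \<in> carrier ?FB" by (intro lin_maps_closed[OF u] lin_maps_closed[OF i] x)
    moreover have "?r (?u (i x)) = x" using ru lin_maps_closed[OF i x] pi x by metis
    ultimately obtain v where "v \<in> carrier ?FB" "x = ?r v" by metis
    then show ?thesis unfolding free_ext_def by (intro bexI[of _ v]) auto
  qed
  have "fin_gen_module R M" unfolding fin_gen_module_def
    using s fin by (intro exI[of _ ?B] conjI ballI) auto
  moreover have "projective_module R M" unfolding projective_module_def
    using lin_maps_comp[OF i u] r ru lin_maps_closed[OF i] pi by metis
  ultimately show "fg_projective R M" by (simp add: fg_projective_def)
qed

section \<open>Complexes and their homology\<close>

text \<open>
  Vanishing in negative degrees is kept apart from the algebraic conditions, so that it has to be
  checked only for the complexes that occur in the factorization and for bounded complexes of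
  projectives.
\<close>

locale zcx =
  fixes R :: "('r, 'k) ring_scheme" and C :: "('r, 'm) cplx"
  assumes mod: "right_module R (ob C k)"
    and d_lin: "dif C k \<in> lin_maps R (ob C k) (ob C (k - 1))"
    and dd: "x \<in> carrier (ob C k) \<Longrightarrow> dif C (k - 1) (dif C k x) = \<zero>\<^bsub>ob C (k - 2)\<^esub>"

definition cyc :: "('r, 'm) cplx \<Rightarrow> int \<Rightarrow> 'm set" where
  "cyc C k = {x \<in> carrier (ob C k). dif C k x = \<zero>\<^bsub>ob C (k - 1)\<^esub>}"

abbreviation cls :: "('r, 'm) cplx \<Rightarrow> int \<Rightarrow> 'm \<Rightarrow> 'm set" where
  "cls C k x \<equiv> boundaries C k +>\<^bsub>ob C k\<^esub> x"

definition acyclic_at :: "('r, 'm) cplx \<Rightarrow> int \<Rightarrow> bool" where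
  "acyclic_at C k \<longleftrightarrow> cyc C k \<subseteq> boundaries C k"

lemma boundaries_iff: "x \<in> boundaries C k \<longleftrightarrow> (\<exists>y\<in>carrier (ob C (k + 1)). x = dif C (k + 1) y)"
  by (auto simp: boundaries_def)

lemma cycles_module_eq: "cycles_module C k = (ob C k)\<lparr>carrier := cyc C k\<rparr>"
  by (auto simp: cycles_module_def cyc_def a_kernel_def')

context zcx
begin

sublocale M: right_module R "ob C k" for k by (rule mod)

lemma d_closed [simp]: "x \<in> carrier (ob C k) \<Longrightarrow> l = k - 1 \<Longrightarrow> dif C k x \<in> carrier (ob C l)"
  using lin_maps_closed[OF d_lin] by simp

lemma d_add [simp]: "x \<in> carrier (ob C k) \<Longrightarrow> y \<in> carrier (ob C k) \<Longrightarrow>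
    dif C k (x \<oplus>\<^bsub>ob C k\<^esub> y) = dif C k x \<oplus>\<^bsub>ob C (k - 1)\<^esub> dif C k y"
  using lin_maps_add[OF d_lin] by simp

lemma d_smult [simp]: "a \<in> carrier R \<Longrightarrow> x \<in> carrier (ob C k) \<Longrightarrow>
    dif C k (a \<odot>\<^bsub>ob C k\<^esub> x) = a \<odot>\<^bsub>ob C (k - 1)\<^esub> dif C k x"
  using lin_maps_smult[OF d_lin] by simp

lemma d_zero [simp]: "dif C k \<zero>\<^bsub>ob C k\<^esub> = \<zero>\<^bsub>ob C (k - 1)\<^esub>"
  using lin_maps_zero[OF d_lin] M.M.abelian_group_axioms by blast

lemma d_minus [simp]: "x \<in> carrier (ob C k) \<Longrightarrow> dif C k (\<ominus>\<^bsub>ob C k\<^esub> x) = \<ominus>\<^bsub>ob C (k - 1)\<^esub> dif C k x"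
  using lin_maps_minus[OF d_lin] M.M.abelian_group_axioms by blast

lemma dd_zero [simp]:
  "x \<in> carrier (ob C k) \<Longrightarrow> l = k - 1 \<Longrightarrow> dif C l (dif C k x) = \<zero>\<^bsub>ob C (k - 2)\<^esub>"
  by (simp add: dd)

lemma submodule_cyc: "submodule R (ob C k) (cyc C k)"
  by (auto simp: submodule_def cyc_def M.modsimps)

lemma submodule_boundaries: "submodule R (ob C k) (boundaries C k)"
  unfolding submodule_def
proof (intro conjI ballI)
  show "boundaries C k \<subseteq> carrier (ob C k)" by (auto simp: boundaries_iff)
  show "\<zero>\<^bsub>ob C k\<^esub> \<in> boundaries C k"
    unfolding boundaries_iff by (rule bexI[of _ "\<zero>\<^bsub>ob C (k + 1)\<^esub>"]) simp_all
next
  fix x y assume "x \<in> boundaries C k" "y \<in> boundaries C k"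
  then obtain x' y' where "x' \<in> carrier (ob C (k + 1))" "x = dif C (k + 1) x'"
    "y' \<in> carrier (ob C (k + 1))" "y = dif C (k + 1) y'" by (auto simp: boundaries_iff)
  then show "x \<oplus>\<^bsub>ob C k\<^esub> y \<in> boundaries C k"
    unfolding boundaries_iff by (intro bexI[of _ "x' \<oplus>\<^bsub>ob C (k + 1)\<^esub> y'"]) simp_all
next
  fix a x assume "a \<in> carrier R" "x \<in> boundaries C k"
  then obtain x' where "x' \<in> carrier (ob C (k + 1))" "x = dif C (k + 1) x'" by (auto simp: boundaries_iff)
  with \<open>a \<in> carrier R\<close> show "a \<odot>\<^bsub>ob C k\<^esub> x \<in> boundaries C k"
    unfolding boundaries_iff by (intro bexI[of _ "a \<odot>\<^bsub>ob C (k + 1)\<^esub> x'"]) (simp_all add: M.modsimps)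
qed

lemma boundaries_cyc: "boundaries C k \<subseteq> cyc C k"
  by (auto simp: boundaries_iff cyc_def)

lemma cycD: "x \<in> cyc C k \<Longrightarrow> x \<in> carrier (ob C k)" "x \<in> cyc C k \<Longrightarrow> dif C k x = \<zero>\<^bsub>ob C (k - 1)\<^esub>"
  by (auto simp: cyc_def)

lemma right_module_cycles: "right_module R (cycles_module C k)"
  unfolding cycles_module_eq by (rule right_module_submodule[OF mod submodule_cyc])

lemma submodule_cycles_boundaries: "submodule R (cycles_module C k) (boundaries C k)"
  using submodule_boundaries[of k] boundaries_cyc[of k]
  by (auto simp: submodule_def cycles_module_eq)

lemma coset_cycles: "U +>\<^bsub>cycles_module C k\<^esub> x = U +>\<^bsub>ob C k\<^esub> x"
  by (auto simp: coset_mem cycles_module_eq)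

lemma homology_carrier: "carrier (homology C k) = {cls C k x | x. x \<in> cyc C k}"
  by (auto simp: homology_def coset_cycles) (auto simp: cycles_module_eq)

lemma right_module_homology: "right_module R (homology C k)"
  unfolding homology_def by (rule right_module_quot[OF right_module_cycles submodule_cycles_boundaries])

lemma cls_lin: "cls C k \<in> lin_maps R (cycles_module C k) (homology C k)"
  using lin_maps_coset[OF right_module_cycles submodule_cycles_boundaries, of k]
  by (simp add: homology_def coset_cycles)

lemma cls_closed [simp]: "x \<in> cyc C k \<Longrightarrow> cls C k x \<in> carrier (homology C k)"
  by (auto simp: homology_carrier)

lemma cls_add: "x \<in> cyc C k \<Longrightarrow> y \<in> cyc C k \<Longrightarrow>
    cls C k (x \<oplus>\<^bsub>ob C k\<^esub> y) = cls C k x \<oplus>\<^bsub>homology C k\<^esub> cls C k y"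
  using lin_maps_add[OF cls_lin, of x k y] by (simp add: cycles_module_eq)

lemma cls_smult: "a \<in> carrier R \<Longrightarrow> x \<in> cyc C k \<Longrightarrow>
    cls C k (a \<odot>\<^bsub>ob C k\<^esub> x) = a \<odot>\<^bsub>homology C k\<^esub> cls C k x"
  using lin_maps_smult[OF cls_lin, of a x k] by (simp add: cycles_module_eq)

lemma cls_eq_iff:
  assumes "x \<in> cyc C k" "y \<in> cyc C k"
  shows "cls C k x = cls C k y \<longleftrightarrow> (\<exists>z\<in>carrier (ob C (k + 1)). x = dif C (k + 1) z \<oplus>\<^bsub>ob C k\<^esub> y)"
  using coset_eq_iff[OF mod submodule_boundaries cycD(1)[OF assms(1)] cycD(1)[OF assms(2)]]
  by (simp add: boundaries_def)

lemma homology_zero: "\<zero>\<^bsub>homology C k\<^esub> = boundaries C k"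
  by (simp add: homology_def)

lemma cls_zero_iff:
  assumes "x \<in> cyc C k"
  shows "cls C k x = \<zero>\<^bsub>homology C k\<^esub> \<longleftrightarrow> x \<in> boundaries C k"
proof -
  have "\<zero>\<^bsub>ob C k\<^esub> \<in> cyc C k" by (simp add: cyc_def)
  moreover have "cls C k \<zero>\<^bsub>ob C k\<^esub> = \<zero>\<^bsub>homology C k\<^esub>"
    by (simp add: homology_zero coset_zero[OF mod submodule_boundaries])
  ultimately show ?thesis using cls_eq_iff[OF assms, of "\<zero>\<^bsub>ob C k\<^esub>"] by (auto simp: boundaries_iff)
qed

lemma trivial_homology_iff: "trivial_module (homology C k) \<longleftrightarrow> acyclic_at C k"
proof -
  interpret H: right_module R "homology C k" by (rule right_module_homology)
  have "trivial_module (homology C k) \<longleftrightarrow> (\<forall>x\<in>cyc C k. cls C k x = \<zero>\<^bsub>homology C k\<^esub>)"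
    unfolding trivial_module_def using H.M.zero_closed by (auto simp: homology_carrier)
  then show ?thesis using cls_zero_iff by (auto simp: acyclic_at_def)
qed

lemma acyclicD: "acyclic_at C k \<Longrightarrow> x \<in> carrier (ob C k) \<Longrightarrow> dif C k x = \<zero>\<^bsub>ob C (k - 1)\<^esub> \<Longrightarrow>
   \<exists>y\<in>carrier (ob C (k + 1)). dif C (k + 1) y = x"
  by (auto simp: acyclic_at_def cyc_def boundaries_iff subset_iff)

lemma trivial_acyclic: "trivial_module (ob C k) \<Longrightarrow> acyclic_at C k"
  using submodule_boundaries[of k] by (auto simp: acyclic_at_def cyc_def submodule_def trivial_module_def)

end

lemma acyclicI: "(\<And>x. x \<in> carrier (ob C k) \<Longrightarrow> dif C k x = \<zero>\<^bsub>ob C (k - 1)\<^esub> \<Longrightarrow>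
   \<exists>y\<in>carrier (ob C (k + 1)). x = dif C (k + 1) y) \<Longrightarrow> acyclic_at C k"
  by (auto simp: acyclic_at_def cyc_def boundaries_iff subset_iff)

lemma chain_complex_iff:
  "chain_complex R C \<longleftrightarrow> zcx R C \<and> (\<forall>k<0. trivial_module (ob C k))"
  by (auto simp: chain_complex_def zcx_def)

locale zmap = C: zcx R C + D: zcx R D
  for R :: "('r, 'k) ring_scheme" and C :: "('r, 'm) cplx" and D :: "('r, 'n) cplx" +
  fixes f :: "int \<Rightarrow> 'm \<Rightarrow> 'n"
  assumes lin: "f k \<in> lin_maps R (ob C k) (ob D k)"
    and comm: "x \<in> carrier (ob C k) \<Longrightarrow> f (k - 1) (dif C k x) = dif D k (f k x)"

lemma chain_map_iff: "chain_map R C D f \<longleftrightarrow> chain_complex R C \<and> chain_complex R D \<and> zmap R C D f"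
  by (auto simp: chain_map_def zmap_def zmap_axioms_def chain_complex_iff)

text \<open>
  Injectivity and surjectivity on homology, stated for cycles so that diagram chases do not have to
  pass through cosets.
\<close>

definition hinj :: "('r, 'm) cplx \<Rightarrow> ('r, 'n) cplx \<Rightarrow> (int \<Rightarrow> 'm \<Rightarrow> 'n) \<Rightarrow> int \<Rightarrow> bool" where
  "hinj C D f k \<longleftrightarrow> (\<forall>x\<in>cyc C k. f k x \<in> boundaries D k \<longrightarrow> x \<in> boundaries C k)"

definition hsurj :: "('r, 'm) cplx \<Rightarrow> ('r, 'n) cplx \<Rightarrow> (int \<Rightarrow> 'm \<Rightarrow> 'n) \<Rightarrow> int \<Rightarrow> bool" where
  "hsurj C D f k \<longleftrightarrow> (\<forall>y\<in>cyc D k. \<exists>x\<in>cyc C k. \<exists>z\<in>carrier (ob D (k + 1)).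
     y = dif D (k + 1) z \<oplus>\<^bsub>ob D k\<^esub> f k x)"

context zmap
begin

lemma f_closed [simp]: "x \<in> carrier (ob C k) \<Longrightarrow> f k x \<in> carrier (ob D k)"
  using lin_maps_closed[OF lin] .

lemma f_add [simp]: "x \<in> carrier (ob C k) \<Longrightarrow> y \<in> carrier (ob C k) \<Longrightarrow>
    f k (x \<oplus>\<^bsub>ob C k\<^esub> y) = f k x \<oplus>\<^bsub>ob D k\<^esub> f k y"
  using lin_maps_add[OF lin] by simp

lemma f_smult [simp]: "a \<in> carrier R \<Longrightarrow> x \<in> carrier (ob C k) \<Longrightarrow>
    f k (a \<odot>\<^bsub>ob C k\<^esub> x) = a \<odot>\<^bsub>ob D k\<^esub> f k x"
  using lin_maps_smult[OF lin] by simp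

lemma f_zero [simp]: "f k \<zero>\<^bsub>ob C k\<^esub> = \<zero>\<^bsub>ob D k\<^esub>"
  using lin_maps_zero[OF lin] C.M.M.abelian_group_axioms D.M.M.abelian_group_axioms by blast

lemma f_minus [simp]: "x \<in> carrier (ob C k) \<Longrightarrow> f k (\<ominus>\<^bsub>ob C k\<^esub> x) = \<ominus>\<^bsub>ob D k\<^esub> f k x"
  using lin_maps_minus[OF lin] C.M.M.abelian_group_axioms D.M.M.abelian_group_axioms by blast

lemma f_d [simp]: "x \<in> carrier (ob C k) \<Longrightarrow> l = k - 1 \<Longrightarrow> f l (dif C k x) = dif D k (f k x)"
  by (simp add: comm)

lemma f_cyc [simp]: "x \<in> cyc C k \<Longrightarrow> f k x \<in> cyc D k"
  using comm[of x k] by (auto simp: cyc_def)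

lemma f_boundaries: "x \<in> boundaries C k \<Longrightarrow> f k x \<in> boundaries D k"
  by (auto simp: boundaries_iff)

lemma homology_map_cls:
  assumes "x \<in> cyc C k"
  shows "homology_map D f k (cls C k x) = cls D k (f k x)"
  unfolding homology_map_def
  by (rule coset_push[OF D.mod D.submodule_boundaries])
    (use C.submodule_boundaries[of k] C.cycD[OF assms] f_boundaries in
      \<open>auto simp: submodule_def C.M.M.abelian_group_axioms\<close>)

lemma homology_map_lin: "homology_map D f k \<in> lin_maps R (homology C k) (homology D k)"
proof (rule lin_mapsI)
  fix K assume "K \<in> carrier (homology C k)"
  then obtain x where x: "x \<in> cyc C k" "K = cls C k x" by (auto simp: C.homology_carrier)
  then show "homology_map D f k K \<in> carrier (homology D k)" by (simp add: homology_map_cls)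
  {
    fix L assume "L \<in> carrier (homology C k)"
    then obtain y where y: "y \<in> cyc C k" "L = cls C k y" by (auto simp: C.homology_carrier)
    have xy: "x \<oplus>\<^bsub>ob C k\<^esub> y \<in> cyc C k"
      using C.submodule_cyc[of k] x y by (auto simp: submodule_def)
    show "homology_map D f k (K \<oplus>\<^bsub>homology C k\<^esub> L)
      = homology_map D f k K \<oplus>\<^bsub>homology D k\<^esub> homology_map D f k L"
      using x y xy C.cycD by (simp add: homology_map_cls flip: C.cls_add D.cls_add)
  }
  fix a assume a: "a \<in> carrier R"
  have "a \<odot>\<^bsub>ob C k\<^esub> x \<in> cyc C k"
    using C.submodule_cyc[of k] x a by (auto simp: submodule_def)
  then show "homology_map D f k (a \<odot>\<^bsub>homology C k\<^esub> K) = a \<odot>\<^bsub>homology D k\<^esub> homology_map D f k K"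
    using x a C.cycD by (simp add: homology_map_cls flip: C.cls_smult D.cls_smult)
qed

lemma homology_map_inj_iff: "inj_on (homology_map D f k) (carrier (homology C k)) \<longleftrightarrow> hinj C D f k"
proof
  assume inj: "inj_on (homology_map D f k) (carrier (homology C k))"
  have z: "\<zero>\<^bsub>ob C k\<^esub> \<in> cyc C k" "\<zero>\<^bsub>ob D k\<^esub> \<in> cyc D k" by (simp_all add: cyc_def)
  show "hinj C D f k" unfolding hinj_def
  proof (intro ballI impI)
    fix x assume x: "x \<in> cyc C k" "f k x \<in> boundaries D k"
    then have "cls D k (f k x) = cls D k (f k \<zero>\<^bsub>ob C k\<^esub>)"
      using z by (subst D.cls_eq_iff) (auto simp: boundaries_iff)
    then have "cls C k x = cls C k \<zero>\<^bsub>ob C k\<^esub>"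
      using inj_onD[OF inj] homology_map_cls x z by simp
    then show "x \<in> boundaries C k" using x z by (subst (asm) C.cls_eq_iff) (auto simp: boundaries_iff)
  qed
next
  assume h: "hinj C D f k"
  show "inj_on (homology_map D f k) (carrier (homology C k))"
  proof (rule inj_onI)
    fix K L assume "K \<in> carrier (homology C k)" "L \<in> carrier (homology C k)"
      and eq: "homology_map D f k K = homology_map D f k L"
    then obtain x y where xy: "x \<in> cyc C k" "K = cls C k x" "y \<in> cyc C k" "L = cls C k y"
      by (auto simp: C.homology_carrier)
    then obtain z where z: "z \<in> carrier (ob D (k + 1))" "f k x = dif D (k + 1) z \<oplus>\<^bsub>ob D k\<^esub> f k y"
      using eq by (auto simp: homology_map_cls D.cls_eq_iff)
    note c = C.cycD(1)[OF xy(1)] C.cycD(1)[OF xy(3)]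
    have "x \<oplus>\<^bsub>ob C k\<^esub> \<ominus>\<^bsub>ob C k\<^esub> y \<in> cyc C k" using xy c
      by (simp add: cyc_def)
    moreover have "f k (x \<oplus>\<^bsub>ob C k\<^esub> \<ominus>\<^bsub>ob C k\<^esub> y) = dif D (k + 1) z"
      using c z by (simp add: D.M.M.grp)
    ultimately obtain w where w: "w \<in> carrier (ob C (k + 1))" "x \<oplus>\<^bsub>ob C k\<^esub> \<ominus>\<^bsub>ob C k\<^esub> y = dif C (k + 1) w"
      using h z unfolding hinj_def boundaries_iff by blast
    have "x = (x \<oplus>\<^bsub>ob C k\<^esub> \<ominus>\<^bsub>ob C k\<^esub> y) \<oplus>\<^bsub>ob C k\<^esub> y" using c by (simp add: C.M.M.grp)
    then show "K = L" using xy w by (auto simp: C.cls_eq_iff)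
  qed
qed

lemma homology_map_surj_iff:
  "homology_map D f k ` carrier (homology C k) = carrier (homology D k) \<longleftrightarrow> hsurj C D f k"
proof -
  have img: "homology_map D f k ` carrier (homology C k) = (\<lambda>x. cls D k (f k x)) ` cyc C k"
    unfolding C.homology_carrier using homology_map_cls by (force simp: image_iff)
  have carr: "carrier (homology D k) = cls D k ` cyc D k"
    by (auto simp: D.homology_carrier)
  have sub: "(\<lambda>x. cls D k (f k x)) ` cyc C k \<subseteq> cls D k ` cyc D k" by auto
  have "homology_map D f k ` carrier (homology C k) = carrier (homology D k)
    \<longleftrightarrow> cls D k ` cyc D k \<subseteq> (\<lambda>x. cls D k (f k x)) ` cyc C k"
    unfolding img carr using sub by blast
  also have "\<dots> \<longleftrightarrow> (\<forall>y\<in>cyc D k. \<exists>x\<in>cyc C k. cls D k y = cls D k (f k x))"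
    by (simp only: image_subset_iff image_iff)
  also have "\<dots> \<longleftrightarrow> hsurj C D f k"
    unfolding hsurj_def by (intro ball_cong bex_cong refl D.cls_eq_iff f_cyc)
  finally show ?thesis .
qed

lemma homology_map_bij_iff:
  "bij_betw (homology_map D f k) (carrier (homology C k)) (carrier (homology D k))
     \<longleftrightarrow> hinj C D f k \<and> hsurj C D f k"
  by (simp add: bij_betw_def homology_map_inj_iff homology_map_surj_iff)

end

definition qi :: "('r, 'm) cplx \<Rightarrow> ('r, 'n) cplx \<Rightarrow> (int \<Rightarrow> 'm \<Rightarrow> 'n) \<Rightarrow> bool" where
  "qi C D f \<longleftrightarrow> (\<forall>k. hinj C D f k \<and> hsurj C D f k)"

lemma quasi_iso_iff:
  "quasi_iso R C D f \<longleftrightarrow> chain_complex R C \<and> chain_complex R D \<and> zmap R C D f \<and> qi C D f"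
  using zmap.homology_map_bij_iff by (fastforce simp: quasi_iso_def chain_map_iff qi_def)

locale ses = i: zmap R C D i + p: zmap R D E p
  for R :: "('r, 'k) ring_scheme" and C :: "('r, 'm) cplx" and D :: "('r, 'n) cplx"
    and E :: "('r, 'o) cplx" and i :: "int \<Rightarrow> 'm \<Rightarrow> 'n" and p :: "int \<Rightarrow> 'n \<Rightarrow> 'o" +
  assumes inj: "inj_on (i k) (carrier (ob C k))"
    and surj: "e \<in> carrier (ob E k) \<Longrightarrow> \<exists>y\<in>carrier (ob D k). p k y = e"
    and p_i [simp]: "c \<in> carrier (ob C k) \<Longrightarrow> p k (i k c) = \<zero>\<^bsub>ob E k\<^esub>"
    and ker: "y \<in> carrier (ob D k) \<Longrightarrow> p k y = \<zero>\<^bsub>ob E k\<^esub> \<Longrightarrow> \<exists>c\<in>carrier (ob C k). y = i k c"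
begin

lemma i_eq_zero: "c \<in> carrier (ob C k) \<Longrightarrow> i k c = \<zero>\<^bsub>ob D k\<^esub> \<Longrightarrow> c = \<zero>\<^bsub>ob C k\<^esub>"
  using inj[of k] i.f_zero[of k] i.C.M.M.zero_closed unfolding inj_on_def by metis

text \<open>
  Exactness of the homology sequence at its middle term.  That extensions inherit acyclicity and
  torsion both come down to it.
\<close>

lemma middle_exact:
  assumes y: "y \<in> cyc D k" and b: "p k y \<in> boundaries E k"
  shows "\<exists>c\<in>cyc C k. \<exists>z\<in>carrier (ob D (k + 1)). y = dif D (k + 1) z \<oplus>\<^bsub>ob D k\<^esub> i k c"
proof -
  note y' = i.D.cycD[OF y]
  obtain e where e: "e \<in> carrier (ob E (k + 1))" "p k y = dif E (k + 1) e"
    using b by (auto simp: boundaries_iff)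
  obtain z where z: "z \<in> carrier (ob D (k + 1))" "p (k + 1) z = e" using surj[OF e(1)] by auto
  have dz: "dif D (k + 1) z \<in> carrier (ob D k)" using z by simp
  have pdz: "p k (dif D (k + 1) z) = p k y" using z e by simp
  have "p k (\<ominus>\<^bsub>ob D k\<^esub> dif D (k + 1) z \<oplus>\<^bsub>ob D k\<^esub> y) = \<zero>\<^bsub>ob E k\<^esub>"
    using y' dz pdz by (simp add: p.D.M.M.l_neg)
  then obtain c where c: "c \<in> carrier (ob C k)" "\<ominus>\<^bsub>ob D k\<^esub> dif D (k + 1) z \<oplus>\<^bsub>ob D k\<^esub> y = i k c"
    using ker[of "\<ominus>\<^bsub>ob D k\<^esub> dif D (k + 1) z \<oplus>\<^bsub>ob D k\<^esub> y" k] y' dz by auto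
  have "i (k - 1) (dif C k c) = dif D k (i k c)" using c by simp
  also have "\<dots> = \<zero>\<^bsub>ob D (k - 1)\<^esub>" using z y' dz by (simp flip: c(2))
  finally have "dif C k c = \<zero>\<^bsub>ob C (k - 1)\<^esub>" using c by (intro i_eq_zero) auto
  then have "c \<in> cyc C k" using c by (simp add: cyc_def)
  moreover have "y = dif D (k + 1) z \<oplus>\<^bsub>ob D k\<^esub> i k c"
    using y' dz by (simp add: i.D.M.M.grp flip: c(2))
  ultimately show ?thesis using z by blast
qed

lemma acyclic:
  assumes "acyclic_at C k" "acyclic_at E k"
  shows "acyclic_at D k"
  unfolding acyclic_at_def
proof
  fix y assume y: "y \<in> cyc D k"
  then have "p k y \<in> boundaries E k" using assms(2) p.f_cyc by (auto simp: acyclic_at_def)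
  from middle_exact[OF y this] obtain c z where cz: "c \<in> cyc C k" "z \<in> carrier (ob D (k + 1))"
    "y = dif D (k + 1) z \<oplus>\<^bsub>ob D k\<^esub> i k c" by auto
  then have "i k c \<in> boundaries D k" using assms(1) i.f_boundaries by (auto simp: acyclic_at_def)
  moreover have "dif D (k + 1) z \<in> boundaries D k" using cz by (auto simp: boundaries_iff)
  ultimately show "y \<in> boundaries D k"
    using i.D.submodule_boundaries[of k] cz(3) by (auto simp: submodule_def)
qed

end

lemma (in zcx) torsion_module_homology_iff:
  assumes "S \<subseteq> carrier R"
  shows "torsion_module S (homology C k) \<longleftrightarrow> (\<exists>a\<in>S. \<forall>x\<in>cyc C k. a \<odot>\<^bsub>ob C k\<^esub> x \<in> boundaries C k)"
    and "torsion_cplx S C \<longleftrightarrow> (\<exists>a\<in>S. \<forall>k. \<forall>x\<in>cyc C k. a \<odot>\<^bsub>ob C k\<^esub> x \<in> boundaries C k)"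
proof -
  have "(\<forall>x\<in>carrier (homology C k). a \<odot>\<^bsub>homology C k\<^esub> x = \<zero>\<^bsub>homology C k\<^esub>)
      \<longleftrightarrow> (\<forall>x\<in>cyc C k. a \<odot>\<^bsub>ob C k\<^esub> x \<in> boundaries C k)" if "a \<in> S" for a k
  proof -
    have a: "a \<in> carrier R" using that assms by auto
    have "a \<odot>\<^bsub>ob C k\<^esub> x \<in> cyc C k" if "x \<in> cyc C k" for x
      using submodule_cyc a that by (simp add: submodule_def)
    then have "a \<odot>\<^bsub>homology C k\<^esub> cls C k x = \<zero>\<^bsub>homology C k\<^esub> \<longleftrightarrow> a \<odot>\<^bsub>ob C k\<^esub> x \<in> boundaries C k"
      if "x \<in> cyc C k" for x
      using that a by (simp add: cls_zero_iff flip: cls_smult)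
    then show ?thesis unfolding homology_carrier by blast
  qed
  then show "torsion_module S (homology C k) \<longleftrightarrow> (\<exists>a\<in>S. \<forall>x\<in>cyc C k. a \<odot>\<^bsub>ob C k\<^esub> x \<in> boundaries C k)"
    "torsion_cplx S C \<longleftrightarrow> (\<exists>a\<in>S. \<forall>k. \<forall>x\<in>cyc C k. a \<odot>\<^bsub>ob C k\<^esub> x \<in> boundaries C k)"
    by (simp_all add: torsion_module_def torsion_cplx_def)
qed

text \<open>
  If \<open>b\<close> kills the homology of the quotient, multiplication by \<open>b\<close> moves a class into the image of the
  homology of the subcomplex, which is killed by \<open>a\<close>; so \<open>b a\<close> kills the homology of the extension.
\<close>

lemma (in ses) torsion:
  assumes S: "submonoid S R" and "torsion_cplx S C" "torsion_cplx S E"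
  shows "torsion_cplx S D"
proof -
  have sub: "S \<subseteq> carrier R" using S by (simp add: submonoid.subset)
  obtain a where a: "a \<in> S" "\<And>k x. x \<in> cyc C k \<Longrightarrow> a \<odot>\<^bsub>ob C k\<^esub> x \<in> boundaries C k"
    using assms(2) i.C.torsion_module_homology_iff(2)[OF sub] by auto
  obtain b where b: "b \<in> S" "\<And>k x. x \<in> cyc E k \<Longrightarrow> b \<odot>\<^bsub>ob E k\<^esub> x \<in> boundaries E k"
    using assms(3) p.D.torsion_module_homology_iff(2)[OF sub] by auto
  have ab: "a \<in> carrier R" "b \<in> carrier R" using a b sub by auto
  have "(b \<otimes>\<^bsub>R\<^esub> a) \<odot>\<^bsub>ob D k\<^esub> y \<in> boundaries D k" if y: "y \<in> cyc D k" for k y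
  proof -
    note y' = i.D.cycD[OF y]
    have "b \<odot>\<^bsub>ob D k\<^esub> y \<in> cyc D k" using y' ab by (simp add: cyc_def i.D.M.modsimps)
    moreover have "p k (b \<odot>\<^bsub>ob D k\<^esub> y) \<in> boundaries E k" using y' ab b(2) p.f_cyc[OF y] by simp
    ultimately obtain c z where cz: "c \<in> cyc C k" "z \<in> carrier (ob D (k + 1))"
      "b \<odot>\<^bsub>ob D k\<^esub> y = dif D (k + 1) z \<oplus>\<^bsub>ob D k\<^esub> i k c" using middle_exact by blast
    have c: "c \<in> carrier (ob C k)" using cz by (auto simp: cyc_def)
    have 1: "i k (a \<odot>\<^bsub>ob C k\<^esub> c) \<in> boundaries D k" using a(2)[OF cz(1)] by (rule i.f_boundaries)
    have "a \<odot>\<^bsub>ob D (k + 1)\<^esub> z \<in> carrier (ob D (k + 1))" using cz ab by (simp add: i.D.M.modsimps)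
    then have 2: "dif D (k + 1) (a \<odot>\<^bsub>ob D (k + 1)\<^esub> z) \<in> boundaries D k" by (auto simp: boundaries_iff)
    have "(b \<otimes>\<^bsub>R\<^esub> a) \<odot>\<^bsub>ob D k\<^esub> y = a \<odot>\<^bsub>ob D k\<^esub> (b \<odot>\<^bsub>ob D k\<^esub> y)"
      using ab y' by (simp add: i.D.M.smult_assoc)
    also have "\<dots> = dif D (k + 1) (a \<odot>\<^bsub>ob D (k + 1)\<^esub> z) \<oplus>\<^bsub>ob D k\<^esub> i k (a \<odot>\<^bsub>ob C k\<^esub> c)"
      using ab cz(2) c by (simp add: cz(3) i.D.M.modsimps)
    finally show ?thesis using i.D.submodule_boundaries[of k] 1 2 by (simp add: submodule_def)
  qed
  moreover have "b \<otimes>\<^bsub>R\<^esub> a \<in> S" using S a b by (simp add: submonoid.m_closed)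
  ultimately show ?thesis using i.D.torsion_module_homology_iff(2)[OF sub] by auto
qed

lemma zmap_comp:
  assumes "zmap R C D f" "zmap R D E g"
  shows "zmap R C E (\<lambda>k x. g k (f k x))"
proof -
  interpret f: zmap R C D f by fact
  interpret g: zmap R D E g by fact
  show ?thesis
    by (intro zmap.intro zmap_axioms.intro f.C.zcx_axioms g.D.zcx_axioms)
      (auto intro: lin_maps_comp[OF f.lin g.lin])
qed

lemma (in zmap) qi_if_bij:
  assumes "\<And>k. bij_betw (f k) (carrier (ob C k)) (carrier (ob D k))"
  shows "qi C D f"
  unfolding qi_def hinj_def hsurj_def
proof (intro allI conjI ballI impI)
  have inj: "x = y" if "x \<in> carrier (ob C k)" "y \<in> carrier (ob C k)" "f k x = f k y" for x y k
    using assms[of k] that by (auto simp: bij_betw_def inj_on_def)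
  have surj: "\<exists>x\<in>carrier (ob C k). y = f k x" if "y \<in> carrier (ob D k)" for y k
    using assms[of k] that by (auto simp: bij_betw_def)
  fix k
  {
    fix x assume x: "x \<in> cyc C k" "f k x \<in> boundaries D k"
    then obtain z where "z \<in> carrier (ob D (k + 1))" "f k x = dif D (k + 1) z" by (auto simp: boundaries_iff)
    moreover obtain w where "w \<in> carrier (ob C (k + 1))" "z = f (k + 1) w" using surj calculation(1) by auto
    ultimately show "x \<in> boundaries C k" unfolding boundaries_iff using C.cycD[OF x(1)]
      by (intro bexI[of _ w] inj[of _ k]) simp_all
  next
    fix y assume y: "y \<in> cyc D k"
    obtain x where x: "x \<in> carrier (ob C k)" "y = f k x" using surj D.cycD(1)[OF y] by auto
    then have "f (k - 1) (dif C k x) = f (k - 1) \<zero>\<^bsub>ob C (k - 1)\<^esub>" using D.cycD(2)[OF y] by simp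
    then have "x \<in> cyc C k" using x inj[of "dif C k x" "k - 1"] by (simp add: cyc_def)
    with x show "\<exists>x\<in>cyc C k. \<exists>z\<in>carrier (ob D (k + 1)). y = dif D (k + 1) z \<oplus>\<^bsub>ob D k\<^esub> f k x"
      by (intro bexI[of _ x] bexI[of _ "\<zero>\<^bsub>ob D (k + 1)\<^esub>"]) simp_all
  }
qed

text \<open>
  In a short exact sequence the quotient complex is isomorphic to the third term, the coset that
  belongs to an element being the fibre over it.
\<close>

context ses
begin

definition fib :: "int \<Rightarrow> 'o \<Rightarrow> 'n set" where
  "fib k e = {y \<in> carrier (ob D k). p k y = e}"

lemma quot_cplx_sel [simp]:
  "ob (quot_cplx C D i) k = quot_module (ob D k) (i k ` carrier (ob C k))"
  "dif (quot_cplx C D i) k K = (i (k - 1) ` carrier (ob C (k - 1))) <+>\<^bsub>ob D (k - 1)\<^esub> (dif D k ` K)"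
  by (simp_all add: quot_cplx_def)

lemma submodule_image: "submodule R (ob D k) (i k ` carrier (ob C k))"
  unfolding submodule_def
proof (intro conjI ballI)
  show "\<zero>\<^bsub>ob D k\<^esub> \<in> i k ` carrier (ob C k)" using i.f_zero[of k] by (force intro: image_eqI[of _ _ "\<zero>\<^bsub>ob C k\<^esub>"])
next
  fix x y assume "x \<in> i k ` carrier (ob C k)" "y \<in> i k ` carrier (ob C k)"
  then obtain x' y' where "x' \<in> carrier (ob C k)" "x = i k x'" "y' \<in> carrier (ob C k)" "y = i k y'" by auto
  then show "x \<oplus>\<^bsub>ob D k\<^esub> y \<in> i k ` carrier (ob C k)"
    by (intro image_eqI[of _ _ "x' \<oplus>\<^bsub>ob C k\<^esub> y'"]) simp_all
next
  fix a x assume "a \<in> carrier R" "x \<in> i k ` carrier (ob C k)"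
  then obtain x' where "a \<in> carrier R" "x' \<in> carrier (ob C k)" "x = i k x'" by auto
  then show "a \<odot>\<^bsub>ob D k\<^esub> x \<in> i k ` carrier (ob C k)"
    by (intro image_eqI[of _ _ "a \<odot>\<^bsub>ob C k\<^esub> x'"]) (simp_all add: i.C.M.modsimps)
qed auto

lemma fib_eq:
  assumes y: "y \<in> carrier (ob D k)"
  shows "fib k (p k y) = i k ` carrier (ob C k) +>\<^bsub>ob D k\<^esub> y"
proof (intro equalityI subsetI)
  fix z assume "z \<in> fib k (p k y)"
  then have z: "z \<in> carrier (ob D k)" "p k z = p k y" by (auto simp: fib_def)
  then have "p k (z \<oplus>\<^bsub>ob D k\<^esub> \<ominus>\<^bsub>ob D k\<^esub> y) = \<zero>\<^bsub>ob E k\<^esub>" using y by (simp add: p.D.M.M.r_neg)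
  then obtain c where c: "c \<in> carrier (ob C k)" "z \<oplus>\<^bsub>ob D k\<^esub> \<ominus>\<^bsub>ob D k\<^esub> y = i k c"
    using ker[of "z \<oplus>\<^bsub>ob D k\<^esub> \<ominus>\<^bsub>ob D k\<^esub> y" k] y z by auto
  have "z = i k c \<oplus>\<^bsub>ob D k\<^esub> y" using y z by (simp add: i.D.M.M.grp flip: c(2))
  with c(1) show "z \<in> i k ` carrier (ob C k) +>\<^bsub>ob D k\<^esub> y" by (auto simp: coset_mem)
next
  fix z assume "z \<in> i k ` carrier (ob C k) +>\<^bsub>ob D k\<^esub> y"
  then show "z \<in> fib k (p k y)" using y by (auto simp: coset_mem fib_def)
qed

lemma push_d:
  assumes "y \<in> carrier (ob D k)"
  shows "(i (k - 1) ` carrier (ob C (k - 1))) <+>\<^bsub>ob D (k - 1)\<^esub> (dif D k ` (i k ` carrier (ob C k) +>\<^bsub>ob D k\<^esub> y))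
    = (i (k - 1) ` carrier (ob C (k - 1))) +>\<^bsub>ob D (k - 1)\<^esub> dif D k y"
proof (rule coset_push[OF i.D.mod submodule_image])
  show "dif D k ` i k ` carrier (ob C k) \<subseteq> i (k - 1) ` carrier (ob C (k - 1))"
  proof clarify
    fix c assume "c \<in> carrier (ob C k)"
    then show "dif D k (i k c) \<in> i (k - 1) ` carrier (ob C (k - 1))"
      by (intro image_eqI[of _ _ "dif C k c"]) simp_all
  qed
qed (use submodule_image[of k] assms in \<open>auto simp: submodule_def i.D.M.M.abelian_group_axioms\<close>)

lemma right_module_quot_cplx: "right_module R (ob (quot_cplx C D i) k)"
  by (simp add: right_module_quot[OF i.D.mod submodule_image])

lemma zcx_quot: "zcx R (quot_cplx C D i)"
proof (rule zcx.intro, goal_cases)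
  case (1 k) show ?case by (rule right_module_quot_cplx)
next
  case (2 k)
  let ?U = "\<lambda>k. i k ` carrier (ob C k)"
  have dc: "dif (quot_cplx C D i) k (?U k +>\<^bsub>ob D k\<^esub> y) = ?U (k - 1) +>\<^bsub>ob D (k - 1)\<^esub> dif D k y"
    if "y \<in> carrier (ob D k)" for y k using push_d[OF that] by simp
  note add = coset_add[OF i.D.mod submodule_image] and sm = coset_smult[OF i.D.mod submodule_image]
  show ?case
  proof (rule lin_mapsI)
    fix K assume "K \<in> carrier (ob (quot_cplx C D i) k)"
    then obtain y where y: "y \<in> carrier (ob D k)" "K = ?U k +>\<^bsub>ob D k\<^esub> y" by auto
    show "dif (quot_cplx C D i) k K \<in> carrier (ob (quot_cplx C D i) (k - 1))"
      unfolding y(2) dc[OF y(1)] using y(1) by auto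
    {
      fix L assume "L \<in> carrier (ob (quot_cplx C D i) k)"
      then obtain z where z: "z \<in> carrier (ob D k)" "L = ?U k +>\<^bsub>ob D k\<^esub> z" by auto
      have "K \<oplus>\<^bsub>ob (quot_cplx C D i) k\<^esub> L = ?U k +>\<^bsub>ob D k\<^esub> (y \<oplus>\<^bsub>ob D k\<^esub> z)"
        using y z by (simp add: add)
      moreover have "dif (quot_cplx C D i) k (?U k +>\<^bsub>ob D k\<^esub> (y \<oplus>\<^bsub>ob D k\<^esub> z))
        = ?U (k - 1) +>\<^bsub>ob D (k - 1)\<^esub> (dif D k y \<oplus>\<^bsub>ob D (k - 1)\<^esub> dif D k z)"
        using y z by (subst dc) simp_all
      ultimately show "dif (quot_cplx C D i) k (K \<oplus>\<^bsub>ob (quot_cplx C D i) k\<^esub> L) =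
        dif (quot_cplx C D i) k K \<oplus>\<^bsub>ob (quot_cplx C D i) (k - 1)\<^esub> dif (quot_cplx C D i) k L"
        unfolding y(2) z(2) dc[OF y(1)] dc[OF z(1)] using y z by (simp add: add)
    }
    fix a assume a: "a \<in> carrier R"
    have "a \<odot>\<^bsub>ob (quot_cplx C D i) k\<^esub> K = ?U k +>\<^bsub>ob D k\<^esub> (a \<odot>\<^bsub>ob D k\<^esub> y)"
      using y a by (simp add: sm)
    moreover have "dif (quot_cplx C D i) k (?U k +>\<^bsub>ob D k\<^esub> (a \<odot>\<^bsub>ob D k\<^esub> y))
      = ?U (k - 1) +>\<^bsub>ob D (k - 1)\<^esub> (a \<odot>\<^bsub>ob D (k - 1)\<^esub> dif D k y)"
      using y a by (subst dc) (simp_all add: i.D.M.modsimps)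
    ultimately show "dif (quot_cplx C D i) k (a \<odot>\<^bsub>ob (quot_cplx C D i) k\<^esub> K) =
      a \<odot>\<^bsub>ob (quot_cplx C D i) (k - 1)\<^esub> dif (quot_cplx C D i) k K"
      unfolding y(2) dc[OF y(1)] using y a by (simp add: sm)
  qed
next
  case (3 K k)
  then obtain y where y: "y \<in> carrier (ob D k)" "K = i k ` carrier (ob C k) +>\<^bsub>ob D k\<^esub> y" by auto
  have "i (k - 2) ` carrier (ob C (k - 2)) +>\<^bsub>ob D (k - 2)\<^esub> \<zero>\<^bsub>ob D (k - 2)\<^esub>
    = i (k - 2) ` carrier (ob C (k - 2))"
    by (rule coset_zero[OF i.D.mod submodule_image])
  then show ?case unfolding y(2) using y(1) push_d[OF y(1)] push_d[of "dif D k y" "k - 1"] by simp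
qed

lemma zmap_fib: "zmap R E (quot_cplx C D i) fib"
proof (intro zmap.intro zmap_axioms.intro p.D.zcx_axioms zcx_quot, goal_cases)
  case (1 k)
  note add = coset_add[OF i.D.mod submodule_image] and sm = coset_smult[OF i.D.mod submodule_image]
  show ?case
  proof (rule lin_mapsI)
    fix e assume "e \<in> carrier (ob E k)"
    then obtain y where y: "y \<in> carrier (ob D k)" "e = p k y" using surj by blast
    then show "fib k e \<in> carrier (ob (quot_cplx C D i) k)" by (auto simp: fib_eq)
    {
      fix e' assume "e' \<in> carrier (ob E k)"
      then obtain z where z: "z \<in> carrier (ob D k)" "e' = p k z" using surj by blast
      have "fib k (p k (y \<oplus>\<^bsub>ob D k\<^esub> z)) = i k ` carrier (ob C k) +>\<^bsub>ob D k\<^esub> (y \<oplus>\<^bsub>ob D k\<^esub> z)"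
        using y z by (intro fib_eq) simp
      then show "fib k (e \<oplus>\<^bsub>ob E k\<^esub> e') = fib k e \<oplus>\<^bsub>ob (quot_cplx C D i) k\<^esub> fib k e'"
        using y z by (simp add: fib_eq add)
    }
    fix a assume a: "a \<in> carrier R"
    have "fib k (p k (a \<odot>\<^bsub>ob D k\<^esub> y)) = i k ` carrier (ob C k) +>\<^bsub>ob D k\<^esub> (a \<odot>\<^bsub>ob D k\<^esub> y)"
      using y a by (intro fib_eq) (simp add: i.D.M.modsimps)
    then show "fib k (a \<odot>\<^bsub>ob E k\<^esub> e) = a \<odot>\<^bsub>ob (quot_cplx C D i) k\<^esub> fib k e"
      using y a by (simp add: fib_eq sm)
  qed
next
  case (2 e k)
  then obtain y where y: "y \<in> carrier (ob D k)" "e = p k y" using surj by blast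
  have "fib (k - 1) (p (k - 1) (dif D k y)) = i (k - 1) ` carrier (ob C (k - 1)) +>\<^bsub>ob D (k - 1)\<^esub> dif D k y"
    using y by (intro fib_eq) simp
  with y show ?case by (simp add: fib_eq push_d)
qed

lemma qi_fib: "qi E (quot_cplx C D i) fib"
proof (rule zmap.qi_if_bij[OF zmap_fib])
  fix k
  show "bij_betw (fib k) (carrier (ob E k)) (carrier (ob (quot_cplx C D i) k))"
  proof (intro bij_betw_imageI inj_onI equalityI subsetI)
    fix e e' assume e: "e \<in> carrier (ob E k)" and "fib k e = fib k e'"
    moreover obtain y where "y \<in> fib k e" using surj[OF e] by (auto simp: fib_def)
    ultimately show "e = e'" by (auto simp: fib_def)
  next
    fix K assume "K \<in> fib k ` carrier (ob E k)"
    then show "K \<in> carrier (ob (quot_cplx C D i) k)"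
      using lin_maps_closed[OF zmap.lin[OF zmap_fib]] by blast
  next
    fix K assume "K \<in> carrier (ob (quot_cplx C D i) k)"
    then obtain y where "y \<in> carrier (ob D k)" "K = fib k (p k y)" by (auto simp: fib_eq)
    then show "K \<in> fib k ` carrier (ob E k)" by auto
  qed
qed

end

section \<open>Twisted sums, suspensions and cones\<close>

lemma dsum_sel [simp]:
  "carrier (dsum_module M N) = carrier M \<times> carrier N"
  "\<zero>\<^bsub>dsum_module M N\<^esub> = (\<zero>\<^bsub>M\<^esub>, \<zero>\<^bsub>N\<^esub>)"
  "(x, y) \<oplus>\<^bsub>dsum_module M N\<^esub> (x', y') = (x \<oplus>\<^bsub>M\<^esub> x', y \<oplus>\<^bsub>N\<^esub> y')"
  "a \<odot>\<^bsub>dsum_module M N\<^esub> (x, y) = (a \<odot>\<^bsub>M\<^esub> x, a \<odot>\<^bsub>N\<^esub> y)"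
  by (simp_all add: dsum_module_def)

lemma right_module_dsum:
  assumes "right_module R M" "right_module R N"
  shows "right_module R (dsum_module M N)"
proof -
  interpret M: right_module R M by fact
  interpret N: right_module R N by fact
  have "abelian_group (dsum_module M N)"
  proof (rule abelian_groupI)
    fix z assume "z \<in> carrier (dsum_module M N)"
    then obtain x y where "z = (x, y)" "x \<in> carrier M" "y \<in> carrier N" by auto
    then show "\<exists>w\<in>carrier (dsum_module M N). w \<oplus>\<^bsub>dsum_module M N\<^esub> z = \<zero>\<^bsub>dsum_module M N\<^esub>"
      by (intro bexI[of _ "(\<ominus>\<^bsub>M\<^esub> x, \<ominus>\<^bsub>N\<^esub> y)"]) (simp_all add: M.M.l_neg N.M.l_neg)
  qed (auto simp: M.M.a_ac N.M.a_ac)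
  then show ?thesis
    by (intro right_moduleI') (auto simp: M.modsimps N.modsimps M.smult_assoc N.smult_assoc M.R.ring_axioms)
qed

text \<open>
  The extension of \<open>E\<close> by \<open>C\<close> with attaching maps \<open>t\<close>; mapping cones and complexes with
  attached cells are of this form.
\<close>

definition tw :: "('r, 'm) cplx \<Rightarrow> ('r, 'n) cplx \<Rightarrow> (int \<Rightarrow> 'm \<Rightarrow> 'n) \<Rightarrow> ('r, 'm \<times> 'n) cplx" where
  "tw E C t = \<lparr>ob = (\<lambda>k. dsum_module (ob E k) (ob C k)),
     dif = (\<lambda>k (e, c). (dif E k e, t k e \<oplus>\<^bsub>ob C (k - 1)\<^esub> dif C k c))\<rparr>"

definition sus :: "('r, 'm) cplx \<Rightarrow> ('r, 'm) cplx" where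
  "sus C = \<lparr>ob = (\<lambda>k. ob C (k - 1)), dif = (\<lambda>k x. \<ominus>\<^bsub>ob C (k - 2)\<^esub> dif C (k - 1) x)\<rparr>"

lemma tw_sel [simp]: "ob (tw E C t) k = dsum_module (ob E k) (ob C k)"
  "dif (tw E C t) k (e, c) = (dif E k e, t k e \<oplus>\<^bsub>ob C (k - 1)\<^esub> dif C k c)"
  by (simp_all add: tw_def)

lemma sus_sel [simp]: "ob (sus C) k = ob C (k - 1)"
  "dif (sus C) k x = \<ominus>\<^bsub>ob C (k - 2)\<^esub> dif C (k - 1) x"
  by (simp_all add: sus_def)

lemma cone_eq_tw: "cone C D f = tw (sus C) D (\<lambda>k. f (k - 1))"
  by (simp add: cone_def tw_def sus_def)

lemma zcx_sus:
  assumes "zcx R C"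
  shows "zcx R (sus C)"
proof -
  interpret C: zcx R C by fact
  show ?thesis
  proof (rule zcx.intro, goal_cases)
    case (1 k) then show ?case by (simp add: C.mod)
  next
    case (2 k)
    have "(\<lambda>x. \<ominus>\<^bsub>ob C (k - 2)\<^esub> dif C (k - 1) x) \<in> lin_maps R (ob C (k - 1)) (ob C (k - 2))"
      using C.d_lin[of "k - 1"] by (intro lin_maps_neg C.mod) simp
    moreover have "dif (sus C) k = (\<lambda>x. \<ominus>\<^bsub>ob C (k - 2)\<^esub> dif C (k - 1) x)" by auto
    ultimately show ?case by simp
  next
    case (3 x k) then show ?case by simp
  qed
qed

locale twisted = E: zcx R E + C: zcx R C
  for R :: "('r, 'k) ring_scheme" and E :: "('r, 'm) cplx" and C :: "('r, 'n) cplx" +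
  fixes t :: "int \<Rightarrow> 'm \<Rightarrow> 'n"
  assumes t_lin: "t k \<in> lin_maps R (ob E k) (ob C (k - 1))"
    and t_d: "e \<in> carrier (ob E k) \<Longrightarrow> t (k - 1) (dif E k e) \<oplus>\<^bsub>ob C (k - 2)\<^esub> dif C (k - 1) (t k e) = \<zero>\<^bsub>ob C (k - 2)\<^esub>"
begin

lemma t_closed [simp]: "e \<in> carrier (ob E k) \<Longrightarrow> l = k - 1 \<Longrightarrow> t k e \<in> carrier (ob C l)"
  using lin_maps_closed[OF t_lin] by simp

lemma t_add [simp]: "e \<in> carrier (ob E k) \<Longrightarrow> e' \<in> carrier (ob E k) \<Longrightarrow>
    t k (e \<oplus>\<^bsub>ob E k\<^esub> e') = t k e \<oplus>\<^bsub>ob C (k - 1)\<^esub> t k e'"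
  using lin_maps_add[OF t_lin] by simp

lemma t_smult [simp]: "a \<in> carrier R \<Longrightarrow> e \<in> carrier (ob E k) \<Longrightarrow>
    t k (a \<odot>\<^bsub>ob E k\<^esub> e) = a \<odot>\<^bsub>ob C (k - 1)\<^esub> t k e"
  using lin_maps_smult[OF t_lin] by simp

lemma t_zero [simp]: "t k \<zero>\<^bsub>ob E k\<^esub> = \<zero>\<^bsub>ob C (k - 1)\<^esub>"
  using lin_maps_zero[OF t_lin] E.M.M.abelian_group_axioms C.M.M.abelian_group_axioms by blast

lemma zcx_tw: "zcx R (tw E C t)"
proof (rule zcx.intro, goal_cases)
  case (1 k) show ?case by (simp add: right_module_dsum E.mod C.mod)
next
  case (2 k)
  show ?case
    by (rule lin_mapsI) (auto simp: C.M.M.grp C.M.modsimps)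
next
  case (3 x k)
  then obtain e c where "x = (e, c)" "e \<in> carrier (ob E k)" "c \<in> carrier (ob C k)" by auto
  then show ?case by (simp add: t_d)
qed

lemma ses_tw: "ses R C (tw E C t) E (\<lambda>k c. (\<zero>\<^bsub>ob E k\<^esub>, c)) (\<lambda>k. fst)"
proof -
  interpret T: zcx R "tw E C t" by (rule zcx_tw)
  show ?thesis
  proof (intro ses.intro zmap.intro ses_axioms.intro zmap_axioms.intro C.zcx_axioms E.zcx_axioms zcx_tw,
      goal_cases)
    case (1 k) show ?case by (rule lin_mapsI) auto
  next
    case (2 x k) then show ?case by simp
  next
    case (3 k) show ?case by (rule lin_mapsI) auto
  next
    case (4 x k) then show ?case by auto
  next
    case (5 k) show ?case by (auto intro: inj_onI)
  next
    case (6 e k) then show ?case by (intro bexI[of _ "(e, \<zero>\<^bsub>ob C k\<^esub>)"]) auto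
  next
    case (7 c k) show ?case by simp
  next
    case (8 y k) then show ?case by auto
  qed
qed

end

lemma dsum_minus:
  assumes "right_module R M" "right_module R N" "x \<in> carrier M" "y \<in> carrier N"
  shows "\<ominus>\<^bsub>dsum_module M N\<^esub> (x, y) = (\<ominus>\<^bsub>M\<^esub> x, \<ominus>\<^bsub>N\<^esub> y)"
proof -
  interpret M: right_module R M by fact
  interpret N: right_module R N by fact
  interpret D: right_module R "dsum_module M N" by (rule right_module_dsum) fact+
  show ?thesis by (rule D.M.minus_equality) (simp_all add: assms M.M.l_neg N.M.l_neg)
qed

lemma cone_sel [simp]: "ob (cone C D f) k = dsum_module (ob C (k - 1)) (ob D k)"
  "dif (cone C D f) k (x, y) =
     (\<ominus>\<^bsub>ob C (k - 2)\<^esub> dif C (k - 1) x, f (k - 1) x \<oplus>\<^bsub>ob D (k - 1)\<^esub> dif D k y)"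
  by (simp_all add: cone_eq_tw)

context zmap
begin

lemma twisted_cone: "twisted R (sus C) D (\<lambda>k. f (k - 1))"
proof -
  interpret S: zcx R "sus C" by (rule zcx_sus) (rule C.zcx_axioms)
  show ?thesis
  proof (intro twisted.intro twisted_axioms.intro S.zcx_axioms D.zcx_axioms, goal_cases)
    case (1 k) show ?case using lin[of "k - 1"] by simp
  next
    case (2 e k) then show ?case by (simp add: D.M.M.l_neg)
  qed
qed

lemma zcx_cone: "zcx R (cone C D f)"
  unfolding cone_eq_tw by (rule twisted.zcx_tw[OF twisted_cone])

lemma ses_cone: "ses R D (cone C D f) (sus C) (\<lambda>k y. (\<zero>\<^bsub>ob C (k - 1)\<^esub>, y)) (\<lambda>k. fst)"
  using twisted.ses_tw[OF twisted_cone] by (simp add: cone_eq_tw)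

text \<open>
  This is the long exact sequence of the cone at one spot; it turns statements about maps into
  statements about one complex and back.
\<close>

lemma cone_acyclic_iff: "acyclic_at (cone C D f) k \<longleftrightarrow> hsurj C D f k \<and> hinj C D f (k - 1)"
proof (intro iffI conjI)
  interpret K: zcx R "cone C D f" by (rule zcx_cone)
  assume ac: "acyclic_at (cone C D f) k"
  show "hsurj C D f k" unfolding hsurj_def
  proof
    fix y assume y: "y \<in> cyc D k"
    have "\<exists>w\<in>carrier (ob (cone C D f) (k + 1)). dif (cone C D f) (k + 1) w = (\<zero>\<^bsub>ob C (k - 1)\<^esub>, y)"
      using D.cycD[OF y] by (intro K.acyclicD[OF ac]) simp_all
    then obtain c z where cz: "c \<in> carrier (ob C k)" "z \<in> carrier (ob D (k + 1))"
      "\<ominus>\<^bsub>ob C (k - 1)\<^esub> dif C k c = \<zero>\<^bsub>ob C (k - 1)\<^esub>" "f k c \<oplus>\<^bsub>ob D k\<^esub> dif D (k + 1) z = y" by auto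
    then have "dif C k c = \<zero>\<^bsub>ob C (k - 1)\<^esub>"
      using C.M.M.minus_minus[of "dif C k c" "k - 1"] by simp
    with cz have "c \<in> cyc C k" "y = dif D (k + 1) z \<oplus>\<^bsub>ob D k\<^esub> f k c"
      by (auto simp: cyc_def D.M.M.a_comm)
    with cz(2) show "\<exists>x\<in>cyc C k. \<exists>z\<in>carrier (ob D (k + 1)). y = dif D (k + 1) z \<oplus>\<^bsub>ob D k\<^esub> f k x" by auto
  qed
  show "hinj C D f (k - 1)" unfolding hinj_def
  proof (intro ballI impI)
    fix x assume x: "x \<in> cyc C (k - 1)" "f (k - 1) x \<in> boundaries D (k - 1)"
    then obtain z where z: "z \<in> carrier (ob D k)" "f (k - 1) x = dif D k z" by (auto simp: boundaries_iff)
    have "\<exists>w\<in>carrier (ob (cone C D f) (k + 1)). dif (cone C D f) (k + 1) w = (x, \<ominus>\<^bsub>ob D k\<^esub> z)"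
      using C.cycD[OF x(1)] z by (intro K.acyclicD[OF ac]) (simp_all add: D.M.M.r_neg)
    then obtain c where c: "c \<in> carrier (ob C k)" "x = \<ominus>\<^bsub>ob C (k - 1)\<^esub> dif C k c" by auto
    then show "x \<in> boundaries C (k - 1)"
      unfolding boundaries_iff by (intro bexI[of _ "\<ominus>\<^bsub>ob C k\<^esub> c"]) simp_all
  qed
next
  assume h: "hsurj C D f k \<and> hinj C D f (k - 1)"
  show "acyclic_at (cone C D f) k"
  proof (rule acyclicI)
    fix w assume "w \<in> carrier (ob (cone C D f) k)" "dif (cone C D f) k w = \<zero>\<^bsub>ob (cone C D f) (k - 1)\<^esub>"
    then obtain x y where w: "w = (x, y)" "x \<in> carrier (ob C (k - 1))" "y \<in> carrier (ob D k)"
      and dx: "\<ominus>\<^bsub>ob C (k - 2)\<^esub> dif C (k - 1) x = \<zero>\<^bsub>ob C (k - 2)\<^esub>"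
      and fx: "f (k - 1) x \<oplus>\<^bsub>ob D (k - 1)\<^esub> dif D k y = \<zero>\<^bsub>ob D (k - 1)\<^esub>" by auto
    have "dif C (k - 1) x = \<zero>\<^bsub>ob C (k - 2)\<^esub>"
      using dx w C.M.M.minus_minus[of "dif C (k - 1) x" "k - 2"] by simp
    then have "x \<in> cyc C (k - 1)" using w by (simp add: cyc_def)
    moreover have "f (k - 1) x = dif D k (\<ominus>\<^bsub>ob D k\<^esub> y)"
      using fx w D.M.M.minus_equality[of "k - 1" "f (k - 1) x" "dif D k y"] by simp
    then have "f (k - 1) x \<in> boundaries D (k - 1)"
      unfolding boundaries_iff using w by (intro bexI[of _ "\<ominus>\<^bsub>ob D k\<^esub> y"]) simp_all
    ultimately obtain c where c: "c \<in> carrier (ob C k)" "x = dif C k c"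
      using h unfolding hinj_def by (force simp: boundaries_iff)
    have "y \<oplus>\<^bsub>ob D k\<^esub> f k c \<in> cyc D k" using w c fx by (simp add: cyc_def D.M.M.a_comm)
    then obtain x' z where x': "x' \<in> cyc C k" and z: "z \<in> carrier (ob D (k + 1))"
      "y \<oplus>\<^bsub>ob D k\<^esub> f k c = dif D (k + 1) z \<oplus>\<^bsub>ob D k\<^esub> f k x'" using h unfolding hsurj_def by blast
    note x'' = C.cycD[OF x']
    have "y = (y \<oplus>\<^bsub>ob D k\<^esub> f k c) \<oplus>\<^bsub>ob D k\<^esub> \<ominus>\<^bsub>ob D k\<^esub> f k c" using w c by (simp add: D.M.M.grp)
    also have "\<dots> = f k (\<ominus>\<^bsub>ob C k\<^esub> c \<oplus>\<^bsub>ob C k\<^esub> x') \<oplus>\<^bsub>ob D k\<^esub> dif D (k + 1) z"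
      unfolding z(2) using z(1) c x'' by (simp add: D.M.M.grp)
    finally show "\<exists>v\<in>carrier (ob (cone C D f) (k + 1)). w = dif (cone C D f) (k + 1) v"
      using w c x'' z(1)
      by (intro bexI[of _ "(\<ominus>\<^bsub>ob C k\<^esub> c \<oplus>\<^bsub>ob C k\<^esub> x', z)"]) simp_all
  qed
qed

lemma qi_iff_cone: "qi C D f \<longleftrightarrow> (\<forall>k. acyclic_at (cone C D f) k)"
  unfolding qi_def cone_acyclic_iff by (metis add_diff_cancel_right')

end

section \<open>Lifting through quasi-isomorphisms\<close>

text \<open>
  The homotopy is built upwards from degree \<open>0\<close>: what it misses in the next degree is a cycle, hence a
  boundary, and lifts linearly by projectivity.  Acyclicity is assumed below \<open>q\<close> only, so that the
  lemma also contracts a complex of projectives below its lowest homology.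
\<close>

lemma null_homotopy:
  assumes "zmap R Q E u"
    and proj: "\<And>k. finite_retract R (ob Q k)"
    and neg: "\<And>k. k < 0 \<Longrightarrow> trivial_module (ob Q k)"
    and acyc: "\<And>k. k < q \<Longrightarrow> acyclic_at E k"
  shows "\<exists>s. (\<forall>k. s k \<in> lin_maps R (ob Q k) (ob E (k + 1))) \<and>
    (\<forall>k<q. \<forall>x\<in>carrier (ob Q k).
       u k x = dif E (k + 1) (s k x) \<oplus>\<^bsub>ob E k\<^esub> s (k - 1) (dif Q k x))"
proof -
  interpret u: zmap R Q E u by fact
  let ?P = "\<lambda>q s. (\<forall>k. s k \<in> lin_maps R (ob Q k) (ob E (k + 1))) \<and>
    (\<forall>k<q. \<forall>x\<in>carrier (ob Q k).
       u k x = dif E (k + 1) (s k x) \<oplus>\<^bsub>ob E k\<^esub> s (k - 1) (dif Q k x))"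
  have "\<exists>s. ?P (int n) s" if "int n \<le> max q 0" for n
    using that
  proof (induction n)
    case 0
    have "u k x = \<zero>\<^bsub>ob E k\<^esub>" if "k < 0" "x \<in> carrier (ob Q k)" for k x
      using neg[OF that(1)] that(2) by (auto simp: trivial_module_def)
    then show ?case
      by (intro exI[of _ "\<lambda>k x. \<zero>\<^bsub>ob E (k + 1)\<^esub>"]) (simp add: lin_maps_zero_map u.D.mod)
  next
    case (Suc n)
    have "\<exists>s. ?P (int n) s" by (rule Suc.IH) (use Suc.prems in auto)
    then obtain s where s: "\<And>k. s k \<in> lin_maps R (ob Q k) (ob E (k + 1))"
      and us: "\<And>k x. k < int n \<Longrightarrow> x \<in> carrier (ob Q k) \<Longrightarrow>
        u k x = dif E (k + 1) (s k x) \<oplus>\<^bsub>ob E k\<^esub> s (k - 1) (dif Q k x)" by blast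
    define n' where "n' = int n"
    have s_cl: "s k x \<in> carrier (ob E l)" if "x \<in> carrier (ob Q k)" "l = k + 1" for k l x
      using lin_maps_closed[OF s that(1)] that by simp
    have s0: "s k \<zero>\<^bsub>ob Q k\<^esub> = \<zero>\<^bsub>ob E (k + 1)\<^esub>" for k
      using lin_maps_zero[OF s u.C.M.M.abelian_group_axioms u.D.M.M.abelian_group_axioms] .
    let ?v = "\<lambda>x. u n' x \<oplus>\<^bsub>ob E n'\<^esub> \<ominus>\<^bsub>ob E n'\<^esub> s (n' - 1) (dif Q n' x)"
    have sl: "s (n' - 1) \<in> lin_maps R (ob Q (n' - 1)) (ob E n')" using s[of "n' - 1"] by simp
    have v: "?v \<in> lin_maps R (ob Q n') (ob E n')"
      by (intro lin_maps_plus lin_maps_neg u.D.mod u.lin lin_maps_comp[OF u.C.d_lin sl])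
    \<comment> \<open>the defect of the homotopy built so far is a cycle, so it can be lifted\<close>
    have dv: "dif E n' (?v x) = \<zero>\<^bsub>ob E (n' - 1)\<^esub>" if x: "x \<in> carrier (ob Q n')" for x
    proof -
      have "u (n' - 1) (dif Q n' x) = dif E n' (s (n' - 1) (dif Q n' x))
          \<oplus>\<^bsub>ob E (n' - 1)\<^esub> s (n' - 2) (dif Q (n' - 1) (dif Q n' x))"
        using us[of "n' - 1" "dif Q n' x"] x by (simp add: n'_def)
      moreover have "dif Q (n' - 1) (dif Q n' x) = \<zero>\<^bsub>ob Q (n' - 2)\<^esub>" using x by simp
      moreover have "s (n' - 2) \<zero>\<^bsub>ob Q (n' - 2)\<^esub> = \<zero>\<^bsub>ob E (n' - 1)\<^esub>" using s0[of "n' - 2"] by simp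
      ultimately have "u (n' - 1) (dif Q n' x) = dif E n' (s (n' - 1) (dif Q n' x))"
        using s_cl[of "dif Q n' x" "n' - 1" n'] x by simp
      then have "dif E n' (u n' x) = dif E n' (s (n' - 1) (dif Q n' x))" using x by simp
      then show ?thesis using s_cl[of "dif Q n' x" "n' - 1" n'] x by (simp add: u.D.M.M.r_neg)
    qed
    have "acyclic_at E n'" using acyc[of n'] Suc.prems by (simp add: n'_def split: if_splits)
    then have lift: "\<exists>y\<in>carrier (ob E (n' + 1)). dif E (n' + 1) y = ?v x" if "x \<in> carrier (ob Q n')" for x
      using dv[OF that] lin_maps_closed[OF v that] by (intro u.D.acyclicD) auto
    have dl: "dif E (n' + 1) \<in> lin_maps R (ob E (n' + 1)) (ob E n')" using u.D.d_lin[of "n' + 1"] by simp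
    obtain s' where s': "s' \<in> lin_maps R (ob Q n') (ob E (n' + 1))"
      and ds': "\<And>x. x \<in> carrier (ob Q n') \<Longrightarrow> dif E (n' + 1) (s' x) = ?v x"
      using finite_retract_lift[OF proj u.C.mod u.D.mod u.D.mod v dl lift] by blast
    have "?P (int (Suc n)) (s(n' := s'))"
    proof (intro conjI allI impI ballI)
      fix k show "(s(n' := s')) k \<in> lin_maps R (ob Q k) (ob E (k + 1))" using s s' by simp
    next
      fix k x assume k: "k < int (Suc n)" and x: "x \<in> carrier (ob Q k)"
      show "u k x = dif E (k + 1) ((s(n' := s')) k x) \<oplus>\<^bsub>ob E k\<^esub> (s(n' := s')) (k - 1) (dif Q k x)"
      proof (cases "k = n'")
        case True
        then show ?thesis using ds' x s_cl[of "dif Q n' x" "n' - 1" n'] by (simp add: u.D.M.M.grp)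
      next
        case False
        then show ?thesis using us[of k x] k x by (simp add: n'_def)
      qed
    qed
    then show ?case by blast
  qed
  from this[of "nat (max q 0)"] obtain s where "?P (max q 0) s" by auto
  then have "?P q s" by auto
  then show ?thesis by blast
qed

definition bounded_perfect :: "('r, 'k) ring_scheme \<Rightarrow> int \<Rightarrow> ('r, 'm) cplx \<Rightarrow> bool" where
  "bounded_perfect R N P \<longleftrightarrow> zcx R P \<and> (\<forall>k. finite_retract R (ob P k)) \<and>
     (\<forall>k. k < 0 \<or> N < k \<longrightarrow> trivial_module (ob P k))"

lemma null_homotopy_bounded:
  assumes "zmap R Q E u" "bounded_perfect R N Q" "\<And>k. acyclic_at E k"
  obtains s where "\<And>k. s k \<in> lin_maps R (ob Q k) (ob E (k + 1))"
    and "\<And>k x. x \<in> carrier (ob Q k) \<Longrightarrow>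
       u k x = dif E (k + 1) (s k x) \<oplus>\<^bsub>ob E k\<^esub> s (k - 1) (dif Q k x)"
proof -
  interpret u: zmap R Q E u by fact
  obtain s where s: "\<And>k. s k \<in> lin_maps R (ob Q k) (ob E (k + 1))"
    and us: "\<And>k x. k < N + 1 \<Longrightarrow> x \<in> carrier (ob Q k) \<Longrightarrow>
       u k x = dif E (k + 1) (s k x) \<oplus>\<^bsub>ob E k\<^esub> s (k - 1) (dif Q k x)"
    using null_homotopy[OF assms(1), of "N + 1"] assms(2,3) unfolding bounded_perfect_def by blast
  have s0: "s k \<zero>\<^bsub>ob Q k\<^esub> = \<zero>\<^bsub>ob E (k + 1)\<^esub>" for k
    using lin_maps_zero[OF s u.C.M.M.abelian_group_axioms u.D.M.M.abelian_group_axioms] .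
  have "u k x = dif E (k + 1) (s k x) \<oplus>\<^bsub>ob E k\<^esub> s (k - 1) (dif Q k x)" if x: "x \<in> carrier (ob Q k)" for k x
  proof (cases "k < N + 1")
    case False
    then have "x = \<zero>\<^bsub>ob Q k\<^esub>" using assms(2) x by (auto simp: bounded_perfect_def trivial_module_def)
    then show ?thesis using s0[of "k - 1"] s0[of k] u.D.d_zero[of "k + 1"] by simp
  qed (use us x in auto)
  with s show thesis by (rule that)
qed

lemma fst_lin: "fst \<in> lin_maps R (dsum_module M N) M"
  and snd_lin: "snd \<in> lin_maps R (dsum_module M N) N"
  by (auto intro!: lin_mapsI)

text \<open>
  A null-homotopy of the composite of \<open>h\<close> with the inclusion of \<open>D\<close> into the cone of \<open>g\<close> has two components:
  a lift of \<open>h\<close> through \<open>g\<close>, and a homotopy between \<open>h\<close> and the image of the lift.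
\<close>

lemma lift_quasi_iso:
  assumes "zmap R C D g" "qi C D g" "zmap R P D h" "bounded_perfect R N P"
  obtains a b where "zmap R P C a" "\<And>k. b k \<in> lin_maps R (ob P k) (ob D (k + 1))"
    and "\<And>k x. x \<in> carrier (ob P k) \<Longrightarrow>
      h k x = g k (a k x) \<oplus>\<^bsub>ob D k\<^esub> (dif D (k + 1) (b k x) \<oplus>\<^bsub>ob D k\<^esub> b (k - 1) (dif P k x))"
proof -
  interpret g: zmap R C D g by fact
  interpret h: zmap R P D h by fact
  let ?E = "cone C D g"
  have zm: "zmap R P ?E (\<lambda>k x. (\<zero>\<^bsub>ob C (k - 1)\<^esub>, h k x))"
    using zmap_comp[OF h.zmap_axioms, OF ses.axioms(1)[OF g.ses_cone]] by simp
  obtain s where s: "\<And>k. s k \<in> lin_maps R (ob P k) (ob ?E (k + 1))"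
    and us: "\<And>k x. x \<in> carrier (ob P k) \<Longrightarrow>
       (\<zero>\<^bsub>ob C (k - 1)\<^esub>, h k x) = dif ?E (k + 1) (s k x) \<oplus>\<^bsub>ob ?E k\<^esub> s (k - 1) (dif P k x)"
    using null_homotopy_bounded[OF zm assms(4)] g.qi_iff_cone assms(2) by metis
  define a where "a = (\<lambda>k x. fst (s k x))"
  define b where "b = (\<lambda>k x. snd (s k x))"
  have sab: "s k x = (a k x, b k x)" for k x by (simp add: a_def b_def)
  have s': "s k \<in> lin_maps R (ob P k) (dsum_module (ob C k) (ob D (k + 1)))" for k
    using s[of k] by simp
  have al: "a k \<in> lin_maps R (ob P k) (ob C k)" and bl: "b k \<in> lin_maps R (ob P k) (ob D (k + 1))" for k
    unfolding a_def b_def by (rule lin_maps_comp[OF s' fst_lin] lin_maps_comp[OF s' snd_lin])+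
  have acl: "a k x \<in> carrier (ob C k)" if "x \<in> carrier (ob P k)" for k x
    using lin_maps_closed[OF al that] .
  have bcl: "b k x \<in> carrier (ob D l)" if "x \<in> carrier (ob P k)" "l = k + 1" for k l x
    using lin_maps_closed[OF bl that(1)] that by simp
  have eq1: "a (k - 1) (dif P k x) = dif C k (a k x)" if x: "x \<in> carrier (ob P k)" for k x
  proof -
    have "a (k - 1) (dif P k x) \<oplus>\<^bsub>ob C (k - 1)\<^esub> \<ominus>\<^bsub>ob C (k - 1)\<^esub> dif C k (a k x) = \<zero>\<^bsub>ob C (k - 1)\<^esub>"
      using us[OF x] x acl[OF x] acl[of "dif P k x" "k - 1"] by (simp add: sab g.C.M.M.a_comm)
    from g.C.M.M.eq_if_minus_zero[OF _ _ this] show ?thesis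
      using x acl[OF x] acl[of "dif P k x" "k - 1"] by simp
  qed
  have eq2: "h k x = g k (a k x) \<oplus>\<^bsub>ob D k\<^esub> (dif D (k + 1) (b k x) \<oplus>\<^bsub>ob D k\<^esub> b (k - 1) (dif P k x))"
    if x: "x \<in> carrier (ob P k)" for k x
    using us[OF x] x acl[OF x] bcl[OF x] bcl[of "dif P k x" "k - 1"] by (simp add: sab g.D.M.M.a_assoc)
  have "zmap R P C a"
    by (intro zmap.intro zmap_axioms.intro h.C.zcx_axioms g.C.zcx_axioms al eq1)
  with bl eq2 show thesis by (intro that[of a b])
qed

lemma (in zcx) sus_cyc: "cyc (sus C) k = cyc C (k - 1)"
proof -
  have "\<ominus>\<^bsub>ob C (k - 2)\<^esub> dif C (k - 1) x = \<zero>\<^bsub>ob C (k - 2)\<^esub> \<longleftrightarrow> dif C (k - 1) x = \<zero>\<^bsub>ob C (k - 2)\<^esub>"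
    if "x \<in> carrier (ob C (k - 1))" for x
    using M.M.minus_minus[of "dif C (k - 1) x" "k - 2"] that by auto
  then show ?thesis by (auto simp: cyc_def)
qed

lemma (in zcx) sus_boundaries: "boundaries (sus C) k = boundaries C (k - 1)"
proof -
  have "\<exists>z\<in>carrier (ob C k). \<ominus>\<^bsub>ob C (k - 1)\<^esub> dif C k y = dif C k z" if "y \<in> carrier (ob C k)" for y
    using that by (intro bexI[of _ "\<ominus>\<^bsub>ob C k\<^esub> y"]) simp_all
  moreover have "\<exists>z\<in>carrier (ob C k). dif C k y = \<ominus>\<^bsub>ob C (k - 1)\<^esub> dif C k z" if "y \<in> carrier (ob C k)" for y
    using that by (intro bexI[of _ "\<ominus>\<^bsub>ob C k\<^esub> y"]) simp_all
  ultimately show ?thesis by (auto simp: boundaries_iff)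
qed

lemma (in zcx) sus_acyclic: "acyclic_at (sus C) k \<longleftrightarrow> acyclic_at C (k - 1)"
  by (simp add: acyclic_at_def sus_cyc sus_boundaries)

text \<open>
  The same argument for maps of degree \<open>-1\<close>, that is, chain maps to a suspension: an attaching map can be
  moved through a quasi-isomorphism.
\<close>

lemma lift_twisted:
  assumes "zmap R P C h" "qi P C h" "twisted R Q C t" "bounded_perfect R N Q"
  obtains t' b where "twisted R Q P t'" "\<And>k. b k \<in> lin_maps R (ob Q k) (ob C k)"
    and "\<And>k x. x \<in> carrier (ob Q k) \<Longrightarrow>
      h (k - 1) (t' k x) = t k x \<oplus>\<^bsub>ob C (k - 1)\<^esub> (dif C k (b k x) \<oplus>\<^bsub>ob C (k - 1)\<^esub>
        \<ominus>\<^bsub>ob C (k - 1)\<^esub> b (k - 1) (dif Q k x))"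
proof -
  interpret h: zmap R P C h by fact
  interpret t: twisted R Q C t by fact
  interpret K: zcx R "cone P C h" by (rule h.zcx_cone)
  let ?E = "sus (cone P C h)"
  interpret E: zcx R ?E by (rule zcx_sus[OF h.zcx_cone])
  have neg: "\<ominus>\<^bsub>dsum_module (ob P k) (ob C l)\<^esub> (x, y) = (\<ominus>\<^bsub>ob P k\<^esub> x, \<ominus>\<^bsub>ob C l\<^esub> y)"
    if "x \<in> carrier (ob P k)" "y \<in> carrier (ob C l)" for x y k l
    by (rule dsum_minus[OF h.C.mod h.D.mod that])
  have zm: "zmap R Q ?E (\<lambda>k x. (\<zero>\<^bsub>ob P (k - 2)\<^esub>, t k x))"
  proof (intro zmap.intro zmap_axioms.intro t.E.zcx_axioms E.zcx_axioms, goal_cases)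
    case (1 k) show ?case by (rule lin_mapsI) simp_all
  next
    case (2 x k)
    have "t (k - 1) (dif Q k x) = \<ominus>\<^bsub>ob C (k - 2)\<^esub> dif C (k - 1) (t k x)"
      using t.t_d[OF 2] 2
        h.D.M.M.minus_equality[of "k - 2" "t (k - 1) (dif Q k x)" "dif C (k - 1) (t k x)"] by simp
    with 2 show ?case by (simp add: neg)
  qed
  obtain s where s: "\<And>k. s k \<in> lin_maps R (ob Q k) (ob ?E (k + 1))"
    and us: "\<And>k x. x \<in> carrier (ob Q k) \<Longrightarrow>
       (\<zero>\<^bsub>ob P (k - 2)\<^esub>, t k x) = dif ?E (k + 1) (s k x) \<oplus>\<^bsub>ob ?E k\<^esub> s (k - 1) (dif Q k x)"
    using null_homotopy_bounded[OF zm assms(4)] h.qi_iff_cone assms(2) K.sus_acyclic by metis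
  define a where "a = (\<lambda>k x. fst (s k x))"
  define b where "b = (\<lambda>k x. snd (s k x))"
  have sab: "s k x = (a k x, b k x)" for k x by (simp add: a_def b_def)
  have s': "s k \<in> lin_maps R (ob Q k) (dsum_module (ob P (k - 1)) (ob C k))" for k
    using s[of k] by simp
  have al: "a k \<in> lin_maps R (ob Q k) (ob P (k - 1))" and bl: "b k \<in> lin_maps R (ob Q k) (ob C k)" for k
    unfolding a_def b_def by (rule lin_maps_comp[OF s' fst_lin] lin_maps_comp[OF s' snd_lin])+
  have acl [simp]: "a k x \<in> carrier (ob P l)" if "x \<in> carrier (ob Q k)" "l = k - 1" for k l x
    using lin_maps_closed[OF al that(1)] that by simp
  have bcl [simp]: "b k x \<in> carrier (ob C k)" if "x \<in> carrier (ob Q k)" for k x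
    using lin_maps_closed[OF bl that(1)] that by simp
  have eqs: "\<zero>\<^bsub>ob P (k - 2)\<^esub> = dif P (k - 1) (a k x) \<oplus>\<^bsub>ob P (k - 2)\<^esub> a (k - 1) (dif Q k x)"
    "t k x = \<ominus>\<^bsub>ob C (k - 1)\<^esub> (h (k - 1) (a k x) \<oplus>\<^bsub>ob C (k - 1)\<^esub> dif C k (b k x))
        \<oplus>\<^bsub>ob C (k - 1)\<^esub> b (k - 1) (dif Q k x)"
    if x: "x \<in> carrier (ob Q k)" for k x
    using us[OF x] x by (simp_all add: sab neg)
  let ?t = "\<lambda>k x. \<ominus>\<^bsub>ob P (k - 1)\<^esub> a k x"
  have "twisted R Q P ?t"
  proof (intro twisted.intro twisted_axioms.intro t.E.zcx_axioms h.C.zcx_axioms, goal_cases)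
    case (1 k) show ?case by (intro lin_maps_neg h.C.mod al)
  next
    case (2 x k)
    have "\<ominus>\<^bsub>ob P (k - 2)\<^esub> dif P (k - 1) (a k x) \<oplus>\<^bsub>ob P (k - 2)\<^esub> \<ominus>\<^bsub>ob P (k - 2)\<^esub> a (k - 1) (dif Q k x)
      = \<ominus>\<^bsub>ob P (k - 2)\<^esub> (dif P (k - 1) (a k x) \<oplus>\<^bsub>ob P (k - 2)\<^esub> a (k - 1) (dif Q k x))"
      using 2 by (simp add: h.C.M.M.minus_add)
    also have "\<dots> = \<zero>\<^bsub>ob P (k - 2)\<^esub>" by (simp flip: eqs(1)[OF 2])
    finally have "\<ominus>\<^bsub>ob P (k - 2)\<^esub> dif P (k - 1) (a k x) \<oplus>\<^bsub>ob P (k - 2)\<^esub>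
      \<ominus>\<^bsub>ob P (k - 2)\<^esub> a (k - 1) (dif Q k x) = \<zero>\<^bsub>ob P (k - 2)\<^esub>" .
    then show ?case using 2 by (simp add: h.C.M.M.a_comm)
  qed
  moreover have "h (k - 1) (?t k x) = t k x \<oplus>\<^bsub>ob C (k - 1)\<^esub> (dif C k (b k x) \<oplus>\<^bsub>ob C (k - 1)\<^esub>
        \<ominus>\<^bsub>ob C (k - 1)\<^esub> b (k - 1) (dif Q k x))" if x: "x \<in> carrier (ob Q k)" for k x
    using x by (simp add: eqs(2)[OF x] h.D.M.M.grp)
  ultimately show thesis using bl by (intro that[of ?t b]) auto
qed

section \<open>Transport of structure\<close>

text \<open>
  The types of elements of the complexes in the factorization, and of the complexes of projectives
  that witness perfection, are prescribed.  A complex of the right shape is moved into the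
  required type along injections of its terms.
\<close>

definition img_module :: "('m \<Rightarrow> 'n) \<Rightarrow> ('r, 'm) module \<Rightarrow> ('r, 'n) module" where
  "img_module e M = \<lparr>carrier = e ` carrier M, mult = undefined, one = undefined, zero = e \<zero>\<^bsub>M\<^esub>,
     add = (\<lambda>x y. e (inv_into (carrier M) e x \<oplus>\<^bsub>M\<^esub> inv_into (carrier M) e y)),
     smult = (\<lambda>a x. e (a \<odot>\<^bsub>M\<^esub> inv_into (carrier M) e x))\<rparr>"

definition img_cplx :: "(int \<Rightarrow> 'm \<Rightarrow> 'n) \<Rightarrow> ('r, 'm) cplx \<Rightarrow> ('r, 'n) cplx" where
  "img_cplx e C = \<lparr>ob = (\<lambda>k. img_module (e k) (ob C k)),
     dif = (\<lambda>k x. e (k - 1) (dif C k (inv_into (carrier (ob C k)) (e k) x)))\<rparr>"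

lemma img_module_sel:
  "carrier (img_module e M) = e ` carrier M" "\<zero>\<^bsub>img_module e M\<^esub> = e \<zero>\<^bsub>M\<^esub>"
  by (simp_all add: img_module_def)

lemma img_module_ops:
  assumes "inj_on e (carrier M)" "x \<in> carrier M"
  shows "y \<in> carrier M \<Longrightarrow> e x \<oplus>\<^bsub>img_module e M\<^esub> e y = e (x \<oplus>\<^bsub>M\<^esub> y)"
    and "a \<odot>\<^bsub>img_module e M\<^esub> e x = e (a \<odot>\<^bsub>M\<^esub> x)"
  using assms by (simp_all add: img_module_def)

lemma right_module_img:
  assumes "right_module R M" "inj_on e (carrier M)"
  shows "right_module R (img_module e M)"
proof -
  interpret M: right_module R M by fact
  note [simp] = img_module_sel img_module_ops[OF assms(2)]
  have "abelian_group (img_module e M)"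
  proof (rule abelian_groupI)
    fix x assume "x \<in> carrier (img_module e M)"
    then obtain x' where "x' \<in> carrier M" "x = e x'" by auto
    then show "\<exists>y\<in>carrier (img_module e M). y \<oplus>\<^bsub>img_module e M\<^esub> x = \<zero>\<^bsub>img_module e M\<^esub>"
      by (intro bexI[of _ "e (\<ominus>\<^bsub>M\<^esub> x')"]) (simp_all add: M.M.l_neg)
  qed (auto simp: M.M.a_ac)
  then show ?thesis
    by (intro right_moduleI') (auto simp: M.modsimps M.smult_assoc M.R.ring_axioms)
qed

lemma lin_maps_img:
  assumes "right_module R M" "inj_on e (carrier M)"
  shows "e \<in> lin_maps R M (img_module e M)"
  using img_module_ops[OF assms(2)] by (intro lin_mapsI) (simp_all add: img_module_sel)

lemma zmap_inv:
  assumes "zmap R C D f" "\<And>k. bij_betw (f k) (carrier (ob C k)) (carrier (ob D k))"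
  shows "zmap R D C (\<lambda>k. inv_into (carrier (ob C k)) (f k))"
proof -
  interpret f: zmap R C D f by fact
  let ?g = "\<lambda>k. inv_into (carrier (ob C k)) (f k)"
  show ?thesis
  proof (intro zmap.intro zmap_axioms.intro f.C.zcx_axioms f.D.zcx_axioms, goal_cases)
    case (1 k) show ?case by (rule lin_maps_inv[OF f.C.mod f.D.mod f.lin assms(2)])
  next
    case (2 y k)
    then obtain x where x: "x \<in> carrier (ob C k)" "y = f k x" using assms(2)[of k] by (auto simp: bij_betw_def)
    have inv: "?g l (f l z) = z" if "z \<in> carrier (ob C l)" for l z
      using that assms(2)[of l] by (auto simp: bij_betw_def)
    have "dif D k y = f (k - 1) (dif C k x)" using x by simp
    then show ?case using x by (simp add: inv del: f.f_d)
  qed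
qed

lemma transport_cplx:
  assumes "zcx R C" "\<And>k. inj_on (e k) (carrier (ob C k))"
  shows "zmap R C (img_cplx e C) e"
    and "bij_betw (e k) (carrier (ob C k)) (carrier (ob (img_cplx e C) k))"
proof -
  interpret C: zcx R C by fact
  have sel [simp]: "ob (img_cplx e C) k = img_module (e k) (ob C k)" for k
    by (simp add: img_cplx_def)
  have dif: "dif (img_cplx e C) k (e k x) = e (k - 1) (dif C k x)" if "x \<in> carrier (ob C k)" for k x
    using that assms(2) by (simp add: img_cplx_def)
  note ops [simp] = img_module_sel img_module_ops[OF assms(2)]
  have "zcx R (img_cplx e C)"
  proof (rule zcx.intro, goal_cases)
    case (1 k) show ?case by (simp add: right_module_img C.mod assms(2))
  next
    case (2 k)
    show ?case
    proof (rule lin_mapsI)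
      fix x assume "x \<in> carrier (ob (img_cplx e C) k)"
      then obtain x' where x: "x' \<in> carrier (ob C k)" "x = e k x'" by auto
      then show "dif (img_cplx e C) k x \<in> carrier (ob (img_cplx e C) (k - 1))" by (simp add: dif)
      {
        fix y assume "y \<in> carrier (ob (img_cplx e C) k)"
        then obtain y' where "y' \<in> carrier (ob C k)" "y = e k y'" by auto
        with x show "dif (img_cplx e C) k (x \<oplus>\<^bsub>ob (img_cplx e C) k\<^esub> y) =
          dif (img_cplx e C) k x \<oplus>\<^bsub>ob (img_cplx e C) (k - 1)\<^esub> dif (img_cplx e C) k y" by (simp add: dif)
      }
      fix a assume "a \<in> carrier R"
      with x show "dif (img_cplx e C) k (a \<odot>\<^bsub>ob (img_cplx e C) k\<^esub> x) =
          a \<odot>\<^bsub>ob (img_cplx e C) (k - 1)\<^esub> dif (img_cplx e C) k x" by (simp add: dif C.M.modsimps)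
    qed
  next
    case (3 x k)
    then obtain x' where x: "x' \<in> carrier (ob C k)" "x = e k x'" by auto
    have "dif (img_cplx e C) (k - 1) (e (k - 1) (dif C k x')) = e (k - 1 - 1) (dif C (k - 1) (dif C k x'))"
      using x by (intro dif) simp
    with x show ?case by (simp add: dif)
  qed
  then show "zmap R C (img_cplx e C) e"
    using lin_maps_img[OF C.mod assms(2)]
    by (intro zmap.intro zmap_axioms.intro C.zcx_axioms) (simp_all add: dif)
  show "bij_betw (e k) (carrier (ob C k)) (carrier (ob (img_cplx e C) k))"
    using assms(2) by (simp add: bij_betw_def)
qed

lemma trivial_module_iso:
  assumes "right_module R M" "right_module R N" "f \<in> lin_maps R M N" "bij_betw f (carrier M) (carrier N)"
  shows "trivial_module M \<longleftrightarrow> trivial_module N"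
proof -
  interpret M: right_module R M by fact
  interpret N: right_module R N by fact
  have f0: "f \<zero>\<^bsub>M\<^esub> = \<zero>\<^bsub>N\<^esub>" by (rule lin_maps_zero[OF assms(3)]) unfold_locales
  have im: "f ` carrier M = carrier N" and inj: "inj_on f (carrier M)"
    using assms(4) by (auto simp: bij_betw_def)
  show ?thesis unfolding trivial_module_def
  proof
    assume "carrier M = {\<zero>\<^bsub>M\<^esub>}" with im f0 show "carrier N = {\<zero>\<^bsub>N\<^esub>}" by auto
  next
    assume N: "carrier N = {\<zero>\<^bsub>N\<^esub>}"
    have "x = \<zero>\<^bsub>M\<^esub>" if "x \<in> carrier M" for x
      using that N im f0 by (intro inj_onD[OF inj]) auto
    then show "carrier M = {\<zero>\<^bsub>M\<^esub>}" using M.M.zero_closed by blast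
  qed
qed

section \<open>Perfect complexes\<close>

text \<open>
  A single quasi-isomorphism from a bounded complex of projectives instead of a zig-zag, together with a
  bound on the degrees.  Finitely generated projective modules embed into sequences in the ring, so
  one type of elements is enough.
\<close>

definition perf :: "('r, 'k) ring_scheme \<Rightarrow> int \<Rightarrow> ('r, 'm) cplx \<Rightarrow> bool" where
  "perf R N C \<longleftrightarrow> (\<exists>(P :: ('r, nat \<Rightarrow> 'r) cplx) h. bounded_perfect R N P \<and> zmap R P C h \<and> qi P C h)"

lemma qi_comp:
  assumes "zmap R C D f" "zmap R D E g" "qi C D f" "qi D E g"
  shows "qi C E (\<lambda>k x. g k (f k x))"
  unfolding qi_def hinj_def hsurj_def
proof (intro allI conjI ballI impI)
  interpret f: zmap R C D f by fact
  interpret g: zmap R D E g by fact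
  fix k
  {
    fix x assume "x \<in> cyc C k" "g k (f k x) \<in> boundaries E k"
    then show "x \<in> boundaries C k" using assms(3,4) f.f_cyc unfolding qi_def hinj_def by blast
  next
    fix z assume "z \<in> cyc E k"
    then obtain y w where y: "y \<in> cyc D k" and w: "w \<in> carrier (ob E (k + 1))"
      "z = dif E (k + 1) w \<oplus>\<^bsub>ob E k\<^esub> g k y" using assms(4) unfolding qi_def hsurj_def by blast
    from y obtain x v where x: "x \<in> cyc C k" and v: "v \<in> carrier (ob D (k + 1))"
      "y = dif D (k + 1) v \<oplus>\<^bsub>ob D k\<^esub> f k x" using assms(3) unfolding qi_def hsurj_def by blast
    have "z = dif E (k + 1) (w \<oplus>\<^bsub>ob E (k + 1)\<^esub> g (k + 1) v) \<oplus>\<^bsub>ob E k\<^esub> g k (f k x)"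
      using w v f.C.cycD(1)[OF x] by (simp add: g.D.M.M.a_assoc)
    moreover have "w \<oplus>\<^bsub>ob E (k + 1)\<^esub> g (k + 1) v \<in> carrier (ob E (k + 1))" using w v by simp
    ultimately show "\<exists>x\<in>cyc C k. \<exists>w\<in>carrier (ob E (k + 1)). z = dif E (k + 1) w \<oplus>\<^bsub>ob E k\<^esub> g k (f k x)"
      using x by blast
  }
qed

lemma (in zmap) qi_acyclic: "qi C D f \<Longrightarrow> acyclic_at C k \<longleftrightarrow> acyclic_at D k"
proof
  assume q: "qi C D f" and a: "acyclic_at C k"
  show "acyclic_at D k" unfolding acyclic_at_def
  proof
    fix y assume "y \<in> cyc D k"
    then obtain x z where xz: "x \<in> cyc C k" "z \<in> carrier (ob D (k + 1))" "y = dif D (k + 1) z \<oplus>\<^bsub>ob D k\<^esub> f k x"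
      using q unfolding qi_def hsurj_def by blast
    then have "f k x \<in> boundaries D k" "dif D (k + 1) z \<in> boundaries D k"
      using a f_boundaries by (auto simp: acyclic_at_def boundaries_iff)
    then show "y \<in> boundaries D k" using D.submodule_boundaries[of k] xz(3) by (simp add: submodule_def)
  qed
next
  assume "qi C D f" "acyclic_at D k"
  then show "acyclic_at C k" using f_cyc unfolding qi_def hinj_def acyclic_at_def by blast
qed

lemma perfI:
  assumes P: "bounded_perfect R N P" and "zmap R P C h" "qi P C h"
  shows "perf R N C"
proof -
  interpret h: zmap R P C h by fact
  \<comment> \<open>each term is a retract of some \<open>R\<^sup>n\<close>, hence has a copy whose elements are sequences in \<open>R\<close>\<close>
  have "\<exists>i. i \<in> lin_maps R (ob P k) (free_module R (UNIV :: nat set)) \<and> inj_on i (carrier (ob P k))" for k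
  proof -
    obtain n :: nat and i p where i: "i \<in> lin_maps R (ob P k) (free_module R {..<n})"
      and "\<forall>x\<in>carrier (ob P k). p (i x) = x"
      using P unfolding bounded_perfect_def finite_retract_def by blast
    then have "inj_on i (carrier (ob P k))" by (metis inj_on_inverseI)
    moreover have "i \<in> lin_maps R (ob P k) (free_module R UNIV)"
      using i lin_maps_closed[OF i] by (auto simp: lin_maps_def)
    ultimately show ?thesis by blast
  qed
  then obtain e :: "int \<Rightarrow> 'c \<Rightarrow> nat \<Rightarrow> 'a" where e: "\<And>k. inj_on (e k) (carrier (ob P k))" by metis
  let ?P = "img_cplx e P"
  note em = transport_cplx(1)[OF h.C.zcx_axioms e] and eb = transport_cplx(2)[OF h.C.zcx_axioms e]
  interpret e: zmap R P ?P e by (rule em)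
  have "bounded_perfect R N ?P"
    using P finite_retract_iso[OF h.C.mod e.D.mod e.lin eb] trivial_module_iso[OF h.C.mod e.D.mod e.lin eb]
    unfolding bounded_perfect_def by (simp add: e.D.zcx_axioms)
  moreover have im: "zmap R ?P P (\<lambda>k. inv_into (carrier (ob P k)) (e k))" by (rule zmap_inv[OF em eb])
  moreover have "qi ?P P (\<lambda>k. inv_into (carrier (ob P k)) (e k))"
    by (rule zmap.qi_if_bij[OF im]) (rule bij_betw_inv_into[OF eb])
  ultimately show ?thesis
    using zmap_comp[OF im assms(2)] qi_comp[OF im assms(2)] assms(3) unfolding perf_def by blast
qed

lemma perfE:
  fixes C :: "('r, 'm) cplx"
  assumes "perf R N C"
  obtains P :: "('r, nat \<Rightarrow> 'r) cplx" and h where "bounded_perfect R N P" "zmap R P C h" "qi P C h"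
  using assms unfolding perf_def by blast

lemma perf_qi: "perf R N C \<Longrightarrow> zmap R C D g \<Longrightarrow> qi C D g \<Longrightarrow> perf R N D"
  by (elim perfE, rule perfI[OF _ zmap_comp qi_comp])

text \<open>
  The complex of projectives maps to \<open>D\<close>; the lift of this map to \<open>C\<close> agrees with it on homology, hence is
  again a quasi-isomorphism.
\<close>

lemma perf_qi_rev:
  assumes "perf R N D" "zmap R C D g" "qi C D g"
  shows "perf R N C"
proof -
  obtain P :: "('a, nat \<Rightarrow> 'a) cplx" and h where P: "bounded_perfect R N P" and h: "zmap R P D h" "qi P D h"
    using assms(1) by (rule perfE)
  obtain a b where a: "zmap R P C a" and b: "\<And>k. b k \<in> lin_maps R (ob P k) (ob D (k + 1))"
    and eq: "\<And>k x. x \<in> carrier (ob P k) \<Longrightarrow>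
      h k x = g k (a k x) \<oplus>\<^bsub>ob D k\<^esub> (dif D (k + 1) (b k x) \<oplus>\<^bsub>ob D k\<^esub> b (k - 1) (dif P k x))"
    using lift_quasi_iso[OF assms(2,3) h(1) P] by blast
  interpret g: zmap R C D g by fact
  interpret h: zmap R P D h by fact
  interpret a: zmap R P C a by fact
  have b0: "b k \<zero>\<^bsub>ob P k\<^esub> = \<zero>\<^bsub>ob D (k + 1)\<^esub>" for k
    using lin_maps_zero[OF b h.C.M.M.abelian_group_axioms g.D.M.M.abelian_group_axioms] .
  have bcl: "b k x \<in> carrier (ob D (k + 1))" if "x \<in> carrier (ob P k)" for k x
    using lin_maps_closed[OF b that] .
  have eqc: "h k x = g k (a k x) \<oplus>\<^bsub>ob D k\<^esub> dif D (k + 1) (b k x)" if x: "x \<in> cyc P k" for k x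
    using eq[OF h.C.cycD(1)[OF x]] h.C.cycD[OF x] b0[of "k - 1"] bcl[of x k] by simp
  have "qi P C a" unfolding qi_def hinj_def hsurj_def
  proof (intro allI conjI ballI impI)
    fix k x assume x: "x \<in> cyc P k" and "a k x \<in> boundaries C k"
    then obtain c where c: "c \<in> carrier (ob C (k + 1))" "a k x = dif C (k + 1) c" by (auto simp: boundaries_iff)
    have "h k x = dif D (k + 1) (g (k + 1) c \<oplus>\<^bsub>ob D (k + 1)\<^esub> b k x)"
      using eqc[OF x] c bcl h.C.cycD(1)[OF x] by simp
    moreover have "g (k + 1) c \<oplus>\<^bsub>ob D (k + 1)\<^esub> b k x \<in> carrier (ob D (k + 1))"
      using c bcl h.C.cycD(1)[OF x] by simp
    ultimately have "h k x \<in> boundaries D k" unfolding boundaries_iff by blast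
    then show "x \<in> boundaries P k" using h(2) x unfolding qi_def hinj_def by blast
  next
    fix k c assume c: "c \<in> cyc C k"
    then obtain x z where x: "x \<in> cyc P k" and z: "z \<in> carrier (ob D (k + 1))"
      "g k c = dif D (k + 1) z \<oplus>\<^bsub>ob D k\<^esub> h k x"
      using h(2) g.f_cyc unfolding qi_def hsurj_def by blast
    note c' = g.C.cycD(1)[OF c] and x' = h.C.cycD(1)[OF x]
    have "g k (c \<oplus>\<^bsub>ob C k\<^esub> \<ominus>\<^bsub>ob C k\<^esub> a k x) = dif D (k + 1) (z \<oplus>\<^bsub>ob D (k + 1)\<^esub> b k x)"
      using c' x' z bcl[OF x'] eqc[OF x] by (simp add: g.D.M.M.grp)
    moreover have "z \<oplus>\<^bsub>ob D (k + 1)\<^esub> b k x \<in> carrier (ob D (k + 1))" using z bcl[OF x'] by simp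
    moreover have "c \<oplus>\<^bsub>ob C k\<^esub> \<ominus>\<^bsub>ob C k\<^esub> a k x \<in> cyc C k"
      using g.C.cycD[OF c] g.C.cycD[OF a.f_cyc[OF x]] by (simp add: cyc_def)
    ultimately have "c \<oplus>\<^bsub>ob C k\<^esub> \<ominus>\<^bsub>ob C k\<^esub> a k x \<in> boundaries C k"
      using assms(3) unfolding qi_def hinj_def boundaries_iff by blast
    then obtain w where w: "w \<in> carrier (ob C (k + 1))" "c \<oplus>\<^bsub>ob C k\<^esub> \<ominus>\<^bsub>ob C k\<^esub> a k x = dif C (k + 1) w"
      by (auto simp: boundaries_iff)
    have "c = dif C (k + 1) w \<oplus>\<^bsub>ob C k\<^esub> a k x" using c' x' by (simp add: g.C.M.M.grp flip: w(2))
    then show "\<exists>x\<in>cyc P k. \<exists>w\<in>carrier (ob C (k + 1)). c = dif C (k + 1) w \<oplus>\<^bsub>ob C k\<^esub> a k x"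
      using x w(1) by blast
  qed
  with P a show ?thesis by (rule perfI)
qed

lemma perf_mono: "perf R N C \<Longrightarrow> N \<le> N' \<Longrightarrow> perf R N' C"
  by (elim perfE, rule perfI) (auto simp: bounded_perfect_def)

lemma perf_acyclic:
  assumes "perf R N C" "N < k \<or> k < 0"
  shows "acyclic_at C k"
proof -
  obtain P :: "('a, nat \<Rightarrow> 'a) cplx" and h where P: "bounded_perfect R N P" and "zmap R P C h" "qi P C h"
    using assms(1) by (rule perfE)
  interpret h: zmap R P C h by fact
  show ?thesis using h.qi_acyclic[OF \<open>qi P C h\<close>] h.C.trivial_acyclic[of k] P assms(2)
    by (auto simp: bounded_perfect_def)
qed

lemma perf_sus:
  assumes "perf R N C" "zcx R C"
  shows "perf R (N + 1) (sus C)"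
proof -
  obtain P :: "('a, nat \<Rightarrow> 'a) cplx" and h where P: "bounded_perfect R N P" and "zmap R P C h" "qi P C h"
    using assms(1) by (rule perfE)
  interpret h: zmap R P C h by fact
  have "bounded_perfect R (N + 1) (sus P)"
    using P zcx_sus by (auto simp: bounded_perfect_def)
  moreover have "zmap R (sus P) (sus C) (\<lambda>k. h (k - 1))"
  proof (intro zmap.intro zmap_axioms.intro zcx_sus h.C.zcx_axioms h.D.zcx_axioms, goal_cases)
    case (1 k) show ?case using h.lin[of "k - 1"] by simp
  next
    case (2 x k) then show ?case by simp
  qed
  moreover have "qi (sus P) (sus C) (\<lambda>k. h (k - 1))"
  proof -
    have "hinj (sus P) (sus C) (\<lambda>k. h (k - 1)) k" for k
      using \<open>qi P C h\<close> by (simp add: qi_def hinj_def h.C.sus_cyc h.D.sus_cyc h.C.sus_boundaries h.D.sus_boundaries)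
    moreover have "hsurj (sus P) (sus C) (\<lambda>k. h (k - 1)) k" for k
      unfolding hsurj_def h.C.sus_cyc h.D.sus_cyc
    proof
      fix y assume y: "y \<in> cyc C (k - 1)"
      have "\<forall>y\<in>cyc C (k - 1). \<exists>x\<in>cyc P (k - 1). \<exists>z\<in>carrier (ob C k). y = dif C k z \<oplus>\<^bsub>ob C (k - 1)\<^esub> h (k - 1) x"
        using \<open>qi P C h\<close> unfolding qi_def hsurj_def by (metis diff_add_cancel)
      with y obtain x z where xz: "x \<in> cyc P (k - 1)" "z \<in> carrier (ob C k)"
        "y = dif C k z \<oplus>\<^bsub>ob C (k - 1)\<^esub> h (k - 1) x" by blast
      then show "\<exists>x\<in>cyc P (k - 1). \<exists>z\<in>carrier (ob (sus C) (k + 1)).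
          y = dif (sus C) (k + 1) z \<oplus>\<^bsub>ob (sus C) k\<^esub> h (k - 1) x"
        by (intro bexI[of _ x] bexI[of _ "\<ominus>\<^bsub>ob C k\<^esub> z"]) simp_all
    qed
    ultimately show ?thesis by (simp add: qi_def)
  qed
  ultimately show ?thesis by (rule perfI)
qed

lemma trivial_dsum: "trivial_module M \<Longrightarrow> trivial_module N \<Longrightarrow> trivial_module (dsum_module M N)"
  by (simp add: trivial_module_def)

text \<open>
  With complexes of projectives \<open>P\<close> and \<open>Q\<close> for the outer terms, \<open>Q\<close> lifts degreewise to \<open>D\<close>.  The lift fails
  to commute with differentials by a map into \<open>C\<close>, which is moved to \<open>P\<close> and becomes the attaching map
  of an extension of \<open>Q\<close> by \<open>P\<close>.  This extension maps to \<open>D\<close> by a quasi-isomorphism, as the cone of the map is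
  an extension of two acyclic cones.
\<close>

lemma perf_ses:
  assumes "ses R C D E i p" "perf R N C" "perf R N E"
  shows "perf R N D"
proof -
  interpret ses R C D E i p by fact
  obtain P :: "('a, nat \<Rightarrow> 'a) cplx" and h where P: "bounded_perfect R N P" and zh: "zmap R P C h" and qh: "qi P C h"
    using assms(2) by (rule perfE)
  obtain Q :: "('a, nat \<Rightarrow> 'a) cplx" and g where Q: "bounded_perfect R N Q" and zg: "zmap R Q E g" and qg: "qi Q E g"
    using assms(3) by (rule perfE)
  interpret h: zmap R P C h by fact
  interpret g: zmap R Q E g by fact
  have "\<exists>g'. g' \<in> lin_maps R (ob Q k) (ob D k) \<and> (\<forall>x\<in>carrier (ob Q k). p k (g' x) = g k x)" for k
  proof -
    have "finite_retract R (ob Q k)" using Q by (simp add: bounded_perfect_def)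
    from finite_retract_lift[OF this g.C.mod p.D.mod i.D.mod g.lin p.lin]
    show ?thesis using surj by (metis g.f_closed)
  qed
  then obtain G where Gl: "\<And>k. G k \<in> lin_maps R (ob Q k) (ob D k)"
    and pG [simp]: "\<And>k x. x \<in> carrier (ob Q k) \<Longrightarrow> p k (G k x) = g k x" by metis
  have Gcl [simp]: "G k x \<in> carrier (ob D k)" if "x \<in> carrier (ob Q k)" for k x
    using lin_maps_closed[OF Gl that] .
  have G0 [simp]: "G k \<zero>\<^bsub>ob Q k\<^esub> = \<zero>\<^bsub>ob D k\<^esub>" for k
    using lin_maps_zero[OF Gl g.C.M.M.abelian_group_axioms i.D.M.M.abelian_group_axioms] .
  \<comment> \<open>the failure of the lifts to form a chain map factors through \<open>C\<close> and becomes the attaching map\<close>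
  let ?v = "\<lambda>k x. dif D k (G k x) \<oplus>\<^bsub>ob D (k - 1)\<^esub> \<ominus>\<^bsub>ob D (k - 1)\<^esub> G (k - 1) (dif Q k x)"
  have v: "?v k \<in> lin_maps R (ob Q k) (ob D (k - 1))" for k
    by (intro lin_maps_plus lin_maps_neg i.D.mod lin_maps_comp[OF Gl i.D.d_lin] lin_maps_comp[OF g.C.d_lin Gl])
  have "\<exists>c\<in>carrier (ob C (k - 1)). i (k - 1) c = ?v k x" if x: "x \<in> carrier (ob Q k)" for k x
    using ker[of "?v k x" "k - 1"] x by (auto simp: p.D.M.M.r_neg)
  moreover have "finite_retract R (ob Q k)" for k using Q by (simp add: bounded_perfect_def)
  ultimately have "\<exists>t. t \<in> lin_maps R (ob Q k) (ob C (k - 1)) \<and> (\<forall>x\<in>carrier (ob Q k). i (k - 1) (t x) = ?v k x)" for k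
    using finite_retract_lift[OF _ g.C.mod i.D.mod i.C.mod v i.lin, of k] by metis
  then obtain t where tl: "\<And>k. t k \<in> lin_maps R (ob Q k) (ob C (k - 1))"
    and it: "\<And>k x. x \<in> carrier (ob Q k) \<Longrightarrow> i (k - 1) (t k x) = ?v k x" by metis
  have tcl [simp]: "t k x \<in> carrier (ob C l)" if "x \<in> carrier (ob Q k)" "l = k - 1" for k l x
    using lin_maps_closed[OF tl that(1)] that by simp
  have "twisted R Q C t"
  proof (intro twisted.intro twisted_axioms.intro g.C.zcx_axioms i.C.zcx_axioms tl)
    fix k x assume x: "x \<in> carrier (ob Q k)"
    let ?w = "t (k - 1) (dif Q k x) \<oplus>\<^bsub>ob C (k - 2)\<^esub> dif C (k - 1) (t k x)"
    have 1: "i (k - 2) (t (k - 1) (dif Q k x)) = dif D (k - 1) (G (k - 1) (dif Q k x))"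
      using it[of "dif Q k x" "k - 1"] x by simp
    have 2: "i (k - 2) (dif C (k - 1) (t k x)) = \<ominus>\<^bsub>ob D (k - 2)\<^esub> dif D (k - 1) (G (k - 1) (dif Q k x))"
      using it[OF x] x by simp
    have "i (k - 2) ?w = i (k - 2) (t (k - 1) (dif Q k x)) \<oplus>\<^bsub>ob D (k - 2)\<^esub> i (k - 2) (dif C (k - 1) (t k x))"
      using x by (intro i.f_add) simp_all
    also have "\<dots> = \<zero>\<^bsub>ob D (k - 2)\<^esub>" unfolding 1 2 using x by (simp add: i.D.M.M.r_neg)
    finally show "?w = \<zero>\<^bsub>ob C (k - 2)\<^esub>" using x by (intro i_eq_zero) simp_all
  qed
  then obtain t' b where t': "twisted R Q P t'" and bl: "\<And>k. b k \<in> lin_maps R (ob Q k) (ob C k)"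
    and ht: "\<And>k x. x \<in> carrier (ob Q k) \<Longrightarrow>
      h (k - 1) (t' k x) = t k x \<oplus>\<^bsub>ob C (k - 1)\<^esub> (dif C k (b k x) \<oplus>\<^bsub>ob C (k - 1)\<^esub>
        \<ominus>\<^bsub>ob C (k - 1)\<^esub> b (k - 1) (dif Q k x))"
    using lift_twisted[OF zh qh _ Q] by blast
  interpret t': twisted R Q P t' by fact
  have bcl [simp]: "b k x \<in> carrier (ob C k)" if "x \<in> carrier (ob Q k)" for k x
    using lin_maps_closed[OF bl that] .
  let ?T = "tw Q P t'"
  define H where "H k x = G k x \<oplus>\<^bsub>ob D k\<^esub> i k (b k x)" for k x
  define F where "F k = (\<lambda>(x, y). H k x \<oplus>\<^bsub>ob D k\<^esub> i k (h k y))" for k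
  have Hl: "H k \<in> lin_maps R (ob Q k) (ob D k)" for k
    unfolding H_def by (intro lin_maps_plus i.D.mod Gl lin_maps_comp[OF bl i.lin])
  have Hcl [simp]: "H k x \<in> carrier (ob D k)" if "x \<in> carrier (ob Q k)" for k x
    using lin_maps_closed[OF Hl that] .
  have dH: "dif D k (H k x) = H (k - 1) (dif Q k x) \<oplus>\<^bsub>ob D (k - 1)\<^esub> i (k - 1) (h (k - 1) (t' k x))"
    if x: "x \<in> carrier (ob Q k)" for k x
    unfolding ht[OF x] H_def using x it[OF x] by (simp add: i.D.M.M.grp)
  have zF: "zmap R ?T D F"
  proof (intro zmap.intro zmap_axioms.intro t'.zcx_tw i.D.zcx_axioms)
    fix k
    have "(\<lambda>z. H k (fst z) \<oplus>\<^bsub>ob D k\<^esub> i k (h k (snd z))) \<in> lin_maps R (ob ?T k) (ob D k)"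
      unfolding tw_sel
      by (intro lin_maps_plus i.D.mod lin_maps_comp[OF fst_lin Hl]
          lin_maps_comp[OF snd_lin lin_maps_comp[OF h.lin i.lin]])
    then show "F k \<in> lin_maps R (ob ?T k) (ob D k)" by (simp add: F_def case_prod_beta')
  next
    fix k z assume "z \<in> carrier (ob ?T k)"
    then obtain x y where z: "z = (x, y)" "x \<in> carrier (ob Q k)" "y \<in> carrier (ob P k)" by auto
    then show "F (k - 1) (dif ?T k z) = dif D k (F k z)"
      by (simp add: F_def dH i.D.M.M.a_assoc)
  qed
  interpret F: zmap R ?T D F by (rule zF)
  have H0 [simp]: "H k \<zero>\<^bsub>ob Q k\<^esub> = \<zero>\<^bsub>ob D k\<^esub>" for k
    using lin_maps_zero[OF Hl g.C.M.M.abelian_group_axioms i.D.M.M.abelian_group_axioms] .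
  have pH: "p k (H k x) = g k x" if "x \<in> carrier (ob Q k)" for k x using that by (simp add: H_def)
  have neg: "\<ominus>\<^bsub>dsum_module (ob Q k) (ob P k)\<^esub> (x, y) = (\<ominus>\<^bsub>ob Q k\<^esub> x, \<ominus>\<^bsub>ob P k\<^esub> y)"
    if "x \<in> carrier (ob Q k)" "y \<in> carrier (ob P k)" for x y k
    by (rule dsum_minus[OF g.C.mod h.C.mod that])
  have S: "ses R (cone P C h) (cone ?T D F) (cone Q E g)
    (\<lambda>k (y, c). ((\<zero>\<^bsub>ob Q (k - 1)\<^esub>, y), i k c)) (\<lambda>k ((x, y), d). (x, p k d))"
  proof (rule ses.intro[OF zmap.intro[OF h.zcx_cone F.zcx_cone zmap_axioms.intro]
          zmap.intro[OF F.zcx_cone g.zcx_cone zmap_axioms.intro] ses_axioms.intro], goal_cases)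
    case (1 k) show ?case by (rule lin_mapsI) auto
  next
    case (2 z k)
    then obtain y c where "z = (y, c)" "y \<in> carrier (ob P (k - 1))" "c \<in> carrier (ob C k)" by auto
    then show ?case by (simp add: F_def neg)
  next
    case (3 k) show ?case by (rule lin_mapsI) auto
  next
    case (4 z k)
    then obtain x y d where "z = ((x, y), d)" "x \<in> carrier (ob Q (k - 1))" "y \<in> carrier (ob P (k - 1))"
      "d \<in> carrier (ob D k)" by auto
    then show ?case by (simp add: F_def neg pH)
  next
    case (5 k) show ?case using inj[of k] by (auto simp: inj_on_def)
  next
    case (6 e k)
    then obtain x y where "e = (x, y)" "x \<in> carrier (ob Q (k - 1))" "y \<in> carrier (ob E k)" by auto
    moreover then obtain d where "d \<in> carrier (ob D k)" "p k d = y" using surj by blast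
    ultimately show ?case by (intro bexI[of _ "((x, \<zero>\<^bsub>ob P (k - 1)\<^esub>), d)"]) auto
  next
    case (7 c k) then show ?case by auto
  next
    case (8 y k)
    then obtain x' y' d where y: "y = ((x', y'), d)" "y' \<in> carrier (ob P (k - 1))" "d \<in> carrier (ob D k)"
      "x' = \<zero>\<^bsub>ob Q (k - 1)\<^esub>" "p k d = \<zero>\<^bsub>ob E k\<^esub>" by auto
    moreover then obtain c where "c \<in> carrier (ob C k)" "d = i k c" using ker by blast
    ultimately show ?case by (intro bexI[of _ "(y', c)"]) auto
  qed
  have "qi ?T D F"
    unfolding F.qi_iff_cone
    using ses.acyclic[OF S] qh qg h.qi_iff_cone g.qi_iff_cone by blast
  moreover have "bounded_perfect R N ?T"
    using P Q unfolding bounded_perfect_def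
    by (simp add: t'.zcx_tw finite_retract_dsum[OF i.C.M.R.ring_axioms] trivial_dsum)
  ultimately show ?thesis using zF by (blast intro: perfI)
qed

lemma perf_cone:
  assumes "zmap R C D f" "perf R N C" "perf R (N + 1) D"
  shows "perf R (N + 1) (cone C D f)"
  using perf_ses[OF zmap.ses_cone[OF assms(1)] assms(3) perf_sus[OF assms(2)]] assms(1)
  by (simp add: zmap_def)


text \<open>
  Below the lowest homology a perfect complex is contractible, and the contraction makes the cycles
  in the lowest degree a retract of the complex.
\<close>

lemma perf_low:
  assumes "perf R N C" and acyc: "\<And>k. k < q \<Longrightarrow> acyclic_at C k"
  shows "\<exists>(n :: nat) r. r \<in> lin_maps R (free_module R {..<n}) (homology C q) \<and>
      r ` carrier (free_module R {..<n}) = carrier (homology C q)" (is ?fg)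
    and "N \<le> q \<Longrightarrow> finite_retract R (homology C q)" (is "_ \<Longrightarrow> ?proj")
proof -
  obtain P :: "('a, nat \<Rightarrow> 'a) cplx" and h where P: "bounded_perfect R N P"
    and zh: "zmap R P C h" and qh: "qi P C h"
    using assms(1) by (rule perfE)
  interpret h: zmap R P C h by fact
  let ?Z = "cycles_module P q"
  have id: "zmap R P P (\<lambda>k x. x)"
    by (intro zmap.intro zmap_axioms.intro h.C.zcx_axioms lin_maps_id) simp
  have "acyclic_at P k" if "k < q" for k using acyc[OF that] h.qi_acyclic[OF qh] by blast
  then obtain s where s: "\<And>k. s k \<in> lin_maps R (ob P k) (ob P (k + 1))"
    and ds: "\<And>k x. k < q \<Longrightarrow> x \<in> carrier (ob P k) \<Longrightarrow>
      x = dif P (k + 1) (s k x) \<oplus>\<^bsub>ob P k\<^esub> s (k - 1) (dif P k x)"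
    using null_homotopy[OF id, of q] P unfolding bounded_perfect_def by blast
  have s0: "s k \<zero>\<^bsub>ob P k\<^esub> = \<zero>\<^bsub>ob P (k + 1)\<^esub>" for k
    using lin_maps_zero[OF s h.C.M.M.abelian_group_axioms h.C.M.M.abelian_group_axioms] .
  have scl: "s k x \<in> carrier (ob P l)" if "x \<in> carrier (ob P k)" "l = k + 1" for k l x
    using lin_maps_closed[OF s that(1)] that(2) by simp
  let ?r = "\<lambda>x. x \<oplus>\<^bsub>ob P q\<^esub> \<ominus>\<^bsub>ob P q\<^esub> s (q - 1) (dif P q x)"
  have sl: "s (q - 1) \<in> lin_maps R (ob P (q - 1)) (ob P q)" using s[of "q - 1"] by simp
  have rl: "?r \<in> lin_maps R (ob P q) (ob P q)"
    by (intro lin_maps_plus lin_maps_neg h.C.mod lin_maps_id lin_maps_comp[OF h.C.d_lin sl])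
  have "?r x \<in> cyc P q" if x: "x \<in> carrier (ob P q)" for x
  proof -
    have "dif P q x = dif P q (s (q - 1) (dif P q x)) \<oplus>\<^bsub>ob P (q - 1)\<^esub> s (q - 2) (dif P (q - 1) (dif P q x))"
      using ds[of "q - 1" "dif P q x"] x by simp
    moreover have "s (q - 2) (dif P (q - 1) (dif P q x)) = \<zero>\<^bsub>ob P (q - 1)\<^esub>"
      using s0[of "q - 2"] x by simp
    ultimately have "dif P q x = dif P q (s (q - 1) (dif P q x))"
      using x scl[of "dif P q x" "q - 1" q] by simp
    moreover have "dif P q (?r x) = dif P q x \<oplus>\<^bsub>ob P (q - 1)\<^esub> \<ominus>\<^bsub>ob P (q - 1)\<^esub> dif P q (s (q - 1) (dif P q x))"
      using x scl[of "dif P q x" "q - 1" q] by simp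
    ultimately have "dif P q (?r x) = \<zero>\<^bsub>ob P (q - 1)\<^esub>" using x by (simp add: h.C.M.M.r_neg)
    then show ?thesis using lin_maps_closed[OF rl x] by (simp add: cyc_def)
  qed
  then have rZ: "?r \<in> lin_maps R (ob P q) ?Z"
    using rl by (auto simp: lin_maps_def cycles_module_eq)
  have iZ: "(\<lambda>x. x) \<in> lin_maps R ?Z (ob P q)"
    by (rule lin_mapsI) (simp_all add: cycles_module_eq cyc_def)
  have rz: "?r x = x" if "x \<in> carrier ?Z" for x
    using that s0[of "q - 1"] by (simp add: cycles_module_eq cyc_def)
  have frZ: "finite_retract R ?Z"
    by (rule finite_retract_retract[OF _ iZ rZ]) (use P rz in \<open>simp_all add: bounded_perfect_def\<close>)
  have hb: "bij_betw (homology_map C h q) (carrier (homology P q)) (carrier (homology C q))"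
    using qh by (simp add: h.homology_map_bij_iff qi_def)
  have cls_surj: "cls P q ` carrier ?Z = carrier (homology P q)"
    by (auto simp: h.C.homology_carrier cycles_module_eq)
  show ?fg
  proof -
    obtain n :: nat and i p where p: "p \<in> lin_maps R (free_module R {..<n}) ?Z"
      and i: "i \<in> lin_maps R ?Z (free_module R {..<n})" and pi: "\<And>x. x \<in> carrier ?Z \<Longrightarrow> p (i x) = x"
      using frZ unfolding finite_retract_def by blast
    have "p ` carrier (free_module R {..<n}) = carrier ?Z"
    proof (intro equalityI subsetI)
      fix x assume "x \<in> p ` carrier (free_module R {..<n})"
      then show "x \<in> carrier ?Z" using lin_maps_closed[OF p] by blast
    next
      fix x assume x: "x \<in> carrier ?Z"
      show "x \<in> p ` carrier (free_module R {..<n})"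
        by (rule image_eqI[of _ _ "i x"]) (simp_all only: pi[OF x] lin_maps_closed[OF i x])
    qed
    then have "homology_map C h q ` (cls P q ` (p ` carrier (free_module R {..<n}))) = carrier (homology C q)"
      using hb cls_surj by (simp only: bij_betw_def)
    then have "(\<lambda>x. homology_map C h q (cls P q (p x))) ` carrier (free_module R {..<n}) = carrier (homology C q)"
      by (simp only: image_image)
    then show ?thesis
      using lin_maps_comp[OF lin_maps_comp[OF p h.C.cls_lin] h.homology_map_lin] by blast
  qed
  show ?proj if "N \<le> q"
  proof -
    have "trivial_module (ob P (q + 1))" using P that by (simp add: bounded_perfect_def)
    then have d0: "dif P (q + 1) z = \<zero>\<^bsub>ob P q\<^esub>" if "z \<in> carrier (ob P (q + 1))" for z
      using that h.C.d_zero[of "q + 1"] by (simp add: trivial_module_def)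
    have "inj_on (cls P q) (carrier ?Z)"
      by (rule inj_onI) (use d0 in \<open>auto simp: cycles_module_eq h.C.cls_eq_iff h.C.cycD\<close>)
    then have "bij_betw (cls P q) (carrier ?Z) (carrier (homology P q))"
      using cls_surj by (simp add: bij_betw_def)
    then have "finite_retract R (homology P q)"
      using finite_retract_iso[OF h.C.right_module_cycles h.C.right_module_homology h.C.cls_lin] frZ by blast
    then show ?thesis
      using finite_retract_iso[OF h.C.right_module_homology h.D.right_module_homology h.homology_map_lin hb] by blast
  qed
qed

text \<open>
  Conversely, a complex whose only homology is finitely generated projective is perfect: a linear
  choice of representing cycles is a quasi-isomorphism from the homology.
\<close>

lemma perf_concentrated:
  assumes "zcx R E" and fr: "finite_retract R (homology E q)"
    and acyc: "\<And>k. k \<noteq> q \<Longrightarrow> acyclic_at E k" and neg: "q < 0 \<Longrightarrow> acyclic_at E q"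
  shows "perf R q E"
proof -
  interpret E: zcx R E by fact
  let ?H = "homology E q"
  interpret H: right_module R ?H by (rule E.right_module_homology)
  have "\<exists>y\<in>carrier (cycles_module E q). cls E q y = K" if "K \<in> carrier ?H" for K
    using that by (auto simp: E.homology_carrier cycles_module_eq)
  then obtain s where s: "s \<in> lin_maps R ?H (cycles_module E q)"
    and cs: "\<And>K. K \<in> carrier ?H \<Longrightarrow> cls E q (s K) = K"
    using finite_retract_lift[OF fr H.right_module_axioms H.right_module_axioms E.right_module_cycles
        lin_maps_id E.cls_lin] by blast
  have scyc: "s K \<in> cyc E q" if "K \<in> carrier ?H" for K
    using lin_maps_closed[OF s that] by (simp add: cycles_module_eq)
  have sl: "s \<in> lin_maps R ?H (ob E q)"
    using s scyc E.cycD by (auto simp: lin_maps_def cycles_module_eq)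
  define P where "P = \<lparr>ob = (\<lambda>k. ?H\<lparr>carrier := if k = q then carrier ?H else {\<zero>\<^bsub>?H\<^esub>}\<rparr>),
    dif = (\<lambda>k x. \<zero>\<^bsub>?H\<^esub>)\<rparr>"
  define h where "h k = (if k = q then s else (\<lambda>x. \<zero>\<^bsub>ob E k\<^esub>))" for k
  have sub: "submodule R ?H (if k = q then carrier ?H else {\<zero>\<^bsub>?H\<^esub>})" for k
    by (simp add: submodule_def H.modsimps)
  have Psel [simp]: "carrier (ob P k) = (if k = q then carrier ?H else {\<zero>\<^bsub>?H\<^esub>})"
    "zero (ob P k) = zero ?H" "add (ob P k) = add ?H" "smult (ob P k) = smult ?H" "dif P k x = \<zero>\<^bsub>?H\<^esub>" for k x
    by (simp_all add: P_def)
  have Pq: "ob P q = ?H" by (simp add: P_def)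
  have Pm: "right_module R (ob P k)" for k
    using right_module_submodule[OF H.right_module_axioms sub] by (simp add: P_def)
  have zP: "zcx R P"
  proof (rule zcx.intro[OF Pm], goal_cases)
    case (1 k) show ?case by (rule lin_mapsI) (simp_all add: H.modsimps)
  qed simp
  have triv: "trivial_module (ob P k)" if "k \<noteq> q" for k using that by (simp add: trivial_module_def)
  have trivq: "trivial_module (ob P q)" if "q < 0"
    using neg[OF that] E.trivial_homology_iff by (simp add: Pq)
  have bP: "bounded_perfect R q P"
    unfolding bounded_perfect_def
  proof (intro conjI allI impI zP)
    fix k show "finite_retract R (ob P k)"
      by (cases "k = q") (simp_all add: Pq fr trivial_finite_retract Pm triv)
    show "trivial_module (ob P k)" if "k < 0 \<or> q < k"
      using that triv[of k] trivq by (cases "k = q") auto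
  qed
  have s0: "s \<zero>\<^bsub>?H\<^esub> = \<zero>\<^bsub>ob E q\<^esub>"
    by (rule lin_maps_zero[OF sl H.abelian_group_axioms E.M.M.abelian_group_axioms])
  have zh: "zmap R P E h"
  proof (intro zmap.intro zmap_axioms.intro zP E.zcx_axioms)
    fix k show "h k \<in> lin_maps R (ob P k) (ob E k)"
      using sl by (cases "k = q") (auto simp: h_def Pq intro: lin_maps_zero_map E.mod)
  next
    fix k x assume "x \<in> carrier (ob P k)"
    then show "h (k - 1) (dif P k x) = dif E k (h k x)"
      using scyc[THEN E.cycD(2)] by (auto simp: h_def s0)
  qed
  moreover have "qi P E h" unfolding qi_def hinj_def hsurj_def
  proof (intro allI conjI ballI impI)
    fix k x assume x: "x \<in> cyc P k" "h k x \<in> boundaries E k"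
    have "x = \<zero>\<^bsub>?H\<^esub>"
    proof (cases "k = q")
      case True
      then have "x \<in> carrier ?H" using x by (simp add: cyc_def)
      then show ?thesis using cs scyc E.cls_zero_iff[of "s x" q] x(2) True by (simp add: h_def)
    qed (use x in \<open>simp add: cyc_def\<close>)
    then show "x \<in> boundaries P k"
      unfolding boundaries_iff by (intro bexI[of _ "\<zero>\<^bsub>?H\<^esub>"]) simp_all
  next
    fix k y assume y: "y \<in> cyc E k"
    show "\<exists>x\<in>cyc P k. \<exists>z\<in>carrier (ob E (k + 1)). y = dif E (k + 1) z \<oplus>\<^bsub>ob E k\<^esub> h k x"
    proof (cases "k = q")
      case True
      let ?x = "cls E q y"
      have x: "?x \<in> carrier ?H" using y True by simp
      then have "cls E q y = cls E q (s ?x)" by (simp add: cs)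
      then obtain z where "z \<in> carrier (ob E (q + 1))" "y = dif E (q + 1) z \<oplus>\<^bsub>ob E q\<^esub> s ?x"
        using E.cls_eq_iff[of y q "s ?x"] y True scyc[OF x] by auto
      with x True show ?thesis by (intro bexI[of _ ?x]) (auto simp: h_def cyc_def)
    next
      case False
      then obtain z where "z \<in> carrier (ob E (k + 1))" "y = dif E (k + 1) z"
        using acyc[OF False] y unfolding acyclic_at_def boundaries_def by blast
      with False show ?thesis
        by (intro bexI[of _ "\<zero>\<^bsub>?H\<^esub>"] bexI[of _ z]) (auto simp: h_def cyc_def)
    qed
  qed
  ultimately show ?thesis using bP by (blast intro: perfI)
qed

lemma strictly_perfect_iff: "strictly_perfect R P \<longleftrightarrow> (\<exists>N. bounded_perfect R N P)"
proof
  assume "strictly_perfect R P"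
  then obtain N where "zcx R P" "\<forall>k<0. trivial_module (ob P k)" "\<forall>k>N. trivial_module (ob P k)"
    "\<forall>k. fg_projective R (ob P k)" by (auto simp: strictly_perfect_def chain_complex_iff)
  moreover then have "\<forall>k. finite_retract R (ob P k)"
    using fg_projective_iff zcx.mod by blast
  ultimately show "\<exists>N. bounded_perfect R N P" by (auto simp: bounded_perfect_def)
next
  assume "\<exists>N. bounded_perfect R N P"
  then obtain N where "zcx R P" "\<forall>k. k < 0 \<or> k > N \<longrightarrow> trivial_module (ob P k)"
    "\<forall>k. finite_retract R (ob P k)" by (auto simp: bounded_perfect_def)
  moreover then have "\<forall>k. fg_projective R (ob P k)"
    using fg_projective_iff zcx.mod by blast
  ultimately show "strictly_perfect R P" by (auto simp: strictly_perfect_def chain_complex_iff)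
qed

lemma perf_linked: "quasi_iso_linked R C D \<Longrightarrow> perf R N D \<Longrightarrow> perf R N C"
  unfolding quasi_iso_linked_def quasi_iso_iff by (auto intro: perf_qi perf_qi_rev)

lemma perf_zigzag: "(quasi_iso_linked R)\<^sup>*\<^sup>* D P \<Longrightarrow> perf R N P \<Longrightarrow> perf R N D"
  by (induction rule: converse_rtranclp_induct) (auto intro: perf_linked)

lemma perfect_over_imp_perf:
  fixes C :: "(nat \<Rightarrow> 'a, 'm) cplx"
  assumes "perfect_over TYPE('u) A C"
  shows "\<exists>N. perf A N (restrict_cplx A C)"
proof -
  obtain D P :: "('a, 'u) cplx" where DP: "quasi_iso_linked A (restrict_cplx A C) D"
    "(quasi_iso_linked A)\<^sup>*\<^sup>* D P" "strictly_perfect A P"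
    using assms unfolding perfect_over_def by blast
  then obtain N where N: "bounded_perfect A N P" by (auto simp: strictly_perfect_iff)
  then have zP: "zcx A P" by (simp add: bounded_perfect_def)
  then interpret P: zcx A P .
  have id: "zmap A P P (\<lambda>k x. x)"
    by (intro zmap.intro zmap_axioms.intro zP lin_maps_id) simp
  have "perf A N P" by (rule perfI[OF N id zmap.qi_if_bij[OF id]]) (simp add: bij_betw_def)
  then show ?thesis using DP perf_zigzag perf_linked by blast
qed

lemma perf_imp_perfect_over:
  fixes C :: "(nat \<Rightarrow> 'a, 'm) cplx"
  assumes "perf A N (restrict_cplx A C)" "chain_complex (UP A) C"
    and neg: "\<forall>k<0. trivial_module (ob (restrict_cplx A C) k)"
  shows "perfect_over TYPE(nat \<Rightarrow> 'a) A C"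
proof -
  obtain P :: "('a, nat \<Rightarrow> 'a) cplx" and h where P: "bounded_perfect A N P"
    and h: "zmap A P (restrict_cplx A C) h" "qi P (restrict_cplx A C) h"
    using assms(1) by (rule perfE)
  have "strictly_perfect A P" using P strictly_perfect_iff by blast
  moreover have "quasi_iso A P (restrict_cplx A C) h"
    using P h neg by (auto simp: quasi_iso_iff chain_complex_iff bounded_perfect_def zmap_def)
  then have "quasi_iso_linked A (restrict_cplx A C) P" by (auto simp: quasi_iso_linked_def)
  ultimately show ?thesis using assms(2) unfolding perfect_over_def by blast
qed

section \<open>Modules over the polynomial ring\<close>

locale poly_base = A: ring A for A :: "('a, 'k) ring_scheme" (structure)
begin

sublocale U: UP_ring A "UP A" by unfold_locales

abbreviation tvar :: "nat \<Rightarrow> 'a" where "tvar \<equiv> monom (UP A) \<one> (Suc 0)"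
abbreviation const :: "'a \<Rightarrow> nat \<Rightarrow> 'a" where "const a \<equiv> monom (UP A) a 0"

lemma UP_add_induct [consumes 1, case_names monom add]:
  assumes p: "p \<in> carrier (UP A)"
    and "\<And>c n. c \<in> carrier A \<Longrightarrow> Q (monom (UP A) c n)"
    and "\<And>p r. p \<in> carrier (UP A) \<Longrightarrow> r \<in> carrier (UP A) \<Longrightarrow> Q p \<Longrightarrow> Q r \<Longrightarrow> Q (p \<oplus>\<^bsub>UP A\<^esub> r)"
  shows "Q p"
proof -
  have "Q (\<Oplus>\<^bsub>UP A\<^esub>i\<in>I. monom (UP A) (coeff (UP A) p i) i)" if "finite I" for I
    using that
  proof (induction I)
    case empty
    show ?case using assms(2)[of \<zero> 0] by simp
  next
    case (insert i I)
    have "(\<lambda>i. monom (UP A) (coeff (UP A) p i) i) \<in> I \<rightarrow> carrier (UP A)" using p by auto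
    with insert show ?case using p assms(2,3)
      by (simp add: U.P.finsum_insert U.P.finsum_closed)
  qed
  from this[of "{..deg A p}"] show ?thesis using U.up_repr[OF p] by simp
qed

lemma monom_split: "c \<in> carrier A \<Longrightarrow> monom (UP A) c n = monom (UP A) \<one> n \<otimes>\<^bsub>UP A\<^esub> const c"
  using U.monom_mult[of \<one> c n 0] by simp

lemma monom_commute: "c \<in> carrier A \<Longrightarrow>
    const c \<otimes>\<^bsub>UP A\<^esub> monom (UP A) \<one> n = monom (UP A) \<one> n \<otimes>\<^bsub>UP A\<^esub> const c"
  using U.monom_mult[of \<one> c n 0] U.monom_mult[of c \<one> 0 n] by simp

lemma tpow_Suc: "monom (UP A) \<one> (Suc n) = monom (UP A) \<one> n \<otimes>\<^bsub>UP A\<^esub> tvar"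
  using U.monom_mult[of \<one> \<one> n "Suc 0"] by simp

end

lemma restrict_module_sel [simp]:
  "carrier (restrict_module A M) = carrier M" "zero (restrict_module A M) = zero M"
  "add (restrict_module A M) = add M"
  "a \<odot>\<^bsub>restrict_module A M\<^esub> x = monom (UP A) a 0 \<odot>\<^bsub>M\<^esub> x"
  by (simp_all add: restrict_module_def)

lemma restrict_cplx_sel [simp]: "ob (restrict_cplx A C) k = restrict_module A (ob C k)"
  "dif (restrict_cplx A C) = dif C"
  by (simp_all add: restrict_cplx_def)

lemma a_inv_restrict [simp]: "a_inv (restrict_module A M) = a_inv M"
  by (rule ext) (simp add: a_inv_def m_inv_def)

context poly_base
begin

lemma right_module_restrict:
  assumes "right_module (UP A) M"
  shows "right_module A (restrict_module A M)"
proof -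
  interpret M: right_module "UP A" M by fact
  have "abelian_group (restrict_module A M)"
  proof (rule abelian_groupI)
    fix x assume "x \<in> carrier (restrict_module A M)"
    then show "\<exists>y\<in>carrier (restrict_module A M). y \<oplus>\<^bsub>restrict_module A M\<^esub> x = \<zero>\<^bsub>restrict_module A M\<^esub>"
      by (intro bexI[of _ "\<ominus>\<^bsub>M\<^esub> x"]) (simp_all add: M.M.l_neg)
  qed (simp_all add: M.M.a_ac)
  moreover have "const (a \<otimes> b) = const a \<otimes>\<^bsub>UP A\<^esub> const b" if "a \<in> carrier A" "b \<in> carrier A" for a b
    using U.monom_mult[of a b 0 0] that by simp
  ultimately show ?thesis
    by (intro right_moduleI') (simp_all add: A.ring_axioms M.modsimps M.smult_assoc
        del: U.monom_mult)
qed

lemma restrict_lin: "h \<in> lin_maps (UP A) M N \<Longrightarrow> h \<in> lin_maps A (restrict_module A M) (restrict_module A N)"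
  by (auto simp: lin_maps_def)

lemma tpow_smult_Suc:
  assumes "right_module (UP A) M" "x \<in> carrier M"
  shows "monom (UP A) \<one> (Suc n) \<odot>\<^bsub>M\<^esub> x = tvar \<odot>\<^bsub>M\<^esub> (monom (UP A) \<one> n \<odot>\<^bsub>M\<^esub> x)"
proof -
  interpret M: right_module "UP A" M by fact
  show ?thesis unfolding tpow_Suc[of n] using assms(2) by (intro M.smult_assoc) simp_all
qed

lemma lin_UP_I:
  assumes "right_module (UP A) M" "right_module (UP A) N"
    and h: "h \<in> lin_maps A (restrict_module A M) (restrict_module A N)"
    and t: "\<And>x. x \<in> carrier M \<Longrightarrow> h (tvar \<odot>\<^bsub>M\<^esub> x) = tvar \<odot>\<^bsub>N\<^esub> h x"
  shows "h \<in> lin_maps (UP A) M N"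
proof -
  interpret M: right_module "UP A" M by fact
  interpret N: right_module "UP A" N by fact
  have hc: "h x \<in> carrier N" if "x \<in> carrier M" for x using lin_maps_closed[OF h] that by simp
  have ha: "h (x \<oplus>\<^bsub>M\<^esub> y) = h x \<oplus>\<^bsub>N\<^esub> h y" if "x \<in> carrier M" "y \<in> carrier M" for x y
    using lin_maps_add[OF h] that by simp
  have hs: "h (const c \<odot>\<^bsub>M\<^esub> x) = const c \<odot>\<^bsub>N\<^esub> h x" if "x \<in> carrier M" "c \<in> carrier A" for x c
    using lin_maps_smult[OF h] that by simp
  have tn: "h (monom (UP A) \<one> n \<odot>\<^bsub>M\<^esub> x) = monom (UP A) \<one> n \<odot>\<^bsub>N\<^esub> h x" if x: "x \<in> carrier M" for n x
  proof (induction n)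
    case 0 then show ?case using x hc M.smult_one N.smult_one by simp
  next
    case (Suc n)
    then show ?case using x hc t[of "monom (UP A) \<one> n \<odot>\<^bsub>M\<^esub> x"]
      by (simp add: tpow_smult_Suc[OF assms(1) x, of n] tpow_smult_Suc[OF assms(2) hc[OF x], of n] M.smult_closed)
  qed
  have "h (p \<odot>\<^bsub>M\<^esub> x) = p \<odot>\<^bsub>N\<^esub> h x" if x: "x \<in> carrier M" and p: "p \<in> carrier (UP A)" for p x
    using p
  proof (induction p rule: UP_add_induct)
    case (monom c n)
    have "monom (UP A) c n \<odot>\<^bsub>M\<^esub> x = const c \<odot>\<^bsub>M\<^esub> (monom (UP A) \<one> n \<odot>\<^bsub>M\<^esub> x)"
      "monom (UP A) c n \<odot>\<^bsub>N\<^esub> h x = const c \<odot>\<^bsub>N\<^esub> (monom (UP A) \<one> n \<odot>\<^bsub>N\<^esub> h x)"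
      unfolding monom_split[OF monom, of n] using monom x hc
      by (auto intro!: M.smult_assoc N.smult_assoc)
    then show ?case using monom x tn[OF x] hs[of "monom (UP A) \<one> n \<odot>\<^bsub>M\<^esub> x" c]
      by (simp add: M.smult_closed)
  next
    case (add p r)
    then show ?case using x hc by (simp add: M.modsimps N.modsimps ha)
  qed
  then show ?thesis using hc ha by (intro lin_mapsI) auto
qed

text \<open>
  Modules over \<open>A[t]\<close> are \<open>A\<close>-modules with an endomorphism.  The modules \<open>M[t]\<close> and the companion modules
  below are constructed in this way, so that nothing but additivity and the effect of monomials has to be known about products of
  polynomials.
\<close>

definition endo_module :: "('a, 'm) module \<Rightarrow> ('m \<Rightarrow> 'm) \<Rightarrow> (nat \<Rightarrow> 'a, 'm) module" where
  "endo_module M T = \<lparr>carrier = carrier M, mult = undefined, one = undefined, zero = zero M, add = add M,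
     smult = (\<lambda>p x. \<Oplus>\<^bsub>M\<^esub>i\<in>{..deg A p}. coeff (UP A) p i \<odot>\<^bsub>M\<^esub> (T ^^ i) x)\<rparr>"

lemma endo_module_sel [simp]:
  "carrier (endo_module M T) = carrier M" "zero (endo_module M T) = zero M"
  "add (endo_module M T) = add M"
  by (simp_all add: endo_module_def)

context
  fixes M :: "('a, 'm) module" and T
  assumes M: "right_module A M" and T: "T \<in> lin_maps A M M"
begin

interpretation M: right_module A M by (rule M)

lemma endo_pow_lin: "(T ^^ n) \<in> lin_maps A M M"
proof (induction n)
  case 0 then show ?case using lin_maps_id by (simp add: id_def)
next
  case (Suc n) then show ?case using lin_maps_comp[OF Suc T] by (simp add: comp_def)
qed

lemma endo_smult_upto:
  assumes "p \<in> carrier (UP A)" "deg A p \<le> N" "x \<in> carrier M"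
  shows "p \<odot>\<^bsub>endo_module M T\<^esub> x = (\<Oplus>\<^bsub>M\<^esub>i\<in>{..N}. coeff (UP A) p i \<odot>\<^bsub>M\<^esub> (T ^^ i) x)"
proof -
  have "(\<Oplus>\<^bsub>M\<^esub>i\<in>{..deg A p}. coeff (UP A) p i \<odot>\<^bsub>M\<^esub> (T ^^ i) x)
    = (\<Oplus>\<^bsub>M\<^esub>i\<in>{..N}. coeff (UP A) p i \<odot>\<^bsub>M\<^esub> (T ^^ i) x)"
    using assms lin_maps_closed[OF endo_pow_lin]
    by (intro M.M.add.finprod_mono_neutral_cong_left) (auto simp: U.deg_aboveD M.smult_closed)
  then show ?thesis by (simp add: endo_module_def)
qed

lemma endo_smult_closed: "p \<in> carrier (UP A) \<Longrightarrow> x \<in> carrier M \<Longrightarrow> p \<odot>\<^bsub>endo_module M T\<^esub> x \<in> carrier M"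
  using lin_maps_closed[OF endo_pow_lin]
  by (auto simp: endo_module_def M.smult_closed intro!: M.M.finsum_closed)

lemma endo_smult_add:
  assumes "p \<in> carrier (UP A)" "x \<in> carrier M" "y \<in> carrier M"
  shows "p \<odot>\<^bsub>endo_module M T\<^esub> (x \<oplus>\<^bsub>M\<^esub> y) = p \<odot>\<^bsub>endo_module M T\<^esub> x \<oplus>\<^bsub>M\<^esub> p \<odot>\<^bsub>endo_module M T\<^esub> y"
proof -
  have "(\<Oplus>\<^bsub>M\<^esub>i\<in>{..deg A p}. coeff (UP A) p i \<odot>\<^bsub>M\<^esub> (T ^^ i) (x \<oplus>\<^bsub>M\<^esub> y))
    = (\<Oplus>\<^bsub>M\<^esub>i\<in>{..deg A p}. coeff (UP A) p i \<odot>\<^bsub>M\<^esub> (T ^^ i) x \<oplus>\<^bsub>M\<^esub> coeff (UP A) p i \<odot>\<^bsub>M\<^esub> (T ^^ i) y)"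
    using assms lin_maps_closed[OF endo_pow_lin]
    by (intro M.M.finsum_cong') (auto simp: lin_maps_add[OF endo_pow_lin] M.modsimps)
  then show ?thesis using assms lin_maps_closed[OF endo_pow_lin]
    by (simp add: endo_module_def M.M.finsum_addf M.smult_closed Pi_iff)
qed

lemma endo_smult_add_l:
  assumes "p \<in> carrier (UP A)" "r \<in> carrier (UP A)" "x \<in> carrier M"
  shows "(p \<oplus>\<^bsub>UP A\<^esub> r) \<odot>\<^bsub>endo_module M T\<^esub> x = p \<odot>\<^bsub>endo_module M T\<^esub> x \<oplus>\<^bsub>M\<^esub> r \<odot>\<^bsub>endo_module M T\<^esub> x"
proof -
  let ?N = "max (deg A p) (deg A r)"
  have "deg A (p \<oplus>\<^bsub>UP A\<^esub> r) \<le> ?N" using assms by (intro U.deg_add)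
  then have "(p \<oplus>\<^bsub>UP A\<^esub> r) \<odot>\<^bsub>endo_module M T\<^esub> x =
     (\<Oplus>\<^bsub>M\<^esub>i\<in>{..?N}. coeff (UP A) (p \<oplus>\<^bsub>UP A\<^esub> r) i \<odot>\<^bsub>M\<^esub> (T ^^ i) x)"
    using assms by (intro endo_smult_upto) auto
  also have "\<dots> = (\<Oplus>\<^bsub>M\<^esub>i\<in>{..?N}. coeff (UP A) p i \<odot>\<^bsub>M\<^esub> (T ^^ i) x \<oplus>\<^bsub>M\<^esub> coeff (UP A) r i \<odot>\<^bsub>M\<^esub> (T ^^ i) x)"
    using assms lin_maps_closed[OF endo_pow_lin]
    by (intro M.M.finsum_cong') (auto simp: M.modsimps)
  also have "\<dots> = p \<odot>\<^bsub>endo_module M T\<^esub> x \<oplus>\<^bsub>M\<^esub> r \<odot>\<^bsub>endo_module M T\<^esub> x"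
    using assms lin_maps_closed[OF endo_pow_lin]
    by (simp add: endo_smult_upto[of p ?N] endo_smult_upto[of r ?N] M.M.finsum_addf M.smult_closed Pi_iff)
  finally show ?thesis .
qed

lemma endo_smult_monom:
  assumes "c \<in> carrier A" "x \<in> carrier M"
  shows "monom (UP A) c n \<odot>\<^bsub>endo_module M T\<^esub> x = c \<odot>\<^bsub>M\<^esub> (T ^^ n) x"
proof -
  have "monom (UP A) c n \<odot>\<^bsub>endo_module M T\<^esub> x
      = (\<Oplus>\<^bsub>M\<^esub>i\<in>{..n}. coeff (UP A) (monom (UP A) c n) i \<odot>\<^bsub>M\<^esub> (T ^^ i) x)"
    using assms by (intro endo_smult_upto) (auto intro: U.deg_monom_le)
  also have "\<dots> = (\<Oplus>\<^bsub>M\<^esub>i\<in>{..n}. if n = i then c \<odot>\<^bsub>M\<^esub> (T ^^ i) x else \<zero>\<^bsub>M\<^esub>)"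
    using assms lin_maps_closed[OF endo_pow_lin]
    by (intro M.M.finsum_cong') (auto simp: M.modsimps)
  also have "\<dots> = c \<odot>\<^bsub>M\<^esub> (T ^^ n) x"
    using assms lin_maps_closed[OF endo_pow_lin]
    by (intro M.M.finsum_singleton) (auto simp: M.modsimps)
  finally show ?thesis .
qed

lemma endo_t: "x \<in> carrier M \<Longrightarrow> tvar \<odot>\<^bsub>endo_module M T\<^esub> x = T x"
  using endo_smult_monom[of \<one> x "Suc 0"] lin_maps_closed[OF T] by (simp add: M.smult_one)

lemma endo_const: "c \<in> carrier A \<Longrightarrow> x \<in> carrier M \<Longrightarrow> const c \<odot>\<^bsub>endo_module M T\<^esub> x = c \<odot>\<^bsub>M\<^esub> x"
  using endo_smult_monom[of c x 0] by simp

lemma right_module_endo: "right_module (UP A) (endo_module M T)"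
proof -
  let ?E = "endo_module M T"
  note cl = endo_smult_closed
  have assoc: "(p \<otimes>\<^bsub>UP A\<^esub> r) \<odot>\<^bsub>?E\<^esub> x = r \<odot>\<^bsub>?E\<^esub> (p \<odot>\<^bsub>?E\<^esub> x)"
    if p: "p \<in> carrier (UP A)" and r: "r \<in> carrier (UP A)" and x: "x \<in> carrier M" for p r x
    using r
  proof (induction r rule: UP_add_induct)
    case (monom c n)
    show ?case using p
    proof (induction p rule: UP_add_induct)
      case m: (monom e k)
      have "monom (UP A) e k \<otimes>\<^bsub>UP A\<^esub> monom (UP A) c n = monom (UP A) (e \<otimes> c) (n + k)"
        using m monom by (simp add: add.commute)
      moreover have "(T ^^ (n + k)) x = (T ^^ n) ((T ^^ k) x)" by (simp add: funpow_add)
      ultimately show ?case using m monom x lin_maps_closed[OF endo_pow_lin]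
        by (simp add: endo_smult_monom M.smult_assoc M.smult_closed lin_maps_smult[OF endo_pow_lin]
            del: U.monom_mult)
    next
      case (add p q)
      then show ?case using monom x by (simp add: U.P.l_distr endo_smult_add_l endo_smult_add cl)
    qed
  next
    case (add r s)
    then show ?case using p x by (simp add: U.P.r_distr endo_smult_add_l cl)
  qed
  have "abelian_group ?E"
  proof (rule abelian_groupI)
    fix x assume "x \<in> carrier ?E"
    then show "\<exists>y\<in>carrier ?E. y \<oplus>\<^bsub>?E\<^esub> x = \<zero>\<^bsub>?E\<^esub>"
      by (intro bexI[of _ "\<ominus>\<^bsub>M\<^esub> x"]) (simp_all add: M.M.l_neg)
  qed (simp_all add: M.M.a_ac)
  then show ?thesis
    using assoc endo_smult_monom[of \<one> _ 0]
    by (intro right_moduleI')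
      (simp_all add: U.P.ring_axioms cl endo_smult_add endo_smult_add_l M.smult_one)
qed

end

end

section \<open>Resolving a module over the polynomial ring\<close>

text \<open>
  The \<open>A\<close>-module that underlies \<open>M[t]\<close>.  The shift \<open>(0, c\<^sub>0, c\<^sub>1, \<dots>)\<close> of a sequence \<open>c\<close>, by which \<open>t\<close> acts, is
  \<open>case_nat 0 c\<close>, and a constant polynomial \<open>x\<close> is \<open>case_nat x 0\<close>.
\<close>

definition seq_module :: "('a, 'm) module \<Rightarrow> ('a, nat \<Rightarrow> 'm) module" where
  "seq_module M = \<lparr>carrier = {c. (\<forall>i. c i \<in> carrier M) \<and> finite {i. c i \<noteq> \<zero>\<^bsub>M\<^esub>}},
     mult = undefined, one = undefined, zero = (\<lambda>i. \<zero>\<^bsub>M\<^esub>), add = (\<lambda>c e i. c i \<oplus>\<^bsub>M\<^esub> e i),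
     smult = (\<lambda>a c i. a \<odot>\<^bsub>M\<^esub> c i)\<rparr>"

lemma seq_module_sel [simp]:
  "c \<in> carrier (seq_module M) \<longleftrightarrow> (\<forall>i. c i \<in> carrier M) \<and> finite {i. c i \<noteq> \<zero>\<^bsub>M\<^esub>}"
  "\<zero>\<^bsub>seq_module M\<^esub> = (\<lambda>i. \<zero>\<^bsub>M\<^esub>)" "c \<oplus>\<^bsub>seq_module M\<^esub> e = (\<lambda>i. c i \<oplus>\<^bsub>M\<^esub> e i)"
  "a \<odot>\<^bsub>seq_module M\<^esub> c = (\<lambda>i. a \<odot>\<^bsub>M\<^esub> c i)"
  by (simp_all add: seq_module_def)

lemma right_module_seq:
  assumes "right_module R M"
  shows "right_module R (seq_module M)"
proof -
  interpret M: right_module R M by fact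
  have fin: "finite {i. c i \<oplus>\<^bsub>M\<^esub> e i \<noteq> \<zero>\<^bsub>M\<^esub>}"
    if "finite {i. c i \<noteq> \<zero>\<^bsub>M\<^esub>}" "finite {i. e i \<noteq> \<zero>\<^bsub>M\<^esub>}" for c e :: "nat \<Rightarrow> 'c"
    by (rule finite_subset[of _ "{i. c i \<noteq> \<zero>\<^bsub>M\<^esub>} \<union> {i. e i \<noteq> \<zero>\<^bsub>M\<^esub>}"]) (use that in auto)
  have fin': "finite {i. a \<odot>\<^bsub>M\<^esub> c i \<noteq> \<zero>\<^bsub>M\<^esub>}"
    if "finite {i. c i \<noteq> \<zero>\<^bsub>M\<^esub>}" "a \<in> carrier R" for c :: "nat \<Rightarrow> 'c" and a
    by (rule finite_subset[OF _ that(1)]) (use that in auto)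
  have "abelian_group (seq_module M)"
  proof (rule abelian_groupI)
    fix c assume c: "c \<in> carrier (seq_module M)"
    have "finite {i. \<ominus>\<^bsub>M\<^esub> c i \<noteq> \<zero>\<^bsub>M\<^esub>}"
      by (rule finite_subset[of _ "{i. c i \<noteq> \<zero>\<^bsub>M\<^esub>}"]) (use c in auto)
    with c show "\<exists>e\<in>carrier (seq_module M). e \<oplus>\<^bsub>seq_module M\<^esub> c = \<zero>\<^bsub>seq_module M\<^esub>"
      by (intro bexI[of _ "\<lambda>i. \<ominus>\<^bsub>M\<^esub> c i"]) (auto simp: M.M.l_neg)
  qed (auto simp: M.M.a_ac fin)
  then show ?thesis
    by (intro right_moduleI') (auto simp: M.R.ring_axioms fin' M.modsimps M.smult_assoc)
qed

lemma finite_support_cons: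
  "finite {i. case_nat x c i \<noteq> z} \<longleftrightarrow> finite {i. c i \<noteq> z}"
proof
  assume "finite {i. case_nat x c i \<noteq> z}"
  then have "finite (Suc -` {i. case_nat x c i \<noteq> z})" by (rule finite_vimageI) simp
  then show "finite {i. c i \<noteq> z}" by (simp add: vimage_def)
next
  assume "finite {i. c i \<noteq> z}"
  then have "finite (insert 0 (Suc ` {i. c i \<noteq> z}))" by simp
  moreover have "{i. case_nat x c i \<noteq> z} \<subseteq> insert 0 (Suc ` {i. c i \<noteq> z})"
  proof
    fix i assume "i \<in> {i. case_nat x c i \<noteq> z}"
    then show "i \<in> insert 0 (Suc ` {i. c i \<noteq> z})" by (cases i) auto
  qed
  ultimately show "finite {i. case_nat x c i \<noteq> z}" by (rule rev_finite_subset)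
qed

context poly_base
begin

definition poly_module :: "(nat \<Rightarrow> 'a, 'm) module \<Rightarrow> (nat \<Rightarrow> 'a, nat \<Rightarrow> 'm) module" where
  "poly_module M = endo_module (seq_module (restrict_module A M)) (case_nat \<zero>\<^bsub>M\<^esub>)"

definition poly_const :: "(nat \<Rightarrow> 'a, 'm) module \<Rightarrow> 'm \<Rightarrow> nat \<Rightarrow> 'm" where
  "poly_const M x = case_nat x (\<lambda>i. \<zero>\<^bsub>M\<^esub>)"

text \<open>
  The \<open>A[t]\<close>-linear extension \<open>M[t] \<rightarrow> N\<close> of an \<open>A\<close>-linear map \<open>M \<rightarrow> N\<close>, as \<open>M[t]\<close> is induced from the
  \<open>A\<close>-module \<open>M\<close>.
\<close>

definition poly_ext :: "(nat \<Rightarrow> 'a, 'm) module \<Rightarrow> (nat \<Rightarrow> 'a, 'n) module \<Rightarrow> ('m \<Rightarrow> 'n) \<Rightarrow> (nat \<Rightarrow> 'm) \<Rightarrow> 'n" where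
  "poly_ext M N s c = (\<Oplus>\<^bsub>N\<^esub>i\<in>{i. c i \<noteq> \<zero>\<^bsub>M\<^esub>}. monom (UP A) \<one> i \<odot>\<^bsub>N\<^esub> s (c i))"

lemma t_lin: "right_module (UP A) N \<Longrightarrow> (\<lambda>x. tvar \<odot>\<^bsub>N\<^esub> x) \<in> lin_maps (UP A) N N"
proof -
  assume N: "right_module (UP A) N"
  then interpret N: right_module "UP A" N .
  show ?thesis
    by (intro lin_UP_I[OF N N] lin_mapsI)
      (auto simp: N.modsimps monom_commute simp flip: N.smult_assoc)
qed

text \<open>
  If \<open>M\<close> is free over \<open>A\<close> and \<open>t\<close> acts by the matrix \<open>T\<close>, this is the characteristic matrix \<open>T - t\<close>.
\<close>

definition char_map :: "(nat \<Rightarrow> 'a, 'm) module \<Rightarrow> (nat \<Rightarrow> 'm) \<Rightarrow> nat \<Rightarrow> 'm" where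
  "char_map M c = (\<lambda>i. tvar \<odot>\<^bsub>M\<^esub> c i) \<oplus>\<^bsub>poly_module M\<^esub> \<ominus>\<^bsub>poly_module M\<^esub> (tvar \<odot>\<^bsub>poly_module M\<^esub> c)"

context
  fixes M :: "(nat \<Rightarrow> 'a, 'm) module"
  assumes M: "right_module (UP A) M"
begin

interpretation M: right_module "UP A" M by (rule M)

abbreviation "PM \<equiv> poly_module M"

lemma shift_lin: "case_nat \<zero>\<^bsub>M\<^esub> \<in> lin_maps A (seq_module (restrict_module A M)) (seq_module (restrict_module A M))"
  by (rule lin_mapsI) (auto simp: finite_support_cons fun_eq_iff M.modsimps split: nat.splits)

lemmas poly_endo = right_module_seq[OF right_module_restrict[OF M]] shift_lin

lemma right_module_poly: "right_module (UP A) PM"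
  unfolding poly_module_def by (rule right_module_endo[OF poly_endo])

interpretation PM: right_module "UP A" PM by (rule right_module_poly)

lemma poly_sel [simp]:
  "c \<in> carrier PM \<longleftrightarrow> (\<forall>i. c i \<in> carrier M) \<and> finite {i. c i \<noteq> \<zero>\<^bsub>M\<^esub>}"
  "\<zero>\<^bsub>PM\<^esub> = (\<lambda>i. \<zero>\<^bsub>M\<^esub>)" "c \<oplus>\<^bsub>PM\<^esub> e = (\<lambda>i. c i \<oplus>\<^bsub>M\<^esub> e i)"
  by (simp_all add: poly_module_def)

lemma poly_t: "c \<in> carrier PM \<Longrightarrow> tvar \<odot>\<^bsub>PM\<^esub> c = case_nat \<zero>\<^bsub>M\<^esub> c"
  using endo_t[OF poly_endo, of c] by (simp add: poly_module_def)

lemma poly_scalar: "a \<in> carrier A \<Longrightarrow> c \<in> carrier PM \<Longrightarrow> const a \<odot>\<^bsub>PM\<^esub> c = (\<lambda>i. const a \<odot>\<^bsub>M\<^esub> c i)"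
  using endo_const[OF poly_endo, of a c] by (simp add: poly_module_def)

lemma poly_const_lin: "poly_const M \<in> lin_maps A (restrict_module A M) (restrict_module A PM)"
proof (rule lin_mapsI)
  have cl: "poly_const M x \<in> carrier PM" if "x \<in> carrier M" for x
    using that by (simp add: poly_const_def finite_support_cons split: nat.splits)
  then show "poly_const M x \<in> carrier (restrict_module A PM)" if "x \<in> carrier (restrict_module A M)" for x
    using that by simp
  show "poly_const M (a \<odot>\<^bsub>restrict_module A M\<^esub> x) = a \<odot>\<^bsub>restrict_module A PM\<^esub> poly_const M x"
    if "a \<in> carrier A" "x \<in> carrier (restrict_module A M)" for a x
    using that poly_scalar[OF that(1) cl] by (auto simp: poly_const_def fun_eq_iff M.modsimps split: nat.splits)
qed (auto simp: poly_const_def fun_eq_iff split: nat.splits)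

lemma poly_const_closed: "x \<in> carrier M \<Longrightarrow> poly_const M x \<in> carrier PM"
  using lin_maps_closed[OF poly_const_lin] by (simp del: poly_sel)

lemma poly_bound: "c \<in> carrier PM \<Longrightarrow> \<exists>n. \<forall>i>n. c i = \<zero>\<^bsub>M\<^esub>"
proof -
  assume "c \<in> carrier PM"
  then have "finite {i. c i \<noteq> \<zero>\<^bsub>M\<^esub>}" by simp
  then obtain n where "\<forall>i\<in>{i. c i \<noteq> \<zero>\<^bsub>M\<^esub>}. i \<le> n" using finite_nat_set_iff_bounded_le by blast
  then show ?thesis by (intro exI[of _ n]) (auto simp: not_le[symmetric])
qed

text \<open>
  The constants generate \<open>M[t]\<close> over \<open>A[t]\<close>.  So identities between maps on
  \<open>M[t]\<close> need to be checked on constants only.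
\<close>

lemma poly_induct [consumes 1, case_names const add shift]:
  assumes c: "c \<in> carrier PM"
    and const: "\<And>x. x \<in> carrier M \<Longrightarrow> Q (poly_const M x)"
    and add: "\<And>c e. c \<in> carrier PM \<Longrightarrow> e \<in> carrier PM \<Longrightarrow> Q c \<Longrightarrow> Q e \<Longrightarrow> Q (c \<oplus>\<^bsub>PM\<^esub> e)"
    and shift: "\<And>c. c \<in> carrier PM \<Longrightarrow> Q c \<Longrightarrow> Q (tvar \<odot>\<^bsub>PM\<^esub> c)"
  shows "Q c"
proof -
  have "Q c" if "c \<in> carrier PM" "\<forall>i\<ge>n. c i = \<zero>\<^bsub>M\<^esub>" for n c
    using that
  proof (induction n arbitrary: c)
    case 0
    then have "c = poly_const M \<zero>\<^bsub>M\<^esub>" by (auto simp: poly_const_def fun_eq_iff split: nat.splits)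
    then show ?case using const by simp
  next
    case (Suc n)
    let ?e = "\<lambda>i. c (Suc i)"
    have cons: "c = case_nat (c 0) ?e" by (auto simp: fun_eq_iff split: nat.splits)
    have "finite {i. c i \<noteq> \<zero>\<^bsub>M\<^esub>}" using Suc.prems by simp
    then have "finite {i. c (Suc i) \<noteq> \<zero>\<^bsub>M\<^esub>}" by (subst (asm) cons) (simp only: finite_support_cons)
    then have e: "?e \<in> carrier PM" using Suc.prems by simp
    then have Qe: "Q ?e" using Suc.prems by (intro Suc.IH) auto
    have c0: "c 0 \<in> carrier M" using Suc.prems by simp
    have "c = poly_const M (c 0) \<oplus>\<^bsub>PM\<^esub> tvar \<odot>\<^bsub>PM\<^esub> ?e"
      unfolding poly_t[OF e] using Suc.prems by (auto simp: poly_const_def fun_eq_iff split: nat.splits)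
    moreover have "Q (poly_const M (c 0) \<oplus>\<^bsub>PM\<^esub> tvar \<odot>\<^bsub>PM\<^esub> ?e)"
      by (intro add poly_const_closed c0 const shift e Qe PM.smult_closed) simp_all
    ultimately show ?case by simp
  qed
  moreover obtain n where "\<forall>i\<ge>n. c i = \<zero>\<^bsub>M\<^esub>"
  proof -
    have "finite {i. c i \<noteq> \<zero>\<^bsub>M\<^esub>}" using c by simp
    then obtain n where "\<forall>i\<in>{i. c i \<noteq> \<zero>\<^bsub>M\<^esub>}. i < n" using finite_nat_set_iff_bounded by blast
    then show thesis by (intro that[of n]) (auto simp: not_less[symmetric])
  qed
  ultimately show ?thesis using c by blast
qed

lemma poly_eqI:
  assumes "right_module (UP A) N" and h: "h \<in> lin_maps (UP A) PM N" and h': "h' \<in> lin_maps (UP A) PM N"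
    and eq: "\<And>x. x \<in> carrier M \<Longrightarrow> h (poly_const M x) = h' (poly_const M x)"
    and c: "c \<in> carrier PM"
  shows "h c = h' c"
  using c
proof (induction c rule: poly_induct)
  case (add c e)
  then show ?case by (simp only: lin_maps_add[OF h] lin_maps_add[OF h'])
next
  case (shift c)
  moreover have "tvar \<in> carrier (UP A)" by simp
  ultimately show ?case by (simp only: lin_maps_smult[OF h] lin_maps_smult[OF h'])
qed (rule eq)

context
  fixes N :: "(nat \<Rightarrow> 'a, 'n) module" and s
  assumes N: "right_module (UP A) N"
    and s: "s \<in> lin_maps A (restrict_module A M) (restrict_module A N)"
begin

interpretation N: right_module "UP A" N by (rule N)

lemma s_simps: "x \<in> carrier M \<Longrightarrow> s x \<in> carrier N"
  "x \<in> carrier M \<Longrightarrow> y \<in> carrier M \<Longrightarrow> s (x \<oplus>\<^bsub>M\<^esub> y) = s x \<oplus>\<^bsub>N\<^esub> s y"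
  "a \<in> carrier A \<Longrightarrow> x \<in> carrier M \<Longrightarrow> s (const a \<odot>\<^bsub>M\<^esub> x) = const a \<odot>\<^bsub>N\<^esub> s x"
  "s \<zero>\<^bsub>M\<^esub> = \<zero>\<^bsub>N\<^esub>"
  using lin_maps_closed[OF s] lin_maps_add[OF s] lin_maps_smult[OF s]
    lin_maps_zero[OF s right_module_group[OF right_module_restrict[OF M]]
      right_module_group[OF right_module_restrict[OF N]]] by simp_all

lemma poly_ext_upto:
  assumes "c \<in> carrier PM" "\<And>i. n < i \<Longrightarrow> c i = \<zero>\<^bsub>M\<^esub>"
  shows "poly_ext M N s c = (\<Oplus>\<^bsub>N\<^esub>i\<in>{..n}. monom (UP A) \<one> i \<odot>\<^bsub>N\<^esub> s (c i))"
  unfolding poly_ext_def using assms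
  by (intro N.M.add.finprod_mono_neutral_cong_left)
    (auto simp: s_simps N.smult_closed not_less[symmetric])

lemma poly_ext_lin: "poly_ext M N s \<in> lin_maps (UP A) PM N"
proof (rule lin_UP_I[OF right_module_poly N])
  have cl: "monom (UP A) \<one> i \<odot>\<^bsub>N\<^esub> s (c i) \<in> carrier N" if "c \<in> carrier PM" for c i
    using that by (simp add: s_simps N.smult_closed)
  show "poly_ext M N s \<in> lin_maps A (restrict_module A PM) (restrict_module A N)"
  proof (rule lin_mapsI)
    fix c assume "c \<in> carrier (restrict_module A PM)"
    then have c: "c \<in> carrier PM" by (simp del: poly_sel)
    then obtain n where n: "\<forall>i>n. c i = \<zero>\<^bsub>M\<^esub>" using poly_bound by blast
    show "poly_ext M N s c \<in> carrier (restrict_module A N)"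
      using cl[OF c] by (simp add: poly_ext_def N.M.finsum_closed Pi_iff)
    {
      fix e assume "e \<in> carrier (restrict_module A PM)"
      then have e: "e \<in> carrier PM" by (simp del: poly_sel)
      then obtain m where m: "\<forall>i>m. e i = \<zero>\<^bsub>M\<^esub>" using poly_bound by blast
      let ?n = "max m n"
      have ce: "c \<oplus>\<^bsub>PM\<^esub> e \<in> carrier PM" using c e by (rule PM.M.a_closed)
      have "poly_ext M N s (c \<oplus>\<^bsub>PM\<^esub> e) = (\<Oplus>\<^bsub>N\<^esub>i\<in>{..?n}. monom (UP A) \<one> i \<odot>\<^bsub>N\<^esub> s ((c \<oplus>\<^bsub>PM\<^esub> e) i))"
        using n m by (intro poly_ext_upto ce) simp
      also have "\<dots> = (\<Oplus>\<^bsub>N\<^esub>i\<in>{..?n}. monom (UP A) \<one> i \<odot>\<^bsub>N\<^esub> s (c i) \<oplus>\<^bsub>N\<^esub> monom (UP A) \<one> i \<odot>\<^bsub>N\<^esub> s (e i))"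
        using c e by (intro N.M.finsum_cong') (auto simp: s_simps N.modsimps)
      also have "\<dots> = (\<Oplus>\<^bsub>N\<^esub>i\<in>{..?n}. monom (UP A) \<one> i \<odot>\<^bsub>N\<^esub> s (c i)) \<oplus>\<^bsub>N\<^esub>
          (\<Oplus>\<^bsub>N\<^esub>i\<in>{..?n}. monom (UP A) \<one> i \<odot>\<^bsub>N\<^esub> s (e i))"
        using cl[OF c] cl[OF e] by (intro N.M.finsum_addf) auto
      also have "\<dots> = poly_ext M N s c \<oplus>\<^bsub>N\<^esub> poly_ext M N s e"
        using n m by (simp add: poly_ext_upto[OF c, of ?n] poly_ext_upto[OF e, of ?n])
      finally show "poly_ext M N s (c \<oplus>\<^bsub>restrict_module A PM\<^esub> e) =
          poly_ext M N s c \<oplus>\<^bsub>restrict_module A N\<^esub> poly_ext M N s e" by simp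
    }
    fix a assume a: "a \<in> carrier A"
    have ac: "const a \<odot>\<^bsub>PM\<^esub> c \<in> carrier PM" using a c by (intro PM.smult_closed) simp_all
    have "poly_ext M N s (const a \<odot>\<^bsub>PM\<^esub> c) = (\<Oplus>\<^bsub>N\<^esub>i\<in>{..n}. monom (UP A) \<one> i \<odot>\<^bsub>N\<^esub> s ((const a \<odot>\<^bsub>PM\<^esub> c) i))"
      using n a by (intro poly_ext_upto ac) (simp add: poly_scalar[OF a c])
    also have "\<dots> = (\<Oplus>\<^bsub>N\<^esub>i\<in>{..n}. const a \<odot>\<^bsub>N\<^esub> (monom (UP A) \<one> i \<odot>\<^bsub>N\<^esub> s (c i)))"
      using a c by (intro N.M.finsum_cong')
        (auto simp: poly_scalar[OF a c] s_simps N.smult_closed monom_commute simp flip: N.smult_assoc)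
    also have "\<dots> = const a \<odot>\<^bsub>N\<^esub> poly_ext M N s c"
      using n a cl[OF c] by (simp add: poly_ext_upto[OF c, of n] N.smult_finsum Pi_iff)
    finally show "poly_ext M N s (a \<odot>\<^bsub>restrict_module A PM\<^esub> c) = a \<odot>\<^bsub>restrict_module A N\<^esub> poly_ext M N s c"
      by simp
  qed
  fix c assume c: "c \<in> carrier PM"
  then obtain n where n: "\<forall>i>n. c i = \<zero>\<^bsub>M\<^esub>" using poly_bound by blast
  have tc: "case_nat \<zero>\<^bsub>M\<^esub> c \<in> carrier PM"
    using PM.smult_closed[OF _ c, of tvar] by (simp add: poly_t[OF c] del: poly_sel)
  have st: "monom (UP A) \<one> (Suc i) \<odot>\<^bsub>N\<^esub> s (c i) = tvar \<odot>\<^bsub>N\<^esub> (monom (UP A) \<one> i \<odot>\<^bsub>N\<^esub> s (c i))" for i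
    using c by (intro tpow_smult_Suc[OF N]) (simp add: s_simps)
  have "poly_ext M N s (case_nat \<zero>\<^bsub>M\<^esub> c) = (\<Oplus>\<^bsub>N\<^esub>i\<in>{..Suc n}. monom (UP A) \<one> i \<odot>\<^bsub>N\<^esub> s (case_nat \<zero>\<^bsub>M\<^esub> c i))"
    using n by (intro poly_ext_upto tc) (auto split: nat.splits)
  also have "\<dots> = (\<Oplus>\<^bsub>N\<^esub>i\<in>{..n}. monom (UP A) \<one> (Suc i) \<odot>\<^bsub>N\<^esub> s (c i))"
    using cl[OF tc] c by (subst N.M.finsum_Suc2) (simp_all add: s_simps N.smult_closed Pi_iff)
  also have "\<dots> = tvar \<odot>\<^bsub>N\<^esub> poly_ext M N s c"
    unfolding st using n cl[OF c] by (simp add: poly_ext_upto[OF c, of n] N.smult_finsum Pi_iff)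
  finally show "poly_ext M N s (tvar \<odot>\<^bsub>PM\<^esub> c) = tvar \<odot>\<^bsub>N\<^esub> poly_ext M N s c"
    by (simp add: poly_t[OF c])
qed

lemma poly_ext_const:
  assumes "x \<in> carrier M"
  shows "poly_ext M N s (poly_const M x) = s x"
proof -
  have "poly_ext M N s (poly_const M x) = (\<Oplus>\<^bsub>N\<^esub>i\<in>{..0}. monom (UP A) \<one> i \<odot>\<^bsub>N\<^esub> s (poly_const M x i))"
    by (intro poly_ext_upto poly_const_closed assms) (auto simp: poly_const_def split: nat.splits)
  also have "\<dots> = s x" using assms by (simp add: poly_const_def s_simps N.smult_closed N.smult_one Pi_iff)
  finally show ?thesis .
qed

end

lemma coeff_t_lin: "(\<lambda>c i. tvar \<odot>\<^bsub>M\<^esub> c i) \<in> lin_maps (UP A) PM PM"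
proof (rule lin_UP_I[OF right_module_poly right_module_poly])
  have cl: "(\<lambda>i. tvar \<odot>\<^bsub>M\<^esub> c i) \<in> carrier PM" if "c \<in> carrier PM" for c
    using that by (auto simp: M.smult_closed intro: finite_subset[of _ "{i. c i \<noteq> \<zero>\<^bsub>M\<^esub>}"])
  show "(\<lambda>c i. tvar \<odot>\<^bsub>M\<^esub> c i) \<in> lin_maps A (restrict_module A PM) (restrict_module A PM)"
  proof (rule lin_mapsI)
    fix a c assume a: "a \<in> carrier A" and "c \<in> carrier (restrict_module A PM)"
    then have "tvar \<odot>\<^bsub>M\<^esub> (const a \<odot>\<^bsub>M\<^esub> c i) = const a \<odot>\<^bsub>M\<^esub> (tvar \<odot>\<^bsub>M\<^esub> c i)" for i
      by (simp add: monom_commute flip: M.smult_assoc)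
    with a \<open>c \<in> _\<close> show "(\<lambda>i. tvar \<odot>\<^bsub>M\<^esub> (a \<odot>\<^bsub>restrict_module A PM\<^esub> c) i) = a \<odot>\<^bsub>restrict_module A PM\<^esub> (\<lambda>i. tvar \<odot>\<^bsub>M\<^esub> c i)"
      using cl[of c] by (auto simp: poly_scalar fun_eq_iff simp del: poly_sel(1))
  next
    fix c assume "c \<in> carrier (restrict_module A PM)"
    then show "(\<lambda>i. tvar \<odot>\<^bsub>M\<^esub> c i) \<in> carrier (restrict_module A PM)" using cl[of c] by (simp del: poly_sel(1))
  next
    fix c e assume "c \<in> carrier (restrict_module A PM)" "e \<in> carrier (restrict_module A PM)"
    then show "(\<lambda>i. tvar \<odot>\<^bsub>M\<^esub> (c \<oplus>\<^bsub>restrict_module A PM\<^esub> e) i) =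
      (\<lambda>i. tvar \<odot>\<^bsub>M\<^esub> c i) \<oplus>\<^bsub>restrict_module A PM\<^esub> (\<lambda>i. tvar \<odot>\<^bsub>M\<^esub> e i)" by (simp add: M.modsimps)
  qed
  fix c assume c: "c \<in> carrier PM"
  show "(\<lambda>i. tvar \<odot>\<^bsub>M\<^esub> (tvar \<odot>\<^bsub>PM\<^esub> c) i) = tvar \<odot>\<^bsub>PM\<^esub> (\<lambda>i. tvar \<odot>\<^bsub>M\<^esub> c i)"
    unfolding poly_t[OF c] poly_t[OF cl[OF c]] by (auto simp: fun_eq_iff split: nat.splits)
qed

lemma char_map_lin: "char_map M \<in> lin_maps (UP A) PM PM"
proof -
  have "(\<lambda>c. (\<lambda>i. tvar \<odot>\<^bsub>M\<^esub> c i) \<oplus>\<^bsub>PM\<^esub> \<ominus>\<^bsub>PM\<^esub> (tvar \<odot>\<^bsub>PM\<^esub> c)) \<in> lin_maps (UP A) PM PM"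
    by (intro lin_maps_plus lin_maps_neg right_module_poly coeff_t_lin t_lin)
  then show ?thesis by (simp only: char_map_def[abs_def])
qed

lemma char_map_const: "x \<in> carrier M \<Longrightarrow> char_map M (poly_const M x) =
    poly_const M (tvar \<odot>\<^bsub>M\<^esub> x) \<oplus>\<^bsub>PM\<^esub> \<ominus>\<^bsub>PM\<^esub> (tvar \<odot>\<^bsub>PM\<^esub> poly_const M x)"
proof -
  have "(\<lambda>i. tvar \<odot>\<^bsub>M\<^esub> poly_const M x i) = poly_const M (tvar \<odot>\<^bsub>M\<^esub> x)"
    by (auto simp: poly_const_def fun_eq_iff split: nat.splits)
  then show ?thesis by (simp only: char_map_def)
qed

text \<open>
  On a constant \<open>x\<close> the characteristic map is \<open>x t\<close> as a constant minus \<open>t\<close> times the constant \<open>x\<close>.  So a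
  map out of \<open>M[t]\<close> composed with it measures how far \<open>s\<close> is from commuting with \<open>t\<close>.
\<close>

lemma poly_ext_char:
  assumes N: "right_module (UP A) N"
    and s: "s \<in> lin_maps A (restrict_module A M) (restrict_module A N)"
    and r: "r \<in> lin_maps (UP A) PM N"
    and rs: "\<And>x. x \<in> carrier M \<Longrightarrow> r (poly_const M x) = s (tvar \<odot>\<^bsub>M\<^esub> x) \<oplus>\<^bsub>N\<^esub> \<ominus>\<^bsub>N\<^esub> (tvar \<odot>\<^bsub>N\<^esub> s x)"
    and c: "c \<in> carrier PM"
  shows "poly_ext M N s (char_map M c) = r c"
proof (rule poly_eqI[OF N _ r _ c, where h = "\<lambda>c. poly_ext M N s (char_map M c)"])
  note e = poly_ext_lin[OF N s]
  show "(\<lambda>c. poly_ext M N s (char_map M c)) \<in> lin_maps (UP A) PM N"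
    by (rule lin_maps_comp[OF char_map_lin e])
  fix x assume x: "x \<in> carrier M"
  interpret N: right_module "UP A" N by (rule N)
  have t: "tvar \<in> carrier (UP A)" by simp
  note cx = poly_const_closed[OF x] and tx = M.smult_closed[OF t x]
  note tcx = PM.smult_closed[OF t cx]
  have "poly_ext M N s (char_map M (poly_const M x))
    = poly_ext M N s (poly_const M (tvar \<odot>\<^bsub>M\<^esub> x)) \<oplus>\<^bsub>N\<^esub> poly_ext M N s (\<ominus>\<^bsub>PM\<^esub> (tvar \<odot>\<^bsub>PM\<^esub> poly_const M x))"
    unfolding char_map_const[OF x]
    by (rule lin_maps_add[OF e poly_const_closed[OF tx] PM.M.a_inv_closed[OF tcx]])
  also have "poly_ext M N s (\<ominus>\<^bsub>PM\<^esub> (tvar \<odot>\<^bsub>PM\<^esub> poly_const M x))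
    = \<ominus>\<^bsub>N\<^esub> (tvar \<odot>\<^bsub>N\<^esub> s x)"
    using lin_maps_minus[OF e PM.abelian_group_axioms N.abelian_group_axioms tcx]
      lin_maps_smult[OF e t cx] poly_ext_const[OF N s x] by simp
  finally show "poly_ext M N s (char_map M (poly_const M x)) = r (poly_const M x)"
    by (simp add: rs[OF x] poly_ext_const[OF N s tx])
qed

definition "eval_t = poly_ext M M (\<lambda>x. x)"

lemma id_lin: "(\<lambda>x. x) \<in> lin_maps A (restrict_module A M) (restrict_module A M)"
  by (rule lin_maps_id)

lemma eval_lin: "eval_t \<in> lin_maps (UP A) PM M"
  unfolding eval_t_def by (rule poly_ext_lin[OF M id_lin])

lemma eval_const: "x \<in> carrier M \<Longrightarrow> eval_t (poly_const M x) = x"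
  unfolding eval_t_def by (rule poly_ext_const[OF M id_lin])

lemma eval_char: "c \<in> carrier PM \<Longrightarrow> eval_t (char_map M c) = \<zero>\<^bsub>M\<^esub>"
  unfolding eval_t_def
  by (rule poly_ext_char[OF M id_lin lin_maps_zero_map[OF M]]) (simp_all add: M.M.r_neg M.smult_closed)

text \<open>
  The sequence \<open>0 \<rightarrow> M[t] \<rightarrow> M[t] \<rightarrow> M \<rightarrow> 0\<close> is exact: every polynomial is congruent, modulo the image
  of the characteristic map, to the constant obtained by letting \<open>t\<close> act, and an element of the
  kernel of the characteristic map has \<open>c\<^sub>i = c\<^bsub>i+1\<^esub> t\<close> for all \<open>i\<close>, so vanishes by finite support.
\<close>

lemma poly_decomp:
  assumes "c \<in> carrier PM"
  shows "\<exists>e\<in>carrier PM. c = poly_const M (eval_t c) \<oplus>\<^bsub>PM\<^esub> char_map M e"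
  using assms
proof (induction c rule: poly_induct)
  case (const x)
  have "char_map M \<zero>\<^bsub>PM\<^esub> = \<zero>\<^bsub>PM\<^esub>"
    by (rule lin_maps_zero[OF char_map_lin PM.abelian_group_axioms PM.abelian_group_axioms])
  then have "poly_const M x = poly_const M (eval_t (poly_const M x)) \<oplus>\<^bsub>PM\<^esub> char_map M \<zero>\<^bsub>PM\<^esub>"
    using eval_const[OF const] PM.M.r_zero[OF poly_const_closed[OF const]] by (simp only:)
  then show ?case using PM.M.zero_closed by blast
next
  case (add c d)
  then obtain e f where e: "e \<in> carrier PM" "c = poly_const M (eval_t c) \<oplus>\<^bsub>PM\<^esub> char_map M e"
    and f: "f \<in> carrier PM" "d = poly_const M (eval_t d) \<oplus>\<^bsub>PM\<^esub> char_map M f" by blast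
  note cl = lin_maps_closed[OF char_map_lin]
  have ev: "eval_t c \<in> carrier M" "eval_t d \<in> carrier M"
    using add lin_maps_closed[OF eval_lin] by blast+
  have pc: "poly_const M (eval_t (c \<oplus>\<^bsub>PM\<^esub> d)) = poly_const M (eval_t c) \<oplus>\<^bsub>PM\<^esub> poly_const M (eval_t d)"
    using lin_maps_add[OF eval_lin add(1,2)] lin_maps_add[OF poly_const_lin, of "eval_t c" "eval_t d"] ev
    by (simp del: poly_sel)
  have cm: "char_map M (e \<oplus>\<^bsub>PM\<^esub> f) = char_map M e \<oplus>\<^bsub>PM\<^esub> char_map M f"
    by (rule lin_maps_add[OF char_map_lin e(1) f(1)])
  have "c \<oplus>\<^bsub>PM\<^esub> d = (poly_const M (eval_t c) \<oplus>\<^bsub>PM\<^esub> char_map M e) \<oplus>\<^bsub>PM\<^esub>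
      (poly_const M (eval_t d) \<oplus>\<^bsub>PM\<^esub> char_map M f)"
    using e(2) f(2) by simp
  also have "\<dots> = poly_const M (eval_t (c \<oplus>\<^bsub>PM\<^esub> d)) \<oplus>\<^bsub>PM\<^esub> char_map M (e \<oplus>\<^bsub>PM\<^esub> f)"
    unfolding pc cm using cl[OF e(1)] cl[OF f(1)] poly_const_closed[OF ev(1)] poly_const_closed[OF ev(2)]
    by (simp add: PM.M.a_ac del: poly_sel)
  finally show ?case using PM.M.a_closed[OF e(1) f(1)] by blast
next
  case (shift c)
  then obtain e where e: "e \<in> carrier PM" "c = poly_const M (eval_t c) \<oplus>\<^bsub>PM\<^esub> char_map M e" by blast
  have t: "tvar \<in> carrier (UP A)" by simp
  define x where "x = eval_t c"
  have x: "x \<in> carrier M" unfolding x_def using shift lin_maps_closed[OF eval_lin] by blast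
  note cl = lin_maps_closed[OF char_map_lin]
  note cx = poly_const_closed[OF x] and ctx = poly_const_closed[OF M.smult_closed[OF t x]]
  note tcx = PM.smult_closed[OF t cx] and te = PM.smult_closed[OF t e(1)]
  let ?e = "tvar \<odot>\<^bsub>PM\<^esub> e \<oplus>\<^bsub>PM\<^esub> \<ominus>\<^bsub>PM\<^esub> poly_const M x"
  have ev: "eval_t (tvar \<odot>\<^bsub>PM\<^esub> c) = tvar \<odot>\<^bsub>M\<^esub> x"
    using lin_maps_smult[OF eval_lin t shift(1)] by (simp add: x_def)
  have "tvar \<odot>\<^bsub>PM\<^esub> c = tvar \<odot>\<^bsub>PM\<^esub> (poly_const M x \<oplus>\<^bsub>PM\<^esub> char_map M e)"
    using e(2) by (simp add: x_def)
  also have "\<dots> = tvar \<odot>\<^bsub>PM\<^esub> poly_const M x \<oplus>\<^bsub>PM\<^esub> char_map M (tvar \<odot>\<^bsub>PM\<^esub> e)"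
    unfolding lin_maps_smult[OF char_map_lin t e(1)] by (rule PM.smult_r_distr[OF t cx cl[OF e(1)]])
  also have "\<dots> = poly_const M (tvar \<odot>\<^bsub>M\<^esub> x) \<oplus>\<^bsub>PM\<^esub>
      (char_map M (tvar \<odot>\<^bsub>PM\<^esub> e) \<oplus>\<^bsub>PM\<^esub> \<ominus>\<^bsub>PM\<^esub> char_map M (poly_const M x))"
    unfolding char_map_const[OF x] using ctx tcx cl[OF te] by (simp add: PM.M.grp del: poly_sel)
  also have "char_map M (tvar \<odot>\<^bsub>PM\<^esub> e) \<oplus>\<^bsub>PM\<^esub> \<ominus>\<^bsub>PM\<^esub> char_map M (poly_const M x) = char_map M ?e"
    using lin_maps_add[OF char_map_lin te PM.M.a_inv_closed[OF cx]]
      lin_maps_minus[OF char_map_lin PM.abelian_group_axioms PM.abelian_group_axioms cx] by (simp only:)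
  finally show ?case unfolding ev using PM.M.a_closed[OF te PM.M.a_inv_closed[OF cx]] by blast
qed

lemma char_map_inj:
  assumes "c \<in> carrier PM" "char_map M c = \<zero>\<^bsub>PM\<^esub>"
  shows "c = \<zero>\<^bsub>PM\<^esub>"
proof -
  have t: "tvar \<in> carrier (UP A)" by simp
  have "(\<lambda>i. tvar \<odot>\<^bsub>M\<^esub> c i) = tvar \<odot>\<^bsub>PM\<^esub> c"
    by (rule PM.M.eq_if_minus_zero[OF lin_maps_closed[OF coeff_t_lin assms(1)] PM.smult_closed[OF t assms(1)]])
      (use assms(2) in \<open>simp only: char_map_def\<close>)
  then have "tvar \<odot>\<^bsub>M\<^esub> c (Suc i) = c i" for i
    unfolding poly_t[OF assms(1)] by (auto dest!: fun_cong[of _ _ "Suc i"])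
  then have step: "c i = \<zero>\<^bsub>M\<^esub>" if "c (Suc i) = \<zero>\<^bsub>M\<^esub>" for i
    using that M.smult_zero_r[OF t] by metis
  obtain n where n: "c j = \<zero>\<^bsub>M\<^esub>" if "j > n" for j using poly_bound[OF assms(1)] by blast
  have "c i = \<zero>\<^bsub>M\<^esub>" for i
  proof -
    have *: "c (i + k) = \<zero>\<^bsub>M\<^esub> \<Longrightarrow> c i = \<zero>\<^bsub>M\<^esub>" for k
      by (induction k) (use step in auto)
    have "n < i + Suc n" by simp
    from *[OF n[OF this]] show ?thesis .
  qed
  then show ?thesis by auto
qed

end

end

section \<open>Restriction of scalars for complexes\<close>

lemma cyc_restrict [simp]: "cyc (restrict_cplx A C) k = cyc C k"
  and boundaries_restrict [simp]: "boundaries (restrict_cplx A C) k = boundaries C k"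
  by (simp_all add: cyc_def boundaries_def)

lemma acyclic_restrict [simp]: "acyclic_at (restrict_cplx A C) k \<longleftrightarrow> acyclic_at C k"
  by (simp add: acyclic_at_def)

lemma homology_restrict:
  fixes A :: "('a, 'k) ring_scheme" and C :: "(nat \<Rightarrow> 'a, 'm) cplx"
  shows "homology (restrict_cplx A C) k = restrict_module A (homology C k)"
proof -
  have 1: "cycles_module (restrict_cplx A C) k = restrict_module A (cycles_module C k)"
    by (simp add: cycles_module_eq restrict_module_def)
  have 2: "quot_module (restrict_module A M) U = restrict_module A (quot_module M U)"
    for M :: "(nat \<Rightarrow> 'a, 'm) module" and U
    by (simp add: quot_module_def restrict_module_def A_RCOSETS_def' set_add_def' a_r_coset_def' fun_eq_iff)
  show ?thesis unfolding homology_def 1 2 by simp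
qed

lemma restrict_dsum: "restrict_module A (dsum_module M N) = dsum_module (restrict_module A M) (restrict_module A N)"
  by (auto simp: restrict_module_def dsum_module_def fun_eq_iff)

lemma restrict_cone: "restrict_cplx A (cone C D f) = cone (restrict_cplx A C) (restrict_cplx A D) f"
  unfolding cone_def restrict_cplx_def by (simp add: restrict_dsum)

context poly_base
begin

lemma restrict_zcx:
  assumes "zcx (UP A) C"
  shows "zcx A (restrict_cplx A C)"
proof -
  interpret C: zcx "UP A" C by fact
  show ?thesis
    by (rule zcx.intro) (simp_all add: right_module_restrict C.mod restrict_lin C.d_lin)
qed

lemma restrict_zmap:
  assumes "zmap (UP A) C D f"
  shows "zmap A (restrict_cplx A C) (restrict_cplx A D) f"
proof -
  interpret f: zmap "UP A" C D f by fact
  show ?thesis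
    by (intro zmap.intro zmap_axioms.intro restrict_zcx f.C.zcx_axioms f.D.zcx_axioms)
      (simp_all add: restrict_lin f.lin)
qed

lemma restrict_ses:
  assumes "ses (UP A) C D E i p"
  shows "ses A (restrict_cplx A C) (restrict_cplx A D) (restrict_cplx A E) i p"
proof -
  interpret ses "UP A" C D E i p by fact
  show ?thesis
    by (intro ses.intro ses_axioms.intro restrict_zmap i.zmap_axioms p.zmap_axioms)
      (simp_all add: inj surj ker)
qed

end

section \<open>Attaching a complex along a map to the mapping cone\<close>

lemma (in zmap) hsurj_if_acyclic: "acyclic_at D k \<Longrightarrow> hsurj C D f k"
  unfolding hsurj_def
proof
  fix y assume "acyclic_at D k" and y: "y \<in> cyc D k"
  then obtain z where "z \<in> carrier (ob D (k + 1))" "y = dif D (k + 1) z"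
    unfolding acyclic_at_def boundaries_def by blast
  then show "\<exists>x\<in>cyc C k. \<exists>z\<in>carrier (ob D (k + 1)). y = dif D (k + 1) z \<oplus>\<^bsub>ob D k\<^esub> f k x"
    by (intro bexI[of _ "\<zero>\<^bsub>ob C k\<^esub>"] bexI[of _ z]) (simp_all add: cyc_def)
qed

lemma hinj_if_acyclic: "acyclic_at C k \<Longrightarrow> hinj C D f k"
  by (auto simp: hinj_def acyclic_at_def)

text \<open>
  A chain map from \<open>K\<close> to the cone of \<open>g : W \<rightarrow> Y\<close> is the same as a map attaching \<open>K\<close> to \<open>W\<close>
  together with an extension of \<open>g\<close> to the larger complex, and the cone of the extension is the
  cone of the given chain map.
\<close>

locale attaching = g: zmap R W Y g + th: zmap R K "cone W Y g" th
  for R :: "('r, 'k) ring_scheme" and W :: "('r, 'w) cplx" and Y :: "('r, 'y) cplx" and g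
    and K :: "('r, 'e) cplx" and th
begin

definition tau :: "int \<Rightarrow> 'e \<Rightarrow> 'w" where "tau k x = \<ominus>\<^bsub>ob W (k - 1)\<^esub> fst (th k x)"

definition ext :: "int \<Rightarrow> 'e \<times> 'w \<Rightarrow> 'y" where
  "ext k = (\<lambda>z. snd (th k (fst z)) \<oplus>\<^bsub>ob Y k\<^esub> g k (snd z))"

lemma th_lin: "th k \<in> lin_maps R (ob K k) (dsum_module (ob W (k - 1)) (ob Y k))"
  using th.lin[of k] by simp

lemma th_pair:
  assumes "x \<in> carrier (ob K k)"
  obtains a b where "th k x = (a, b)" "a \<in> carrier (ob W (k - 1))" "b \<in> carrier (ob Y k)"
  using lin_maps_closed[OF th_lin assms] by (cases "th k x") auto

lemma th_d:
  assumes "x \<in> carrier (ob K k)" "th k x = (a, b)"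
  shows "th (k - 1) (dif K k x) = (\<ominus>\<^bsub>ob W (k - 2)\<^esub> dif W (k - 1) a, g (k - 1) a \<oplus>\<^bsub>ob Y (k - 1)\<^esub> dif Y k b)"
  using th.comm[OF assms(1)] assms(2) by simp

sublocale twisted R K W tau
proof (intro twisted.intro twisted_axioms.intro th.C.zcx_axioms g.C.zcx_axioms)
  show "tau k \<in> lin_maps R (ob K k) (ob W (k - 1))" for k
    unfolding tau_def[abs_def] by (intro lin_maps_neg g.C.mod lin_maps_comp[OF th_lin fst_lin])
  fix k e assume e: "e \<in> carrier (ob K k)"
  obtain a b where "th k e = (a, b)" "a \<in> carrier (ob W (k - 1))" "b \<in> carrier (ob Y k)"
    using th_pair[OF e] .
  then show "tau (k - 1) (dif K k e) \<oplus>\<^bsub>ob W (k - 2)\<^esub> dif W (k - 1) (tau k e) = \<zero>\<^bsub>ob W (k - 2)\<^esub>"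
    using th_d[OF e] by (simp add: tau_def g.C.M.M.r_neg)
qed

lemma zmap_ext: "zmap R (tw K W tau) Y ext"
proof (intro zmap.intro zmap_axioms.intro zcx_tw g.D.zcx_axioms)
  show "ext k \<in> lin_maps R (ob (tw K W tau) k) (ob Y k)" for k
    unfolding ext_def tw_sel
    by (intro lin_maps_plus g.D.mod lin_maps_comp[OF fst_lin lin_maps_comp[OF th_lin snd_lin]]
        lin_maps_comp[OF snd_lin g.lin])
  fix k z assume "z \<in> carrier (ob (tw K W tau) k)"
  then obtain e w where z: "z = (e, w)" "e \<in> carrier (ob K k)" "w \<in> carrier (ob W k)" by auto
  obtain a b where "th k e = (a, b)" "a \<in> carrier (ob W (k - 1))" "b \<in> carrier (ob Y k)"
    using th_pair[OF z(2)] .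
  then show "ext (k - 1) (dif (tw K W tau) k z) = dif Y k (ext k z)"
    using z th_d[OF z(2)] by (simp add: ext_def tau_def g.D.M.M.grp)
qed

lemma ext_incl: "w \<in> carrier (ob W k) \<Longrightarrow> ext k (\<zero>\<^bsub>ob K k\<^esub>, w) = g k w"
  using th.f_zero[of k] by (simp add: ext_def)

lemma cone_ext_acyclic:
  assumes e: "zmap R (tw K W tau) Z e"
    and bij: "\<And>k. bij_betw (e k) (carrier (ob (tw K W tau) k)) (carrier (ob Z k))"
    and h: "zmap R Z Y h" and he: "\<And>k z. z \<in> carrier (ob (tw K W tau) k) \<Longrightarrow> h k (e k z) = ext k z"
  shows "acyclic_at (cone Z Y h) k \<longleftrightarrow> acyclic_at (cone K (cone W Y g) th) k"
proof -
  interpret e: zmap R "tw K W tau" Z e by (rule e)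
  interpret h: zmap R Z Y h by (rule h)
  define F where "F k = (\<lambda>(x, w, y :: 'y). (e (k - 1) (x, w), y))" for k
  have edsum: "e k (x, w) \<in> carrier (ob Z k)" if "x \<in> carrier (ob K k)" "w \<in> carrier (ob W k)" for k x w
    using that by (intro e.f_closed) simp
  have zF: "zmap R (cone K (cone W Y g) th) (cone Z Y h) F"
  proof (intro zmap.intro zmap_axioms.intro th.zcx_cone h.zcx_cone)
    fix k
    show "F k \<in> lin_maps R (ob (cone K (cone W Y g) th) k) (ob (cone Z Y h) k)"
    proof (rule lin_mapsI)
      fix u assume "u \<in> carrier (ob (cone K (cone W Y g) th) k)"
      then obtain x w y where u: "u = (x, w, y)" "x \<in> carrier (ob K (k - 1))" "w \<in> carrier (ob W (k - 1))"
        "y \<in> carrier (ob Y k)" by auto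
      then show "F k u \<in> carrier (ob (cone Z Y h) k)" using edsum[of x "k - 1" w] by (simp add: F_def)
      {
        fix v assume "v \<in> carrier (ob (cone K (cone W Y g) th) k)"
        then obtain x' w' y' where v: "v = (x', w', y')" "x' \<in> carrier (ob K (k - 1))"
          "w' \<in> carrier (ob W (k - 1))" "y' \<in> carrier (ob Y k)" by auto
        show "F k (u \<oplus>\<^bsub>ob (cone K (cone W Y g) th) k\<^esub> v) = F k u \<oplus>\<^bsub>ob (cone Z Y h) k\<^esub> F k v"
          using u v e.f_add[of "(x, w)" "k - 1" "(x', w')"] by (simp add: F_def)
      }
      fix a assume a: "a \<in> carrier R"
      then show "F k (a \<odot>\<^bsub>ob (cone K (cone W Y g) th) k\<^esub> u) = a \<odot>\<^bsub>ob (cone Z Y h) k\<^esub> F k u"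
        using u e.f_smult[OF a, of "(x, w)" "k - 1"] by (simp add: F_def)
    qed
    fix u assume "u \<in> carrier (ob (cone K (cone W Y g) th) k)"
    then obtain x w y where u: "u = (x, w, y)" "x \<in> carrier (ob K (k - 1))" "w \<in> carrier (ob W (k - 1))"
      "y \<in> carrier (ob Y k)" by auto
    obtain a b where ab: "th (k - 1) x = (a, b)" "a \<in> carrier (ob W (k - 2))" "b \<in> carrier (ob Y (k - 1))"
      using th_pair[OF u(2)] by auto
    have "e (k - 2) (\<ominus>\<^bsub>dsum_module (ob K (k - 2)) (ob W (k - 2))\<^esub>
        (dif K (k - 1) x, tau (k - 1) x \<oplus>\<^bsub>ob W (k - 2)\<^esub> dif W (k - 1) w))
      = \<ominus>\<^bsub>ob Z (k - 2)\<^esub> e (k - 2) (dif K (k - 1) x, tau (k - 1) x \<oplus>\<^bsub>ob W (k - 2)\<^esub> dif W (k - 1) w)"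
      using e.f_minus[of "(dif K (k - 1) x, tau (k - 1) x \<oplus>\<^bsub>ob W (k - 2)\<^esub> dif W (k - 1) w)" "k - 2"] u
      by simp
    moreover have "\<ominus>\<^bsub>dsum_module (ob K (k - 2)) (ob W (k - 2))\<^esub>
        (dif K (k - 1) x, tau (k - 1) x \<oplus>\<^bsub>ob W (k - 2)\<^esub> dif W (k - 1) w)
      = (\<ominus>\<^bsub>ob K (k - 2)\<^esub> dif K (k - 1) x, a \<oplus>\<^bsub>ob W (k - 2)\<^esub> \<ominus>\<^bsub>ob W (k - 2)\<^esub> dif W (k - 1) w)"
      using u ab by (subst dsum_minus[OF th.C.mod g.C.mod]) (simp_all add: tau_def g.C.M.M.grp)
    moreover have "dif Z (k - 1) (e (k - 1) (x, w))
        = e (k - 2) (dif K (k - 1) x, tau (k - 1) x \<oplus>\<^bsub>ob W (k - 2)\<^esub> dif W (k - 1) w)"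
      using e.comm[of "(x, w)" "k - 1"] u by simp
    moreover have "h (k - 1) (e (k - 1) (x, w)) = b \<oplus>\<^bsub>ob Y (k - 1)\<^esub> g (k - 1) w"
      using he[of "(x, w)" "k - 1"] u ab by (simp add: ext_def)
    ultimately show "F (k - 1) (dif (cone K (cone W Y g) th) k u) = dif (cone Z Y h) k (F k u)"
      using u ab by (simp add: F_def g.D.M.M.a_assoc)
  qed
  have "bij_betw (F k) (carrier (ob (cone K (cone W Y g) th) k)) (carrier (ob (cone Z Y h) k))" for k
  proof -
    have inj: "x = x' \<and> w = w'"
      if "e (k - 1) (x, w) = e (k - 1) (x', w')" "x \<in> carrier (ob K (k - 1))" "w \<in> carrier (ob W (k - 1))"
        "x' \<in> carrier (ob K (k - 1))" "w' \<in> carrier (ob W (k - 1))" for x w x' w'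
      using bij[of "k - 1"] that by (auto simp: bij_betw_def dest!: inj_onD)
    show ?thesis
    proof (intro bij_betw_imageI inj_onI equalityI subsetI)
      fix u v assume "u \<in> carrier (ob (cone K (cone W Y g) th) k)" "v \<in> carrier (ob (cone K (cone W Y g) th) k)"
        "F k u = F k v"
      then show "u = v" by (auto simp: F_def dest!: inj)
    next
      fix v assume "v \<in> F k ` carrier (ob (cone K (cone W Y g) th) k)"
      then show "v \<in> carrier (ob (cone Z Y h) k)" using lin_maps_closed[OF zmap.lin[OF zF]] by blast
    next
      fix v assume "v \<in> carrier (ob (cone Z Y h) k)"
      then obtain z y where v: "v = (z, y)" "z \<in> carrier (ob Z (k - 1))" "y \<in> carrier (ob Y k)" by auto
      have "z \<in> e (k - 1) ` (carrier (ob K (k - 1)) \<times> carrier (ob W (k - 1)))"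
        using bij[of "k - 1"] v(2) by (simp add: bij_betw_def)
      then obtain x w where "z = e (k - 1) (x, w)" "x \<in> carrier (ob K (k - 1))" "w \<in> carrier (ob W (k - 1))"
        by blast
      with v show "v \<in> F k ` carrier (ob (cone K (cone W Y g) th) k)"
        by (intro image_eqI[of _ _ "(x, w, y)"]) (simp_all add: F_def)
    qed
  qed
  then show ?thesis using zmap.qi_acyclic[OF zF zmap.qi_if_bij[OF zF]] by simp
qed

end

lemma ses_iso:
  assumes "ses R C D E i p" and e: "zmap R D D' e"
    and bij: "\<And>k. bij_betw (e k) (carrier (ob D k)) (carrier (ob D' k))"
  shows "ses R C D' E (\<lambda>k x. e k (i k x)) (\<lambda>k y. p k (inv_into (carrier (ob D k)) (e k) y))"
proof -
  interpret ses R C D E i p by fact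
  interpret e: zmap R D D' e by fact
  have inv [simp]: "inv_into (carrier (ob D k)) (e k) (e k x) = x" if "x \<in> carrier (ob D k)" for k x
    using bij[of k] that by (auto simp: bij_betw_def)
  have surj': "\<exists>x\<in>carrier (ob D k). y = e k x" if "y \<in> carrier (ob D' k)" for k y
    using bij[of k] that by (auto simp: bij_betw_def)
  show ?thesis
  proof (intro ses.intro ses_axioms.intro zmap_comp[OF i.zmap_axioms e] zmap_comp[OF zmap_inv[OF e bij] p.zmap_axioms],
      goal_cases)
    case (1 k)
    have "inj_on (e k) (carrier (ob D k))" using bij[of k] by (simp add: bij_betw_def)
    then show ?case using inj[of k] by (auto simp: inj_on_def)
  next
    case (2 x k)
    then obtain y where "y \<in> carrier (ob D k)" "p k y = x" using surj by blast
    then show ?case by (intro bexI[of _ "e k y"]) simp_all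
  next
    case (3 c k) then show ?case by simp
  next
    case (4 y k)
    then obtain x where x: "x \<in> carrier (ob D k)" "y = e k x" using surj' by blast
    with 4 have "p k x = \<zero>\<^bsub>ob E k\<^esub>" by simp
    then show ?case using ker[OF x(1)] x(2) by auto
  qed
qed

section \<open>The elementary complex of a module\<close>

context poly_base
begin

text \<open>
  The complex \<open>M[t] \<rightarrow> M[t]\<close> in degrees \<open>q + 1\<close> and \<open>q\<close>, whose homology is \<open>M\<close> in degree \<open>q\<close>.  The other terms
  are zero submodules of \<open>M[t]\<close>, since all terms of a complex share one type of elements.
\<close>

definition resolution :: "(nat \<Rightarrow> 'a, 'm) module \<Rightarrow> int \<Rightarrow> (nat \<Rightarrow> 'a, nat \<Rightarrow> 'm) cplx" where
  "resolution M q = \<lparr>ob = (\<lambda>k. (poly_module M)\<lparr>carrier := if k = q \<or> k = q + 1 then carrier (poly_module M)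
      else {\<zero>\<^bsub>poly_module M\<^esub>}\<rparr>),
     dif = (\<lambda>k. if k = q + 1 then char_map M else (\<lambda>c. \<zero>\<^bsub>poly_module M\<^esub>))\<rparr>"

lemma resolution_sel [simp]:
  "carrier (ob (resolution M q) k) = (if k = q \<or> k = q + 1 then carrier (poly_module M) else {\<zero>\<^bsub>poly_module M\<^esub>})"
  "zero (ob (resolution M q) k) = zero (poly_module M)"
  "add (ob (resolution M q) k) = add (poly_module M)"
  "smult (ob (resolution M q) k) = smult (poly_module M)"
  "dif (resolution M q) k = (if k = q + 1 then char_map M else (\<lambda>c. \<zero>\<^bsub>poly_module M\<^esub>))"
  by (simp_all add: resolution_def)

lemma resolution_ob: "k = q \<or> k = q + 1 \<Longrightarrow> ob (resolution M q) k = poly_module M"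
  by (simp add: resolution_def)

context
  fixes M :: "(nat \<Rightarrow> 'a, 'm) module" and q :: int
  assumes M: "right_module (UP A) M"
begin

interpretation M: right_module "UP A" M by (rule M)
interpretation PM: right_module "UP A" "poly_module M" by (rule right_module_poly[OF M])

lemma char_map_zero: "char_map M \<zero>\<^bsub>poly_module M\<^esub> = \<zero>\<^bsub>poly_module M\<^esub>"
  by (rule lin_maps_zero[OF char_map_lin[OF M] PM.abelian_group_axioms PM.abelian_group_axioms])

lemma zcx_resolution: "zcx (UP A) (resolution M q)"
proof (rule zcx.intro, goal_cases)
  case (1 k)
  have "submodule (UP A) (poly_module M) (if k = q \<or> k = q + 1 then carrier (poly_module M) else {\<zero>\<^bsub>poly_module M\<^esub>})"
    by (simp add: submodule_def PM.modsimps del: poly_sel[OF M])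
  then show ?case
    using right_module_submodule[OF PM.right_module_axioms] by (simp add: resolution_def)
next
  case (2 k)
  note cm = char_map_lin[OF M]
  show ?case
  proof (cases "k = q + 1")
    case True
    then show ?thesis using cm by (simp add: resolution_ob)
  next
    case False
    then show ?thesis
      by (intro lin_mapsI) (simp_all add: PM.modsimps)
  qed
next
  case (3 c k)
  then show ?case by (auto simp: char_map_zero)
qed

interpretation K: zcx "UP A" "resolution M q" by (rule zcx_resolution)

lemma resolution_cyc: "cyc (resolution M q) q = carrier (poly_module M)"
  by (auto simp: cyc_def)

lemma resolution_boundary_iff:
  assumes c: "c \<in> carrier (poly_module M)"
  shows "c \<in> boundaries (resolution M q) q \<longleftrightarrow> eval_t M c = \<zero>\<^bsub>M\<^esub>"
proof
  assume "c \<in> boundaries (resolution M q) q"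
  then obtain e where "e \<in> carrier (poly_module M)" "c = char_map M e" by (auto simp: boundaries_def)
  then show "eval_t M c = \<zero>\<^bsub>M\<^esub>" using eval_char[OF M] by simp
next
  assume ev: "eval_t M c = \<zero>\<^bsub>M\<^esub>"
  obtain e where e: "e \<in> carrier (poly_module M)" "c = poly_const M (eval_t M c) \<oplus>\<^bsub>poly_module M\<^esub> char_map M e"
    using poly_decomp[OF M c] by blast
  have "poly_const M \<zero>\<^bsub>M\<^esub> = \<zero>\<^bsub>poly_module M\<^esub>"
    by (auto simp: poly_const_def poly_sel[OF M] fun_eq_iff split: nat.splits)
  then have "c = char_map M e"
    using e(2) PM.M.l_zero[OF lin_maps_closed[OF char_map_lin[OF M] e(1)]] by (simp only: ev)
  with e(1) show "c \<in> boundaries (resolution M q) q" by (auto simp: boundaries_def)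
qed

lemma resolution_acyclic:
  assumes "k \<noteq> q"
  shows "acyclic_at (resolution M q) k"
  unfolding acyclic_at_def
proof
  fix c assume "c \<in> cyc (resolution M q) k"
  then have "c = \<zero>\<^bsub>poly_module M\<^esub>"
    using assms char_map_inj[OF M, of c] by (auto simp: cyc_def split: if_splits)
  then show "c \<in> boundaries (resolution M q) k"
    using K.submodule_boundaries[of k] by (simp add: submodule_def)
qed

lemma resolution_homology:
  "(\<lambda>x. cls (resolution M q) q (poly_const M x)) \<in> lin_maps A (restrict_module A M) (restrict_module A (homology (resolution M q) q))"
  "bij_betw (\<lambda>x. cls (resolution M q) q (poly_const M x)) (carrier M) (carrier (homology (resolution M q) q))"
proof -
  have "cycles_module (resolution M q) q = poly_module M"
    by (simp add: cycles_module_eq resolution_cyc resolution_ob)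
  then have "cls (resolution M q) q \<in> lin_maps (UP A) (poly_module M) (homology (resolution M q) q)"
    using K.cls_lin[of q] by simp
  from lin_maps_comp[OF poly_const_lin[OF M] restrict_lin[OF this]]
  show "(\<lambda>x. cls (resolution M q) q (poly_const M x)) \<in> lin_maps A (restrict_module A M) (restrict_module A (homology (resolution M q) q))" .
  note pc = poly_const_closed[OF M] and ev = lin_maps_closed[OF eval_lin[OF M]]
  note cm = lin_maps_closed[OF char_map_lin[OF M]]
  have eq: "cls (resolution M q) q c = cls (resolution M q) q d \<longleftrightarrow>
      (\<exists>e\<in>carrier (poly_module M). c = char_map M e \<oplus>\<^bsub>poly_module M\<^esub> d)"
    if "c \<in> carrier (poly_module M)" "d \<in> carrier (poly_module M)" for c d
    using K.cls_eq_iff[of c q d] that by (simp add: resolution_cyc)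
  show "bij_betw (\<lambda>x. cls (resolution M q) q (poly_const M x)) (carrier M) (carrier (homology (resolution M q) q))"
  proof (intro bij_betw_imageI inj_onI equalityI subsetI)
    fix x y assume x: "x \<in> carrier M" and y: "y \<in> carrier M"
      and "cls (resolution M q) q (poly_const M x) = cls (resolution M q) q (poly_const M y)"
    then obtain e where e: "e \<in> carrier (poly_module M)"
      "poly_const M x = char_map M e \<oplus>\<^bsub>poly_module M\<^esub> poly_const M y"
      using eq[OF pc[OF x] pc[OF y]] by blast
    have "eval_t M (poly_const M x) = eval_t M (char_map M e) \<oplus>\<^bsub>M\<^esub> eval_t M (poly_const M y)"
      unfolding e(2) by (rule lin_maps_add[OF eval_lin[OF M] cm[OF e(1)] pc[OF y]])
    then show "x = y" using x y e(1) by (simp add: eval_const[OF M] eval_char[OF M])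
  next
    fix K assume "K \<in> (\<lambda>x. cls (resolution M q) q (poly_const M x)) ` carrier M"
    then show "K \<in> carrier (homology (resolution M q) q)"
      using pc by (auto simp: K.homology_carrier resolution_cyc)
  next
    fix K assume "K \<in> carrier (homology (resolution M q) q)"
    then obtain c where c: "c \<in> carrier (poly_module M)" "K = cls (resolution M q) q c"
      by (auto simp: K.homology_carrier resolution_cyc)
    obtain e where e: "e \<in> carrier (poly_module M)" "c = poly_const M (eval_t M c) \<oplus>\<^bsub>poly_module M\<^esub> char_map M e"
      using poly_decomp[OF M c(1)] by blast
    have "c = char_map M e \<oplus>\<^bsub>poly_module M\<^esub> poly_const M (eval_t M c)"
      using e(2) PM.M.a_comm[OF cm[OF e(1)] pc[OF ev[OF c(1)]]] by simp
    then have "cls (resolution M q) q c = cls (resolution M q) q (poly_const M (eval_t M c))"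
      using eq[OF c(1) pc[OF ev[OF c(1)]]] e(1) by blast
    then show "K \<in> (\<lambda>x. cls (resolution M q) q (poly_const M x)) ` carrier M"
      using c(2) ev[OF c(1)] by blast
  qed
qed

lemma resolution_torsion:
  assumes "a \<in> carrier (UP A)" "\<And>x. x \<in> carrier M \<Longrightarrow> a \<odot>\<^bsub>M\<^esub> x = \<zero>\<^bsub>M\<^esub>"
    and c: "c \<in> cyc (resolution M q) k"
  shows "a \<odot>\<^bsub>ob (resolution M q) k\<^esub> c \<in> boundaries (resolution M q) k"
proof (cases "k = q")
  case True
  then have cP: "c \<in> carrier (poly_module M)" using c by (simp add: resolution_cyc)
  have "eval_t M (a \<odot>\<^bsub>poly_module M\<^esub> c) = \<zero>\<^bsub>M\<^esub>"
    using assms(2)[OF lin_maps_closed[OF eval_lin[OF M] cP]] lin_maps_smult[OF eval_lin[OF M] assms(1) cP] by simp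
  then show ?thesis using True resolution_boundary_iff[OF PM.smult_closed[OF assms(1) cP]] by simp
next
  case False
  have "a \<odot>\<^bsub>ob (resolution M q) k\<^esub> c \<in> cyc (resolution M q) k"
    using K.submodule_cyc[of k] assms(1) c unfolding submodule_def by blast
  then show ?thesis using resolution_acyclic[OF False] by (auto simp: acyclic_at_def)
qed

end

end

lemma torsion_module_iso:
  assumes "f \<in> lin_maps R M N" "bij_betw f (carrier M) (carrier N)" "abelian_group M" "abelian_group N"
    and "S \<subseteq> carrier R" "torsion_module S M"
  shows "torsion_module S N"
proof -
  obtain a where a: "a \<in> S" "\<And>x. x \<in> carrier M \<Longrightarrow> a \<odot>\<^bsub>M\<^esub> x = \<zero>\<^bsub>M\<^esub>"
    using assms(6) by (auto simp: torsion_module_def)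
  have "a \<odot>\<^bsub>N\<^esub> y = \<zero>\<^bsub>N\<^esub>" if "y \<in> carrier N" for y
  proof -
    have "y \<in> f ` carrier M" using assms(2) that by (simp add: bij_betw_def)
    then obtain x where "x \<in> carrier M" "y = f x" by blast
    then show ?thesis
      using a assms(5) lin_maps_smult[OF assms(1), of a x] lin_maps_zero[OF assms(1,3,4)] by auto
  qed
  with a(1) show ?thesis by (auto simp: torsion_module_def)
qed

context poly_base
begin

lemma resolution_trivial:
  assumes "right_module (UP A) M" "k < 0" "q < 0 \<Longrightarrow> trivial_module M"
  shows "trivial_module (ob (resolution M q) k)"
proof (cases "k = q \<or> k = q + 1")
  case True
  then have "trivial_module M" using assms(2,3) by auto
  then have "c = (\<lambda>i. \<zero>\<^bsub>M\<^esub>)" if "c \<in> carrier (poly_module M)" for c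
    using that by (auto simp: poly_sel[OF assms(1)] trivial_module_def)
  moreover interpret PM: right_module "UP A" "poly_module M" by (rule right_module_poly[OF assms(1)])
  have "(\<lambda>i. \<zero>\<^bsub>M\<^esub>) \<in> carrier (poly_module M)" using PM.M.zero_closed by (simp only: poly_sel(2)[OF assms(1)])
  ultimately have "carrier (poly_module M) = {\<lambda>i. \<zero>\<^bsub>M\<^esub>}" by blast
  then show ?thesis using True
    by (simp add: trivial_module_def resolution_ob poly_sel(2)[OF assms(1)] del: resolution_sel(1))
qed (simp add: trivial_module_def)

text \<open>
  The chain map from the elementary complex of \<open>M\<close> that realises a given map from \<open>M\<close> to the homology:
  representing cycles and the chains that measure their failure to be compatible with \<open>t\<close> can be
  chosen linearly over \<open>A\<close>, as \<open>M\<close> is projective over \<open>A\<close>, and extend to polynomials.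
\<close>

lemma resolution_map:
  assumes "zcx (UP A) D" and M: "right_module (UP A) M" and fr: "finite_retract A (restrict_module A M)"
    and lam: "lam \<in> lin_maps (UP A) M (homology D q)"
  obtains th where "zmap (UP A) (resolution M q) D th"
    and "\<And>x. x \<in> carrier M \<Longrightarrow> th q (poly_const M x) \<in> cyc D q \<and> cls D q (th q (poly_const M x)) = lam x"
proof -
  interpret D: zcx "UP A" D by fact
  interpret M: right_module "UP A" M by fact
  interpret PM: right_module "UP A" "poly_module M" by (rule right_module_poly[OF M])
  note rM = right_module_restrict[OF M] and rD = right_module_restrict[OF D.mod]
  have t: "tvar \<in> carrier (UP A)" by simp
  have "\<exists>y\<in>carrier (restrict_module A (cycles_module D q)). cls D q y = lam x"
    if "x \<in> carrier (restrict_module A M)" for x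
  proof -
    have "lam x \<in> carrier (homology D q)" using that lin_maps_closed[OF lam] by simp
    then show ?thesis by (auto simp: D.homology_carrier cycles_module_eq)
  qed
  then obtain s where s: "s \<in> lin_maps A (restrict_module A M) (restrict_module A (cycles_module D q))"
    and cs: "\<And>x. x \<in> carrier (restrict_module A M) \<Longrightarrow> cls D q (s x) = lam x"
    using finite_retract_lift[OF fr rM right_module_restrict[OF D.right_module_homology]
        right_module_restrict[OF D.right_module_cycles] restrict_lin[OF lam] restrict_lin[OF D.cls_lin]] by blast
  have scyc: "s x \<in> cyc D q" if "x \<in> carrier M" for x
    using lin_maps_closed[OF s, of x] that by (simp add: cycles_module_eq)
  have scl: "s x \<in> carrier (ob D q)" if "x \<in> carrier M" for x using scyc[OF that] by (rule D.cycD)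
  have sl: "s \<in> lin_maps A (restrict_module A M) (restrict_module A (ob D q))"
    using s scl by (auto simp: lin_maps_def cycles_module_eq)
  let ?f = "\<lambda>x. s (tvar \<odot>\<^bsub>M\<^esub> x) \<oplus>\<^bsub>ob D q\<^esub> \<ominus>\<^bsub>ob D q\<^esub> (tvar \<odot>\<^bsub>ob D q\<^esub> s x)"
  have fl: "?f \<in> lin_maps A (restrict_module A M) (restrict_module A (ob D q))"
    using lin_maps_plus[OF rD lin_maps_comp[OF restrict_lin[OF t_lin[OF M]] sl]
        lin_maps_neg[OF rD lin_maps_comp[OF sl restrict_lin[OF t_lin[OF D.mod]]]]]
    by simp
  have dl: "dif D (q + 1) \<in> lin_maps A (restrict_module A (ob D (q + 1))) (restrict_module A (ob D q))"
    using restrict_lin[OF D.d_lin[of "q + 1"]] by simp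
  have "\<exists>y\<in>carrier (restrict_module A (ob D (q + 1))). dif D (q + 1) y = ?f x"
    if "x \<in> carrier (restrict_module A M)" for x
  proof -
    have x: "x \<in> carrier M" using that by simp
    note tx = M.smult_closed[OF t x]
    have ts: "tvar \<odot>\<^bsub>ob D q\<^esub> s x \<in> cyc D q"
      using D.submodule_cyc[of q] scyc[OF x] t by (simp add: submodule_def)
    have "cls D q (s (tvar \<odot>\<^bsub>M\<^esub> x)) = tvar \<odot>\<^bsub>homology D q\<^esub> lam x"
      using cs tx lin_maps_smult[OF lam t x] by simp
    also have "\<dots> = cls D q (tvar \<odot>\<^bsub>ob D q\<^esub> s x)"
      using cs x by (simp only: D.cls_smult[OF t scyc[OF x]] restrict_module_sel)
    finally obtain z where "z \<in> carrier (ob D (q + 1))" "s (tvar \<odot>\<^bsub>M\<^esub> x) = dif D (q + 1) z \<oplus>\<^bsub>ob D q\<^esub> tvar \<odot>\<^bsub>ob D q\<^esub> s x"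
      using D.cls_eq_iff[OF scyc[OF tx] ts] by blast
    then show ?thesis using D.cycD(1)[OF ts] by (intro bexI[of _ z]) (simp_all add: D.M.M.grp)
  qed
  then obtain r where r: "r \<in> lin_maps A (restrict_module A M) (restrict_module A (ob D (q + 1)))"
    and dr: "\<And>x. x \<in> carrier (restrict_module A M) \<Longrightarrow> dif D (q + 1) (r x) = ?f x"
    using finite_retract_lift[OF fr rM rD rD fl dl] by blast
  define th where "th k = (if k = q then poly_ext M (ob D q) s
    else if k = q + 1 then poly_ext M (ob D (q + 1)) r else (\<lambda>c. \<zero>\<^bsub>ob D k\<^esub>))" for k
  note es = poly_ext_lin[OF M D.mod sl] and er = poly_ext_lin[OF M D.mod r]
  note esc = poly_ext_const[OF M D.mod sl] and erc = poly_ext_const[OF M D.mod r]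
  let ?K = "resolution M q"
  interpret K: zcx "UP A" ?K by (rule zcx_resolution[OF M])
  have thl: "th k \<in> lin_maps (UP A) (ob ?K k) (ob D k)" for k
  proof -
    consider "k = q" | "k = q + 1" | "k \<noteq> q" "k \<noteq> q + 1" by auto
    then show ?thesis
      by cases (use es er in \<open>simp_all add: th_def resolution_ob lin_maps_zero_map D.mod\<close>)
  qed
  have th0: "th k \<zero>\<^bsub>poly_module M\<^esub> = \<zero>\<^bsub>ob D k\<^esub>" for k
    using lin_maps_zero[OF thl K.M.M.abelian_group_axioms D.M.M.abelian_group_axioms] by simp
  have "zmap (UP A) ?K D th"
  proof (intro zmap.intro zmap_axioms.intro K.zcx_axioms D.zcx_axioms thl)
    fix k c assume c: "c \<in> carrier (ob ?K k)"
    consider "k = q" | "k = q + 1" | "k \<noteq> q" "k \<noteq> q + 1" by auto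
    then show "th (k - 1) (dif ?K k c) = dif D k (th k c)"
    proof cases
      case 1
      have cP: "c \<in> carrier (poly_module M)" using c 1 by simp
      have "dif D q (poly_ext M (ob D q) s c) = \<zero>\<^bsub>ob D (q - 1)\<^esub>"
        by (rule poly_eqI[OF M D.mod lin_maps_comp[OF es D.d_lin] lin_maps_zero_map[OF D.mod] _ cP])
          (simp add: esc D.cycD[OF scyc])
      then show ?thesis using 1 th0[of "q - 1"] by (simp add: th_def)
    next
      case 2
      have cP: "c \<in> carrier (poly_module M)" using c 2 by simp
      have dl': "dif D (q + 1) \<in> lin_maps (UP A) (ob D (q + 1)) (ob D q)" using D.d_lin[of "q + 1"] by simp
      have "poly_ext M (ob D q) s (char_map M c) = dif D (q + 1) (poly_ext M (ob D (q + 1)) r c)"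
        by (rule poly_ext_char[OF M D.mod sl lin_maps_comp[OF er dl'] _ cP]) (simp add: erc dr)
      then show ?thesis using 2 by (simp add: th_def)
    next
      case 3
      then show ?thesis using c th0 by (simp add: D.d_zero)
    qed
  qed
  moreover have "th q (poly_const M x) \<in> cyc D q \<and> cls D q (th q (poly_const M x)) = lam x" if "x \<in> carrier M" for x
    using that scyc cs by (simp add: th_def esc)
  ultimately show thesis by (rule that)
qed

text \<open>
  With \<open>K\<close> the resolution of \<open>M\<close>, the cone of the new map to \<open>Y\<close> is the cone of \<open>K \<rightarrow> cone W Y g\<close>.  The
  latter map is onto on homology up to degree \<open>q\<close>, and injective below \<open>q\<close> because \<open>K\<close> has homology in
  degree \<open>q\<close> only.  The map \<open>enc\<close> only places the new complex in the intended type.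
\<close>

lemma attach_module:
  fixes W :: "(nat \<Rightarrow> 'a, 'w) cplx" and Y :: "(nat \<Rightarrow> 'a, 'y) cplx" and M :: "(nat \<Rightarrow> 'a, 'h) module"
    and enc :: "(nat \<Rightarrow> 'h) \<times> 'w \<Rightarrow> 'z"
  assumes S: "submonoid S (UP A)"
    and W: "chain_complex (UP A) W" and Y: "chain_complex (UP A) Y" and g: "zmap (UP A) W Y g"
    and tW: "torsion_cplx S W" and pW: "perf A N (restrict_cplx A W)" and qN: "q \<le> N"
    and M: "right_module (UP A) M" and fr: "finite_retract A (restrict_module A M)" and tM: "torsion_module S M"
    and lam: "lam \<in> lin_maps (UP A) M (homology (cone W Y g) q)"
    and surj: "lam ` carrier M = carrier (homology (cone W Y g) q)"
    and low: "\<And>k. k < q \<Longrightarrow> acyclic_at (cone W Y g) k"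
    and neg: "q < 0 \<Longrightarrow> trivial_module M"
    and enc: "\<And>k. inj_on enc (carrier (poly_module M) \<times> carrier (ob W k))"
  shows "\<exists>(Z :: (nat \<Rightarrow> 'a, 'z) cplx) i h. elementary_extension A S q W Z i \<and> chain_complex (UP A) Z \<and>
    zmap (UP A) Z Y h \<and> (\<forall>k. \<forall>x\<in>carrier (ob W k). h k (i k x) = g k x) \<and>
    torsion_cplx S Z \<and> perf A N (restrict_cplx A Z) \<and> (\<forall>k\<le>q. acyclic_at (cone Z Y h) k) \<and>
    (inj_on lam (carrier M) \<and> (\<forall>k>q. acyclic_at (cone W Y g) k) \<longrightarrow> (\<forall>k. acyclic_at (cone Z Y h) k))"
proof -
  interpret g: zmap "UP A" W Y g by fact
  define D where "D = cone W Y g"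
  interpret D: zcx "UP A" D unfolding D_def by (rule g.zcx_cone)
  interpret PM: right_module "UP A" "poly_module M" by (rule right_module_poly[OF M])
  have sub: "S \<subseteq> carrier (UP A)" using S by (rule submonoid.subset)
  let ?K = "resolution M q"
  interpret K: zcx "UP A" ?K by (rule zcx_resolution[OF M])
  obtain th where th: "zmap (UP A) ?K D th"
    and thc: "\<And>x. x \<in> carrier M \<Longrightarrow> th q (poly_const M x) \<in> cyc D q \<and> cls D q (th q (poly_const M x)) = lam x"
    using resolution_map[OF D.zcx_axioms M fr] lam unfolding D_def by blast
  interpret th: zmap "UP A" ?K D th by (rule th)
  interpret at: attaching "UP A" W Y g ?K th
    using th unfolding D_def by (intro attaching.intro g.zmap_axioms)
  note pc = poly_const_closed[OF M] and ev = lin_maps_closed[OF eval_lin[OF M]]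

  have hs: "hsurj ?K D th k" if "k \<le> q" for k
  proof (cases "k = q")
    case True
    show ?thesis unfolding hsurj_def True
    proof
      fix y assume y: "y \<in> cyc D q"
      then have "cls D q y \<in> lam ` carrier M" using D.cls_closed[OF y] surj by (simp only: D_def)
      then obtain x where x: "x \<in> carrier M" "cls D q y = lam x" by blast
      then obtain z where "z \<in> carrier (ob D (q + 1))" "y = dif D (q + 1) z \<oplus>\<^bsub>ob D q\<^esub> th q (poly_const M x)"
        using thc[OF x(1)] D.cls_eq_iff[OF y, of "th q (poly_const M x)"] by auto
      then show "\<exists>c\<in>cyc ?K q. \<exists>z\<in>carrier (ob D (q + 1)). y = dif D (q + 1) z \<oplus>\<^bsub>ob D q\<^esub> th q c"
        using pc[OF x(1)] by (auto simp: resolution_cyc[OF M])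
    qed
  next
    case False
    then show ?thesis using low[of k] that by (intro th.hsurj_if_acyclic) (simp add: D_def)
  qed
  have acy_low: "acyclic_at (cone ?K D th) k" if "k \<le> q" for k
    unfolding th.cone_acyclic_iff using hs[OF that] that
    by (auto intro!: hinj_if_acyclic resolution_acyclic[OF M])
  have acy_all: "acyclic_at (cone ?K D th) k"
    if inj: "inj_on lam (carrier M)" and high: "\<And>k. k > q \<Longrightarrow> acyclic_at (cone W Y g) k" for k
  proof -
    have "hsurj ?K D th k" for k
      using hs[of k] high[of k] th.hsurj_if_acyclic[of k] by (cases "k \<le> q") (auto simp: D_def)
    moreover have "hinj ?K D th q" unfolding hinj_def
    proof (intro ballI impI)
      fix c assume "c \<in> cyc ?K q" and thb: "th q c \<in> boundaries D q"
      then have c: "c \<in> carrier (poly_module M)" by (simp add: resolution_cyc[OF M])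
      define x where "x = eval_t M c"
      have x: "x \<in> carrier M" unfolding x_def by (rule ev[OF c])
      obtain e where e: "e \<in> carrier (poly_module M)" "c = poly_const M x \<oplus>\<^bsub>poly_module M\<^esub> char_map M e"
        using poly_decomp[OF M c] unfolding x_def by blast
      have ce: "char_map M e \<in> carrier (poly_module M)" by (rule lin_maps_closed[OF char_map_lin[OF M] e(1)])
      have "th q (char_map M e) = dif D (q + 1) (th (q + 1) e)" using th.comm[of e "q + 1"] e(1) by simp
      moreover have the: "th (q + 1) e \<in> carrier (ob D (q + 1))" using th.f_closed[of e "q + 1"] e(1) by simp
      ultimately have "th q c = th q (poly_const M x) \<oplus>\<^bsub>ob D q\<^esub> dif D (q + 1) (th (q + 1) e)"
        using th.f_add[of "poly_const M x" q "char_map M e"] pc[OF x] ce e(2) by simp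
      moreover have thx: "th q (poly_const M x) \<in> carrier (ob D q)" using thc[OF x] D.cycD by blast
      ultimately have "th q (poly_const M x) = th q c \<oplus>\<^bsub>ob D q\<^esub> dif D (q + 1) (\<ominus>\<^bsub>ob D (q + 1)\<^esub> th (q + 1) e)"
        using the by (simp add: D.M.M.grp)
      moreover have "dif D (q + 1) (\<ominus>\<^bsub>ob D (q + 1)\<^esub> th (q + 1) e) \<in> boundaries D q"
        unfolding boundaries_def using D.M.M.a_inv_closed[OF the] by (rule imageI)
      ultimately have "th q (poly_const M x) \<in> boundaries D q"
        using D.submodule_boundaries[of q] thb by (simp add: submodule_def)
      then have "lam x = \<zero>\<^bsub>homology D q\<^esub>" using thc[OF x] D.cls_zero_iff by metis
      moreover have "lam \<zero>\<^bsub>M\<^esub> = \<zero>\<^bsub>homology D q\<^esub>"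
        using lin_maps_zero[OF lam right_module_group[OF M]] right_module_group[OF D.right_module_homology]
        by (simp add: D_def)
      moreover have "\<zero>\<^bsub>M\<^esub> \<in> carrier M" using right_module_group[OF M]
        by (simp add: abelian_group_def abelian_monoid.zero_closed)
      ultimately have "x = \<zero>\<^bsub>M\<^esub>" using inj_onD[OF inj, of x "\<zero>\<^bsub>M\<^esub>"] x by simp
      then show "c \<in> boundaries ?K q" using resolution_boundary_iff[OF M c] by (simp add: x_def)
    qed
    then have "hinj ?K D th k" for k
      using hinj_if_acyclic[OF resolution_acyclic[OF M]] by (cases "k = q") auto
    ultimately show ?thesis unfolding th.cone_acyclic_iff by blast
  qed

  define T where "T = tw ?K W at.tau"
  define Z where "Z = img_cplx (\<lambda>k. enc) T"
  have zT: "zcx (UP A) T" unfolding T_def by (rule at.zcx_tw)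
  interpret T: zcx "UP A" T by (rule zT)
  have sT: "ses (UP A) W T ?K (\<lambda>k c. (\<zero>\<^bsub>ob ?K k\<^esub>, c)) (\<lambda>k. fst)" unfolding T_def by (rule at.ses_tw)
  have "carrier (ob ?K k) \<subseteq> carrier (poly_module M)" for k by simp
  then have encT: "inj_on enc (carrier (ob T k))" for k
    by (intro inj_on_subset[OF enc[of k]]) (auto simp: T_def simp del: resolution_sel(1))
  note em = transport_cplx(1)[OF zT encT, folded Z_def] and eb = transport_cplx(2)[OF zT encT, folded Z_def]
  interpret em: zmap "UP A" T Z "\<lambda>k. enc" by (rule em)
  define h where "h = (\<lambda>k z. at.ext k (inv_into (carrier (ob T k)) enc z))"
  have zh: "zmap (UP A) Z Y h"
    unfolding h_def using zmap_comp[OF zmap_inv[OF em eb] at.zmap_ext[folded T_def]] .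
  have he: "h k (enc z) = at.ext k z" if "z \<in> carrier (ob T k)" for k z
    using that encT by (simp add: h_def)
  have cones: "acyclic_at (cone Z Y h) k \<longleftrightarrow> acyclic_at (cone ?K D th) k" for k
    using at.cone_ext_acyclic[folded T_def D_def, OF em eb zh he] .
  obtain i p where s: "ses (UP A) W Z ?K i p" and i: "\<And>k x. i k x = enc (\<zero>\<^bsub>ob ?K k\<^esub>, x)"
    using ses_iso[OF sT em eb] by blast
  interpret s: ses "UP A" W Z ?K i p by (rule s)
  have inT: "(\<zero>\<^bsub>ob ?K k\<^esub>, x) \<in> carrier (ob T k)" if "x \<in> carrier (ob W k)" for k x
    using that K.M.M.zero_closed[of k] by (simp add: T_def)
  have hi: "h k (i k x) = g k x" if "x \<in> carrier (ob W k)" for k x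
    using he[OF inT[OF that]] at.ext_incl[OF that] by (simp only: i)
  have negK: "trivial_module (ob ?K k)" if "k < 0" for k
    using resolution_trivial[OF M that neg] .
  have ccZ: "chain_complex (UP A) Z"
    unfolding chain_complex_iff
  proof (intro conjI allI impI em.D.zcx_axioms)
    fix k :: int assume k: "k < 0"
    have "trivial_module (ob W k)" using W k by (simp add: chain_complex_iff)
    then have "trivial_module (ob T k)" using trivial_dsum[OF negK[OF k]] by (simp add: T_def)
    then show "trivial_module (ob Z k)" using trivial_module_iso[OF T.mod em.D.mod em.lin eb] by blast
  qed
  let ?Q = "quot_cplx W Z i"
  interpret Q: zcx "UP A" ?Q by (rule s.zcx_quot)
  have homb: "bij_betw (homology_map ?Q s.fib q) (carrier (homology ?K q)) (carrier (homology ?Q q))"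
    using zmap.homology_map_bij_iff[OF s.zmap_fib] s.qi_fib by (simp add: qi_def)
  note homl = zmap.homology_map_lin[OF s.zmap_fib]
  obtain a where a: "a \<in> S" "\<And>x. x \<in> carrier M \<Longrightarrow> a \<odot>\<^bsub>M\<^esub> x = \<zero>\<^bsub>M\<^esub>"
    using tM by (auto simp: torsion_module_def)
  have tK: "torsion_cplx S ?K"
    unfolding K.torsion_module_homology_iff(2)[OF sub]
    using resolution_torsion[OF M _ a(2)] a(1) sub by blast
  have "torsion_module S (homology ?K q)"
    unfolding K.torsion_module_homology_iff(1)[OF sub]
    using resolution_torsion[OF M _ a(2)] a(1) sub by blast
  then have tQ: "torsion_module S (homology ?Q q)"
    using torsion_module_iso[OF homl homb] sub right_module_group[OF K.right_module_homology]
      right_module_group[OF Q.right_module_homology] by blast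
  note rH = right_module_restrict[OF K.right_module_homology]
  have frK: "finite_retract A (restrict_module A (homology ?K q))"
    using finite_retract_iso[OF right_module_restrict[OF M] rH resolution_homology(1)[OF M]]
      resolution_homology(2)[OF M] fr by simp
  have frQ: "finite_retract A (restrict_module A (homology ?Q q))"
    using finite_retract_iso[OF rH right_module_restrict[OF Q.right_module_homology] restrict_lin[OF homl]]
      homb frK by simp
  have "elementary_extension A S q W Z i"
    unfolding elementary_extension_def chain_map_iff levelwise_inj_def homology_concentrated_in_def
      Q.trivial_homology_iff fg_projective_iff[OF right_module_restrict[OF Q.right_module_homology]]
    using W ccZ s.i.zmap_axioms s.inj tQ frQ
      zmap.qi_acyclic[OF s.zmap_fib s.qi_fib] resolution_acyclic[OF M] by blast
  moreover have "torsion_cplx S Z" by (rule s.torsion[OF S tW tK])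
  moreover have "perf A N (restrict_cplx A Z)"
  proof (rule perf_ses[OF restrict_ses[OF s] pW])
    have "perf A q (restrict_cplx A ?K)"
    proof (rule perf_concentrated)
      show "zcx A (restrict_cplx A ?K)" by (rule restrict_zcx[OF K.zcx_axioms])
      show "finite_retract A (homology (restrict_cplx A ?K) q)" using frK by (simp add: homology_restrict)
      show "acyclic_at (restrict_cplx A ?K) k" if "k \<noteq> q" for k using resolution_acyclic[OF M that] by simp
      show "acyclic_at (restrict_cplx A ?K) q" if "q < 0" using K.trivial_acyclic[OF negK[OF that]] by simp
    qed
    then show "perf A N (restrict_cplx A ?K)" using qN by (rule perf_mono)
  qed
  moreover have "\<forall>k\<le>q. acyclic_at (cone Z Y h) k" using acy_low by (simp add: cones)
  moreover have "inj_on lam (carrier M) \<and> (\<forall>k>q. acyclic_at (cone W Y g) k) \<longrightarrow> (\<forall>k. acyclic_at (cone Z Y h) k)"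
    using acy_all by (simp add: cones)
  ultimately show ?thesis using ccZ zh hi by blast
qed

end

section \<open>Covering torsion modules by projective ones\<close>

lemma (in right_module) finsum_smult_left:
  assumes "finite I" "f \<in> I \<rightarrow> carrier R" "x \<in> carrier M"
  shows "(\<Oplus>\<^bsub>R\<^esub>i\<in>I. f i) \<odot>\<^bsub>M\<^esub> x = (\<Oplus>\<^bsub>M\<^esub>i\<in>I. f i \<odot>\<^bsub>M\<^esub> x)"
  using assms(1,2)
proof (induction I)
  case (insert i I)
  then have "f \<in> I \<rightarrow> carrier R" "f i \<in> carrier R" by auto
  with insert assms(3) show ?case
    by (simp add: R.finsum_insert M.finsum_insert smult_l_distr smult_closed Pi_iff R.finsum_closed)
qed (use assms(3) in simp)

lemma finsum_restrict: "finsum (restrict_module A M) = finsum M"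
  by (intro ext) (simp add: finsum_def finprod_def)

context poly_base
begin

lemma finsum_endo: "finsum (endo_module M T) = finsum M"
  by (intro ext) (simp add: finsum_def finprod_def)

text \<open>
  This links \<open>p\<close> with its companion matrix: in the companion module itself it shows that \<open>p\<close> kills the cyclic
  generators, and in a module killed by \<open>p\<close> it expresses the action of \<open>t\<close> to the power \<open>deg p\<close> through lower powers.
\<close>

lemma smult_monic:
  assumes N: "right_module (UP A) N" and p: "monic A p" and x: "x \<in> carrier N"
  shows "p \<odot>\<^bsub>N\<^esub> x = monom (UP A) \<one> (deg A p) \<odot>\<^bsub>N\<^esub> x \<oplus>\<^bsub>N\<^esub>
     (\<Oplus>\<^bsub>N\<^esub>k\<in>{..<deg A p}. const (coeff (UP A) p k) \<odot>\<^bsub>N\<^esub> (monom (UP A) \<one> k \<odot>\<^bsub>N\<^esub> x))"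
proof -
  interpret N: right_module "UP A" N by (rule N)
  let ?d = "deg A p" and ?c = "coeff (UP A) p"
  have pc: "p \<in> carrier (UP A)" and lead: "?c ?d = \<one>" using p by (auto simp: monic_def)
  have c: "?c k \<in> carrier A" for k using U.coeff_closed[OF pc] .
  have mk: "monom (UP A) (?c k) k \<odot>\<^bsub>N\<^esub> x = const (?c k) \<odot>\<^bsub>N\<^esub> (monom (UP A) \<one> k \<odot>\<^bsub>N\<^esub> x)" for k
    unfolding monom_split[OF c, of k k] using c x by (intro N.smult_assoc) simp_all
  have cl: "const (?c k) \<odot>\<^bsub>N\<^esub> (monom (UP A) \<one> k \<odot>\<^bsub>N\<^esub> x) \<in> carrier N" for k
    using c x by (intro N.smult_closed) simp_all
  have "p \<odot>\<^bsub>N\<^esub> x = (\<Oplus>\<^bsub>UP A\<^esub>k\<in>{..?d}. monom (UP A) (?c k) k) \<odot>\<^bsub>N\<^esub> x"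
    by (simp only: U.up_repr[OF pc])
  also have "\<dots> = (\<Oplus>\<^bsub>N\<^esub>k\<in>{..?d}. const (?c k) \<odot>\<^bsub>N\<^esub> (monom (UP A) \<one> k \<odot>\<^bsub>N\<^esub> x))"
    using c x by (subst N.finsum_smult_left) (simp_all add: mk Pi_iff)
  also have "{..?d} = insert ?d {..<?d}" by auto
  also have "(\<Oplus>\<^bsub>N\<^esub>k\<in>insert ?d {..<?d}. const (?c k) \<odot>\<^bsub>N\<^esub> (monom (UP A) \<one> k \<odot>\<^bsub>N\<^esub> x))
     = const (?c ?d) \<odot>\<^bsub>N\<^esub> (monom (UP A) \<one> ?d \<odot>\<^bsub>N\<^esub> x) \<oplus>\<^bsub>N\<^esub>
       (\<Oplus>\<^bsub>N\<^esub>k\<in>{..<?d}. const (?c k) \<odot>\<^bsub>N\<^esub> (monom (UP A) \<one> k \<odot>\<^bsub>N\<^esub> x))"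
    using cl by (intro N.M.finsum_insert) simp_all
  also have "const (?c ?d) \<odot>\<^bsub>N\<^esub> (monom (UP A) \<one> ?d \<odot>\<^bsub>N\<^esub> x) = monom (UP A) \<one> ?d \<odot>\<^bsub>N\<^esub> x"
    using x by (simp add: lead N.smult_one N.smult_closed)
  finally show ?thesis .
qed

text \<open>
  The module is a sum of copies of \<open>A[t]/(p)\<close>, written as a free \<open>A\<close>-module with \<open>t\<close> acting by the
  companion matrix of \<open>p\<close>; in this form its freeness over \<open>A\<close> needs no division with remainder.
  It is killed by \<open>p\<close> because \<open>p\<close> kills the cyclic generators and is central.
\<close>

lemma companion_cover:
  fixes H :: "(nat \<Rightarrow> 'a, 'h) module" and n :: nat
  assumes H: "right_module (UP A) H" and mp: "monic A p" and cp: "centric A p"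
    and kill: "\<And>x. x \<in> carrier H \<Longrightarrow> p \<odot>\<^bsub>H\<^esub> x = \<zero>\<^bsub>H\<^esub>"
    and r: "r \<in> lin_maps A (free_module A {..<n}) (restrict_module A H)"
    and onto: "r ` carrier (free_module A {..<n}) = carrier H"
  shows "\<exists>(M :: (nat \<Rightarrow> 'a, nat \<times> nat \<Rightarrow> 'a) module) lam. right_module (UP A) M \<and>
    finite_retract A (restrict_module A M) \<and> (\<forall>x\<in>carrier M. p \<odot>\<^bsub>M\<^esub> x = \<zero>\<^bsub>M\<^esub>) \<and>
    lam \<in> lin_maps (UP A) M H \<and> lam ` carrier M = carrier H \<and> (n = 0 \<longrightarrow> trivial_module M)"
proof -
  interpret H: right_module "UP A" H by (rule H)
  define d where "d = deg A p"
  define c where "c = coeff (UP A) p"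
  have pc: "p \<in> carrier (UP A)" using mp by (simp add: monic_def)
  have ck [simp]: "c k \<in> carrier A" for k unfolding c_def using U.coeff_closed[OF pc] .
  let ?I = "{..<n} \<times> {..<d}"
  have fI: "finite ?I" by simp
  define F where "F = free_module A ?I"
  have rF: "right_module A F" unfolding F_def by (rule right_module_free[OF A.ring_axioms])
  interpret F: right_module A F by (rule rF)
  define e where "e ji = basis_vec A ji" for ji :: "nat \<times> nat"
  have e: "e (j, i) \<in> carrier F" if "j < n" "i < d" for j i
    unfolding e_def F_def using that by (intro basis_vec_closed A.ring_axioms) auto
  define sm where "sm j = (\<Oplus>\<^bsub>F\<^esub>k\<in>{..<d}. c k \<odot>\<^bsub>F\<^esub> e (j, k))" for j
  have sm: "sm j \<in> carrier F" if "j < n" for j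
    unfolding sm_def using e[OF that] by (intro F.M.finsum_closed) (auto simp: F.smult_closed)
  define s where "s = (\<lambda>(j, i). if Suc i < d then e (j, Suc i) else \<ominus>\<^bsub>F\<^esub> sm j)"
  have s: "s \<in> ?I \<rightarrow> carrier F" using e sm by (auto simp: s_def)
  define T where "T = free_ext ?I F s"
  have T: "T \<in> lin_maps A F F"
    using free_ext_lin[OF rF fI s] by (simp only: T_def F_def)
  have Te: "T (e (j, i)) = s (j, i)" if "j < n" "i < d" for j i
    unfolding T_def e_def using that by (intro free_ext_basis[OF rF fI s]) simp
  define M where "M = endo_module F T"
  have rM: "right_module (UP A) M" unfolding M_def by (rule right_module_endo[OF rF T])
  interpret M: right_module "UP A" M by (rule rM)
  have Msel [simp]: "carrier M = carrier F" "zero M = zero F" "add M = add F" by (simp_all add: M_def)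
  have Mt: "tvar \<odot>\<^bsub>M\<^esub> x = T x" if "x \<in> carrier F" for x
    unfolding M_def by (rule endo_t[OF rF T that])
  have Mc: "const a \<odot>\<^bsub>M\<^esub> x = a \<odot>\<^bsub>F\<^esub> x" if "a \<in> carrier A" "x \<in> carrier F" for a x
    unfolding M_def by (rule endo_const[OF rF T that])
  have pow: "monom (UP A) \<one> k \<odot>\<^bsub>M\<^esub> e (j, 0) = e (j, k)" if "j < n" "k < d" for j k
    using that(2)
  proof (induction k)
    case 0 then show ?case using e[OF that(1), of 0] M.smult_one[of "e (j, 0)"] by simp
  next
    case (Suc k)
    then have "monom (UP A) \<one> (Suc k) \<odot>\<^bsub>M\<^esub> e (j, 0) = tvar \<odot>\<^bsub>M\<^esub> e (j, k)"
      using tpow_smult_Suc[OF rM, of "e (j, 0)" k] e[OF that(1), of 0] by simp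
    also have "\<dots> = e (j, Suc k)"
      using Suc.prems Te[OF that(1), of k] e[OF that(1), of k] by (simp add: Mt s_def)
    finally show ?case .
  qed
  have p0: "p \<odot>\<^bsub>M\<^esub> e (j, 0) = \<zero>\<^bsub>F\<^esub>" if j: "j < n" and d: "0 < d" for j
  proof -
    obtain d' where d': "d = Suc d'" using d by (cases d) auto
    have e0: "e (j, 0) \<in> carrier M" using e[OF j d] by simp
    have "monom (UP A) \<one> d \<odot>\<^bsub>M\<^esub> e (j, 0) = tvar \<odot>\<^bsub>M\<^esub> (monom (UP A) \<one> d' \<odot>\<^bsub>M\<^esub> e (j, 0))"
      unfolding d' by (rule tpow_smult_Suc[OF rM e0])
    also have "\<dots> = \<ominus>\<^bsub>F\<^esub> sm j"
      using pow[OF j, of d'] Te[OF j, of d'] e[OF j, of d'] d' by (simp add: Mt s_def)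
    finally have 1: "monom (UP A) \<one> d \<odot>\<^bsub>M\<^esub> e (j, 0) = \<ominus>\<^bsub>F\<^esub> sm j" .
    have "(\<Oplus>\<^bsub>F\<^esub>k\<in>{..<d}. const (c k) \<odot>\<^bsub>M\<^esub> (monom (UP A) \<one> k \<odot>\<^bsub>M\<^esub> e (j, 0))) = sm j"
      unfolding sm_def using e[OF j] pow[OF j]
      by (intro F.M.finsum_cong') (auto simp: Mc F.smult_closed)
    then have 2: "(\<Oplus>\<^bsub>M\<^esub>k\<in>{..<d}. const (c k) \<odot>\<^bsub>M\<^esub> (monom (UP A) \<one> k \<odot>\<^bsub>M\<^esub> e (j, 0))) = sm j"
      by (simp only: M_def finsum_endo)
    show ?thesis
      using smult_monic[OF rM mp e0] sm[OF j] by (simp add: 1 2 F.M.l_neg flip: c_def d_def)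
  qed
  have comm: "p \<otimes>\<^bsub>UP A\<^esub> a = a \<otimes>\<^bsub>UP A\<^esub> p" if "a \<in> carrier (UP A)" for a
    using cp that by (simp add: centric_def)
  have swap: "p \<odot>\<^bsub>M\<^esub> (a \<odot>\<^bsub>M\<^esub> x) = a \<odot>\<^bsub>M\<^esub> (p \<odot>\<^bsub>M\<^esub> x)" if "a \<in> carrier (UP A)" "x \<in> carrier M" for a x
    using that pc comm[OF that(1)] M.smult_assoc[of a p x] M.smult_assoc[of p a x] by simp
  have pe: "p \<odot>\<^bsub>M\<^esub> e (j, i) = \<zero>\<^bsub>F\<^esub>" if "j < n" "i < d" for j i
  proof -
    have "p \<odot>\<^bsub>M\<^esub> (monom (UP A) \<one> i \<odot>\<^bsub>M\<^esub> e (j, 0)) = monom (UP A) \<one> i \<odot>\<^bsub>M\<^esub> (p \<odot>\<^bsub>M\<^esub> e (j, 0))"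
      using that e[of j 0] by (intro swap) simp_all
    also have "\<dots> = \<zero>\<^bsub>F\<^esub>" using p0[of j] that M.smult_zero_r[of "monom (UP A) \<one> i"] by simp
    finally show ?thesis using pow[OF that] by simp
  qed
  have pM: "p \<odot>\<^bsub>M\<^esub> x = \<zero>\<^bsub>M\<^esub>" if x: "x \<in> carrier M" for x
  proof -
    have pl: "(\<lambda>x. p \<odot>\<^bsub>M\<^esub> x) \<in> lin_maps A F F"
    proof (rule lin_mapsI)
      show "p \<odot>\<^bsub>M\<^esub> x \<in> carrier F" if "x \<in> carrier F" for x using M.smult_closed[OF pc, of x] that by simp
      show "p \<odot>\<^bsub>M\<^esub> (x \<oplus>\<^bsub>F\<^esub> y) = p \<odot>\<^bsub>M\<^esub> x \<oplus>\<^bsub>F\<^esub> p \<odot>\<^bsub>M\<^esub> y" if "x \<in> carrier F" "y \<in> carrier F" for x y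
        using M.smult_r_distr[OF pc, of x y] that by simp
      show "p \<odot>\<^bsub>M\<^esub> (a \<odot>\<^bsub>F\<^esub> x) = a \<odot>\<^bsub>F\<^esub> (p \<odot>\<^bsub>M\<^esub> x)" if "a \<in> carrier A" "x \<in> carrier F" for a x
        using swap[of "const a" x] that M.smult_closed[OF pc, of x] by (simp add: Mc)
    qed
    have "p \<odot>\<^bsub>M\<^esub> x = \<zero>\<^bsub>F\<^esub>"
    proof (rule free_module_eqI[OF rF fI, of "\<lambda>x. p \<odot>\<^bsub>M\<^esub> x" "\<lambda>x. \<zero>\<^bsub>F\<^esub>"])
      show "(\<lambda>x. p \<odot>\<^bsub>M\<^esub> x) \<in> lin_maps A (free_module A ?I) F" using pl by (simp only: F_def)
      show "(\<lambda>x. \<zero>\<^bsub>F\<^esub>) \<in> lin_maps A (free_module A ?I) F" by (rule lin_maps_zero_map[OF rF])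
      show "x \<in> carrier (free_module A ?I)" using x by (simp only: Msel F_def)
      show "p \<odot>\<^bsub>M\<^esub> basis_vec A ji = \<zero>\<^bsub>F\<^esub>" if "ji \<in> ?I" for ji
        using pe[of "fst ji" "snd ji"] that by (auto simp: e_def)
    qed
    then show ?thesis by simp
  qed
  note rrM = right_module_restrict[OF rM] and rrH = right_module_restrict[OF H]
  have idl: "(\<lambda>x. x) \<in> lin_maps A F (restrict_module A M)"
    by (rule lin_mapsI) (simp_all add: Mc)
  have idb: "bij_betw (\<lambda>x. x) (carrier F) (carrier (restrict_module A M))" by (simp add: bij_betw_def)
  have frM: "finite_retract A (restrict_module A M)"
    using finite_retract_iso[OF rF rrM idl idb] finite_retract_free[OF A.ring_axioms fI] by (simp add: F_def)
  define b where "b j = r (basis_vec A j)" for j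
  have b: "b j \<in> carrier H" if "j < n" for j
    unfolding b_def using that lin_maps_closed[OF r basis_vec_closed[OF A.ring_axioms]] by simp
  define v where "v = (\<lambda>(j, i). monom (UP A) \<one> i \<odot>\<^bsub>H\<^esub> b j)"
  have v: "v \<in> ?I \<rightarrow> carrier (restrict_module A H)" using b by (auto simp: v_def H.smult_closed)
  define lam where "lam = free_ext ?I (restrict_module A H) v"
  have lamF: "lam \<in> lin_maps A F (restrict_module A H)"
    using free_ext_lin[OF rrH fI v] by (simp only: lam_def F_def)
  have lame: "lam (e (j, i)) = monom (UP A) \<one> i \<odot>\<^bsub>H\<^esub> b j" if "j < n" "i < d" for j i
    unfolding lam_def e_def using free_ext_basis[OF rrH fI v, of "(j, i)"] that by (simp add: v_def)
  have lamcl: "lam x \<in> carrier H" if "x \<in> carrier F" for x using lin_maps_closed[OF lamF that] by simp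
  have lamT: "lam (T x) = tvar \<odot>\<^bsub>H\<^esub> lam x" if x: "x \<in> carrier F" for x
  proof (rule free_module_eqI[OF rrH fI, of "\<lambda>x. lam (T x)" "\<lambda>x. tvar \<odot>\<^bsub>H\<^esub> lam x"])
    show "(\<lambda>x. lam (T x)) \<in> lin_maps A (free_module A ?I) (restrict_module A H)"
      using lin_maps_comp[OF T lamF] by (simp only: F_def)
    show "(\<lambda>x. tvar \<odot>\<^bsub>H\<^esub> lam x) \<in> lin_maps A (free_module A ?I) (restrict_module A H)"
      using lin_maps_comp[OF lamF restrict_lin[OF t_lin[OF H]]] by (simp only: F_def)
    show "x \<in> carrier (free_module A ?I)" using x by (simp only: F_def)
    fix ji assume "ji \<in> ?I"
    then obtain j i where ji: "ji = (j, i)" "j < n" "i < d" by auto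
    have "lam (s (j, i)) = tvar \<odot>\<^bsub>H\<^esub> (monom (UP A) \<one> i \<odot>\<^bsub>H\<^esub> b j)"
    proof (cases "Suc i < d")
      case True
      then show ?thesis using lame[OF ji(2) True] tpow_smult_Suc[OF H b[OF ji(2)], of i] by (simp add: s_def)
    next
      case False
      then have di: "d = Suc i" using ji by simp
      let ?u = "\<lambda>k. const (c k) \<odot>\<^bsub>H\<^esub> (monom (UP A) \<one> k \<odot>\<^bsub>H\<^esub> b j)"
      have ucl: "?u k \<in> carrier H" for k using b[OF ji(2)] by (simp add: H.smult_closed)
      have cle: "(\<lambda>k. c k \<odot>\<^bsub>F\<^esub> e (j, k)) \<in> {..<d} \<rightarrow> carrier F"
        using e[OF ji(2)] by (auto simp: F.smult_closed)
      have "lam (sm j) = (\<Oplus>\<^bsub>restrict_module A H\<^esub>k\<in>{..<d}. lam (c k \<odot>\<^bsub>F\<^esub> e (j, k)))"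
        unfolding sm_def
        by (rule lin_maps_finsum[OF lamF F.abelian_group_axioms right_module_group[OF rrH] finite_lessThan cle])
      also have "\<dots> = (\<Oplus>\<^bsub>H\<^esub>k\<in>{..<d}. ?u k)"
        unfolding finsum_restrict using e[OF ji(2)] lame[OF ji(2)] ucl
        by (intro H.M.finsum_cong') (auto simp: lin_maps_smult[OF lamF])
      finally have ls: "lam (sm j) = (\<Oplus>\<^bsub>H\<^esub>k\<in>{..<d}. ?u k)" .
      have "monom (UP A) \<one> d \<odot>\<^bsub>H\<^esub> b j \<oplus>\<^bsub>H\<^esub> lam (sm j) = \<zero>\<^bsub>H\<^esub>"
        using smult_monic[OF H mp b[OF ji(2)]] kill[OF b[OF ji(2)]] by (simp add: ls flip: c_def d_def)
      then have "\<ominus>\<^bsub>H\<^esub> lam (sm j) = monom (UP A) \<one> d \<odot>\<^bsub>H\<^esub> b j"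
        using b[OF ji(2)] lamcl[OF sm[OF ji(2)]] by (intro H.M.minus_equality) (simp_all add: H.smult_closed)
      moreover have "lam (\<ominus>\<^bsub>F\<^esub> sm j) = \<ominus>\<^bsub>H\<^esub> lam (sm j)"
        using lin_maps_minus[OF lamF F.abelian_group_axioms right_module_group[OF rrH] sm[OF ji(2)]] by simp
      ultimately show ?thesis
        using tpow_smult_Suc[OF H b[OF ji(2)], of i] False by (simp add: s_def di)
    qed
    then show "lam (T (basis_vec A ji)) = tvar \<odot>\<^bsub>H\<^esub> lam (basis_vec A ji)"
      using Te[OF ji(2,3)] lame[OF ji(2,3)] by (simp add: e_def ji(1))
  qed
  have lamM: "lam \<in> lin_maps (UP A) M H"
  proof (rule lin_UP_I[OF rM H])
    show "lam \<in> lin_maps A (restrict_module A M) (restrict_module A H)"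
      using lamF by (auto simp: lin_maps_def Mc)
    show "lam (tvar \<odot>\<^bsub>M\<^esub> x) = tvar \<odot>\<^bsub>H\<^esub> lam x" if "x \<in> carrier M" for x
      using that lamT by (simp add: Mt)
  qed
  have "carrier H \<subseteq> lam ` carrier M"
  proof
    fix y assume y: "y \<in> carrier H"
    show "y \<in> lam ` carrier M"
    proof (cases "d = 0")
      case True
      have "p \<odot>\<^bsub>H\<^esub> y = y" using smult_monic[OF H mp y] y H.smult_one[OF y] True by (simp flip: d_def)
      then have "y = \<zero>\<^bsub>H\<^esub>" using kill[OF y] by simp
      moreover have "lam \<zero>\<^bsub>M\<^esub> = \<zero>\<^bsub>H\<^esub>"
        by (rule lin_maps_zero[OF lamM M.abelian_group_axioms H.abelian_group_axioms])
      ultimately show ?thesis using M.M.zero_closed by (metis image_eqI)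
    next
      case False
      then have d: "0 < d" by simp
      obtain w where w: "w \<in> carrier (free_module A {..<n})" "y = r w" using onto y by blast
      let ?u = "free_ext {..<n} F (\<lambda>j. e (j, 0))"
      have e0: "(\<lambda>j. e (j, 0)) \<in> {..<n} \<rightarrow> carrier F" using e d by auto
      have u: "?u \<in> lin_maps A (free_module A {..<n}) F" by (rule free_ext_lin[OF rF finite_lessThan e0])
      have "lam (?u w) = r w"
      proof (rule free_module_eqI[OF rrH finite_lessThan lin_maps_comp[OF u lamF] r w(1)])
        fix j assume "j \<in> {..<n}"
        then have j: "j < n" by simp
        have "?u (basis_vec A j) = e (j, 0)" using free_ext_basis[OF rF finite_lessThan e0, of j] j by simp
        then show "lam (?u (basis_vec A j)) = r (basis_vec A j)"
          using lame[OF j d] H.smult_one[OF b[OF j]] by (simp add: b_def)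
      qed
      then show ?thesis using w(2) lin_maps_closed[OF u w(1)] by (intro image_eqI[of _ _ "?u w"]) simp_all
    qed
  qed
  moreover have "lam ` carrier M \<subseteq> carrier H" using lamcl by auto
  moreover have "trivial_module M" if "n = 0"
    using F.M.zero_closed that by (auto simp: trivial_module_def F_def)
  ultimately show ?thesis using rM frM pM lamM by blast
qed

section \<open>Attaching torsion modules to the lowest homology\<close>

lemma torsion_cone:
  assumes S: "submonoid S (UP A)" and f: "zmap (UP A) W Y g" and "torsion_cplx S W" "torsion_cplx S Y"
  shows "torsion_cplx S (cone W Y g)"
proof -
  interpret g: zmap "UP A" W Y g by (rule f)
  interpret sW: zcx "UP A" "sus W" by (rule zcx_sus[OF g.C.zcx_axioms])
  have sub: "S \<subseteq> carrier (UP A)" using S by (rule submonoid.subset)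
  have "torsion_cplx S (sus W)"
    using assms(3) unfolding sW.torsion_module_homology_iff(2)[OF sub] g.C.torsion_module_homology_iff(2)[OF sub]
      g.C.sus_cyc g.C.sus_boundaries by auto
  then show ?thesis by (rule ses.torsion[OF g.ses_cone S assms(4)])
qed

text \<open>
  A module that is finitely generated projective over \<open>A\<close> embeds into sequences in \<open>A\<close>, so the type of
  its elements need not appear in the type of the new complex.
\<close>

lemma attach_encoded:
  fixes W :: "(nat \<Rightarrow> 'a, 'w) cplx" and Y :: "(nat \<Rightarrow> 'a, 'y) cplx" and M :: "(nat \<Rightarrow> 'a, 'h) module"
    and enc :: "(nat \<Rightarrow> nat \<Rightarrow> 'a) \<times> 'w \<Rightarrow> 'z"
  assumes "submonoid S (UP A)" "chain_complex (UP A) W" "chain_complex (UP A) Y" "zmap (UP A) W Y g"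
    "torsion_cplx S W" "perf A N (restrict_cplx A W)" "q \<le> N"
    and M: "right_module (UP A) M" and fr: "finite_retract A (restrict_module A M)" and "torsion_module S M"
    "lam \<in> lin_maps (UP A) M (homology (cone W Y g) q)" "lam ` carrier M = carrier (homology (cone W Y g) q)"
    "\<And>k. k < q \<Longrightarrow> acyclic_at (cone W Y g) k" "q < 0 \<Longrightarrow> trivial_module M"
    and enc: "inj enc"
  shows "\<exists>(Z :: (nat \<Rightarrow> 'a, 'z) cplx) i h. elementary_extension A S q W Z i \<and> chain_complex (UP A) Z \<and>
    zmap (UP A) Z Y h \<and> (\<forall>k. \<forall>x\<in>carrier (ob W k). h k (i k x) = g k x) \<and>
    torsion_cplx S Z \<and> perf A N (restrict_cplx A Z) \<and> (\<forall>k\<le>q. acyclic_at (cone Z Y h) k) \<and>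
    (inj_on lam (carrier M) \<and> (\<forall>k>q. acyclic_at (cone W Y g) k) \<longrightarrow> (\<forall>k. acyclic_at (cone Z Y h) k))"
proof -
  obtain e :: "'h \<Rightarrow> nat \<Rightarrow> 'a" where e: "inj_on e (carrier M)"
  proof -
    obtain n :: nat and i p where "\<forall>x\<in>carrier M. p (i x) = x"
      "i \<in> lin_maps A (restrict_module A M) (free_module A {..<n})"
      using fr unfolding finite_retract_def by auto
    then show thesis using inj_on_inverseI[of "carrier M" p i] by (intro that[of i]) auto
  qed
  have "inj_on (\<lambda>(c, w). enc (\<lambda>i. e (c i), w)) (carrier (poly_module M) \<times> carrier (ob W k))" for k
  proof (rule inj_onI, clarify)
    fix c w c' w'
    assume c: "c \<in> carrier (poly_module M)" "c' \<in> carrier (poly_module M)"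
      and "enc (\<lambda>i. e (c i), w) = enc (\<lambda>i. e (c' i), w')"
    then have eq: "(\<lambda>i. e (c i)) = (\<lambda>i. e (c' i))" "w = w'" using injD[OF enc] by blast+
    have "c i = c' i" for i
      using fun_cong[OF eq(1), of i] c by (intro inj_onD[OF e]) (simp_all add: poly_sel[OF M])
    then show "c = c' \<and> w = w'" using eq(2) by auto
  qed
  from attach_module[OF assms(1-14) this] show ?thesis by blast
qed

context
  fixes S :: "(nat \<Rightarrow> 'a) set" and W :: "(nat \<Rightarrow> 'a, 'w) cplx" and Y :: "(nat \<Rightarrow> 'a, 'y) cplx" and g
    and N q :: int and enc :: "(nat \<Rightarrow> nat \<Rightarrow> 'a) \<times> 'w \<Rightarrow> 'z"
  assumes S: "submonoid S (UP A)" and mc: "\<forall>p\<in>S. monic A p \<and> centric A p"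
    and W: "chain_complex (UP A) W" and Y: "chain_complex (UP A) Y" and g: "zmap (UP A) W Y g"
    and tW: "torsion_cplx S W" and tY: "torsion_cplx S Y"
    and pW: "perf A N (restrict_cplx A W)" and pY: "perf A (N + 1) (restrict_cplx A Y)"
    and low: "\<And>k. k < q \<Longrightarrow> acyclic_at (cone W Y g) k"
    and enc: "inj enc"
begin

lemma cone_facts:
  shows "right_module (UP A) (homology (cone W Y g) q)"
    and "torsion_module S (homology (cone W Y g) q)"
    and "perf A (N + 1) (restrict_cplx A (cone W Y g))"
    and "q < 0 \<Longrightarrow> trivial_module (homology (cone W Y g) q)"
proof -
  interpret g: zmap "UP A" W Y g by (rule g)
  interpret D: zcx "UP A" "cone W Y g" by (rule g.zcx_cone)
  show "right_module (UP A) (homology (cone W Y g) q)" by (rule D.right_module_homology)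
  show "torsion_module S (homology (cone W Y g) q)"
    using torsion_cone[OF S g tW tY] by (auto simp: torsion_cplx_def torsion_module_def)
  show "perf A (N + 1) (restrict_cplx A (cone W Y g))"
    unfolding restrict_cone by (rule perf_cone[OF restrict_zmap[OF g] pW pY])
  assume "q < 0"
  then have "trivial_module (ob (cone W Y g) q)"
    using W Y by (simp add: chain_complex_iff trivial_dsum)
  then show "trivial_module (homology (cone W Y g) q)"
    unfolding D.trivial_homology_iff by (rule D.trivial_acyclic)
qed

lemma low_restrict: "k < q \<Longrightarrow> acyclic_at (restrict_cplx A (cone W Y g)) k"
  using low by simp

text \<open>
  In negative degrees the cone vanishes and nothing may be attached, as the new complex has to vanish
  there too; the covering module is then chosen on no generators.
\<close>

lemma inductive_step:
  assumes "q \<le> N"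
  shows "\<exists>(Z :: (nat \<Rightarrow> 'a, 'z) cplx) i h. elementary_extension A S q W Z i \<and> chain_complex (UP A) Z \<and>
    zmap (UP A) Z Y h \<and> (\<forall>k. \<forall>x\<in>carrier (ob W k). h k (i k x) = g k x) \<and>
    torsion_cplx S Z \<and> perf A N (restrict_cplx A Z) \<and> (\<forall>k\<le>q. acyclic_at (cone Z Y h) k)"
proof -
  let ?H = "homology (cone W Y g) q"
  interpret H: right_module "UP A" ?H by (rule cone_facts)
  obtain p where p: "p \<in> S" "\<And>x. x \<in> carrier ?H \<Longrightarrow> p \<odot>\<^bsub>?H\<^esub> x = \<zero>\<^bsub>?H\<^esub>"
    using cone_facts(2) by (auto simp: torsion_module_def)
  have "\<exists>(n :: nat) r. r \<in> lin_maps A (free_module A {..<n}) (restrict_module A ?H) \<and>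
    r ` carrier (free_module A {..<n}) = carrier ?H \<and> (q < 0 \<longrightarrow> n = 0)"
  proof (cases "q < 0")
    case True
    interpret F: right_module A "free_module A {..<0::nat}" by (rule right_module_free[OF A.ring_axioms])
    have "(\<lambda>x. \<zero>\<^bsub>?H\<^esub>) \<in> lin_maps A (free_module A {..<0::nat}) (restrict_module A ?H)"
      using lin_maps_zero_map[OF right_module_restrict[OF H.right_module_axioms], of "free_module A {..<0::nat}"]
      by simp
    moreover have "(\<lambda>x. \<zero>\<^bsub>?H\<^esub>) ` carrier (free_module A {..<0::nat}) = carrier ?H"
      using cone_facts(4)[OF True] F.M.zero_closed unfolding trivial_module_def by blast
    ultimately show ?thesis by blast
  next
    case False
    then show ?thesis
      using perf_low(1)[OF cone_facts(3) low_restrict] by (simp add: homology_restrict)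
  qed
  then obtain n :: nat and r where r: "r \<in> lin_maps A (free_module A {..<n}) (restrict_module A ?H)"
    "r ` carrier (free_module A {..<n}) = carrier ?H" and n0: "q < 0 \<longrightarrow> n = 0" by blast
  have mp: "monic A p" and cp: "centric A p" using mc p(1) by auto
  obtain M :: "(nat \<Rightarrow> 'a, nat \<times> nat \<Rightarrow> 'a) module" and lam where M: "right_module (UP A) M"
    "finite_retract A (restrict_module A M)" "\<forall>x\<in>carrier M. p \<odot>\<^bsub>M\<^esub> x = \<zero>\<^bsub>M\<^esub>"
    "lam \<in> lin_maps (UP A) M ?H" "lam ` carrier M = carrier ?H" "n = 0 \<longrightarrow> trivial_module M"
    using companion_cover[OF H.right_module_axioms mp cp p(2) r] by blast
  have tM: "torsion_module S M" using M(3) p(1) by (auto simp: torsion_module_def)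
  have negM: "trivial_module M" if "q < 0" using that n0 M(6) by blast
  show ?thesis
    using attach_encoded[OF S W Y g tW pW assms M(1,2) tM M(4,5) low negM enc] by blast
qed

text \<open>
  In the degree that bounds the amplitude of the cone, its only homology is projective over \<open>A\<close> and
  can be attached as it is.
\<close>

lemma last_step:
  assumes "q = N + 1"
  shows "\<exists>(Z :: (nat \<Rightarrow> 'a, 'z) cplx) i h. elementary_extension A S q W Z i \<and> chain_complex (UP A) Z \<and>
    zmap (UP A) Z Y h \<and> (\<forall>k. \<forall>x\<in>carrier (ob W k). h k (i k x) = g k x) \<and>
    torsion_cplx S Z \<and> perf A q (restrict_cplx A Z) \<and> (\<forall>k. acyclic_at (cone Z Y h) k)"
proof -
  let ?H = "homology (cone W Y g) q"
  have fr: "finite_retract A (restrict_module A ?H)"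
    using perf_low(2)[OF cone_facts(3) low_restrict] assms by (simp add: homology_restrict)
  have high: "\<forall>k>q. acyclic_at (cone W Y g) k"
    using perf_acyclic[OF cone_facts(3)] assms by auto
  have pW': "perf A q (restrict_cplx A W)" using pW assms by (intro perf_mono[OF pW]) simp
  have im: "(\<lambda>x. x) ` carrier ?H = carrier ?H" and inj: "inj_on (\<lambda>x. x) (carrier ?H)" by simp_all
  show ?thesis
    using attach_encoded[OF S W Y g tW pW' order_refl cone_facts(1) fr cone_facts(2) lin_maps_id im low
        cone_facts(4) enc] high inj by blast
qed

end

end

section \<open>The factorization\<close>

text \<open>
  Attaching cells pairs the old complex with sequences; the two sequences that an element then
  carries are merged into one, so that all stages share a type.
\<close>

definition interleave :: "(nat \<Rightarrow> 'b) \<times> 'x \<times> (nat \<Rightarrow> 'b) \<Rightarrow> 'x \<times> (nat \<Rightarrow> 'b)" where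
  "interleave = (\<lambda>(c, x, e). (x, \<lambda>i. if even i then c (i div 2) else e (i div 2)))"

lemma inj_interleave: "inj (interleave :: (nat \<Rightarrow> 'b) \<times> 'x \<times> (nat \<Rightarrow> 'b) \<Rightarrow> _)"
proof (rule injI)
  fix z z' :: "(nat \<Rightarrow> 'b) \<times> 'x \<times> (nat \<Rightarrow> 'b)"
  assume "interleave z = interleave z'"
  moreover obtain c x e c' x' e' where z: "z = (c, x, e)" "z' = (c', x', e')"
    by (cases z, cases z')
  ultimately have x: "x = x'" and eq: "(\<lambda>i. if even i then c (i div 2) else e (i div 2))
      = (\<lambda>i. if even i then c' (i div 2) else e' (i div 2))"
    by (simp_all add: interleave_def)
  have "c i = c' i" "e i = e' i" for i
    using fun_cong[OF eq, of "2 * i"] fun_cong[OF eq, of "2 * i + 1"] by simp_all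
  then show "z = z'" using x by (auto simp: z)
qed

lemma composite_cong:
  "(\<And>r. a < r \<Longrightarrow> r \<le> a + int l \<Longrightarrow> i r = i' r) \<Longrightarrow> composite a j i l = composite a j i' l"
  by (induction l) simp_all

theorem propositionC8:
  fixes A :: "('a, 'k) ring_scheme"
    and S :: "(nat \<Rightarrow> 'a) set"
    and m :: int
    and X :: "(nat \<Rightarrow> 'a, 'x) cplx"
    and Y :: "(nat \<Rightarrow> 'a, 'y) cplx"
    and f :: "int \<Rightarrow> 'x \<Rightarrow> 'y"
  assumes "ring A"
    and "submonoid S (UP A)"
    and "\<forall>p\<in>S. monic A p \<and> centric A p"
    and "perfect_over TYPE('u) A X" and "torsion_cplx S X"
    and "perfect_over TYPE('v) A Y" and "torsion_cplx S Y"
    and "chain_map (UP A) X Y f"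
    and "connected_map m X Y f"
  shows "\<exists>(n :: int) (Z :: int \<Rightarrow> (nat \<Rightarrow> 'a, 'x \<times> (nat \<Rightarrow> nat \<Rightarrow> 'a)) cplx) j i g.
    n > m \<and>
    elementary_extension A S (m + 1) X (Z (m + 1)) j \<and>
    (\<forall>q. m + 1 < q \<and> q \<le> n \<longrightarrow> elementary_extension A S q (Z (q - 1)) (Z q) (i q)) \<and>
    quasi_iso (UP A) (Z n) Y g \<and>
    (\<forall>k. \<forall>x\<in>carrier (ob X k). g k (composite (m + 1) j i (nat (n - (m + 1))) k x) = f k x) \<and>
    (\<forall>q. m < q \<and> q \<le> n \<longrightarrow>
      perfect_over TYPE(nat \<Rightarrow> 'a) A (Z q) \<and> torsion_cplx S (Z q))"
proof -
  interpret poly_base A using assms(1) by (simp add: poly_base_def)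
  have X: "chain_complex (UP A) X" and Y: "chain_complex (UP A) Y" and f: "zmap (UP A) X Y f"
    using assms(8) by (auto simp: chain_map_iff)
  interpret f: zmap "UP A" X Y f by (rule f)
  obtain NX where NX: "perf A NX (restrict_cplx A X)" using perfect_over_imp_perf[OF assms(4)] by blast
  obtain NY where NY: "perf A NY (restrict_cplx A Y)" using perfect_over_imp_perf[OF assms(6)] by blast
  \<comment> \<open>large enough that the last step is not the first one\<close>
  define N where "N = max (m + 1) (max NX NY)"
  have pX: "perf A N (restrict_cplx A X)" by (rule perf_mono[OF NX]) (simp add: N_def)
  have pY: "perf A (N + 1) (restrict_cplx A Y)" by (rule perf_mono[OF NY]) (simp add: N_def)
  have conn: "acyclic_at (cone X Y f) k" if "k < m + 1" for k
    using assms(9) that zcx.trivial_homology_iff[OF f.zcx_cone] by (auto simp: connected_map_def)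
  note common = assms(2,3)
  \<comment> \<open>stage \<open>l\<close> has attached modules in the degrees from \<open>m + 1\<close> to \<open>m + 1 + l\<close>\<close>
  define good where "good Z \<longleftrightarrow> chain_complex (UP A) Z \<and> torsion_cplx S Z \<and> (\<exists>N. perf A N (restrict_cplx A Z))"
    for Z :: "(nat \<Rightarrow> 'a, 'x \<times> (nat \<Rightarrow> nat \<Rightarrow> 'a)) cplx"
  define stage where "stage l Z j i g \<longleftrightarrow>
      elementary_extension A S (m + 1) X (Z (m + 1)) j \<and>
      (\<forall>q. m + 1 < q \<and> q \<le> m + 1 + int l \<longrightarrow> elementary_extension A S q (Z (q - 1)) (Z q) (i q)) \<and>
      (\<forall>q. m < q \<and> q \<le> m + 1 + int l \<longrightarrow> good (Z q)) \<and>
      zmap (UP A) (Z (m + 1 + int l)) Y g \<and>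
      (\<forall>k. \<forall>x\<in>carrier (ob X k). composite (m + 1) j i l k x \<in> carrier (ob (Z (m + 1 + int l)) k) \<and>
        g k (composite (m + 1) j i l k x) = f k x)"
    for l and Z :: "int \<Rightarrow> (nat \<Rightarrow> 'a, 'x \<times> (nat \<Rightarrow> nat \<Rightarrow> 'a)) cplx" and j i g
  have extend: "stage (Suc l) (Z(m + 1 + int (Suc l) := Z')) j (i(m + 1 + int (Suc l) := i')) g'"
    if st: "stage l Z j i g"
      and el: "elementary_extension A S (m + 1 + int (Suc l)) (Z (m + 1 + int l)) Z' i'"
      and Z': "good Z'" and g': "zmap (UP A) Z' Y g'"
      and gi: "\<And>k x. x \<in> carrier (ob (Z (m + 1 + int l)) k) \<Longrightarrow> g' k (i' k x) = g k x"
    for l Z j i g Z' i' g'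
  proof -
    let ?a = "m + 1" and ?q = "m + 1 + int (Suc l)"
    let ?Z = "Z(?q := Z')" and ?i = "i(?q := i')"
    have i'cl: "i' k x \<in> carrier (ob Z' k)" if "x \<in> carrier (ob (Z (m + 1 + int l)) k)" for k x
      using el that unfolding elementary_extension_def chain_map_iff by (meson zmap.f_closed)
    have comp: "composite ?a j ?i l = composite ?a j i l"
      by (rule composite_cong) simp
    have compS: "composite ?a j ?i (Suc l) k x = i' k (composite ?a j i l k x)" for k x
      by (simp only: composite.simps comp fun_upd_same)
    have "elementary_extension A S q (?Z (q - 1)) (?Z q) (?i q)" if "m + 1 < q \<and> q \<le> ?q" for q
    proof (cases "q = ?q")
      case True then show ?thesis using el by (simp add: algebra_simps)
    next
      case False then show ?thesis using st that unfolding stage_def by auto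
    qed
    moreover have "good (?Z q)" if "m < q \<and> q \<le> ?q" for q
      using st Z' that unfolding stage_def by auto
    moreover have "composite ?a j ?i (Suc l) k x \<in> carrier (ob (?Z ?q) k) \<and>
        g' k (composite ?a j ?i (Suc l) k x) = f k x" if "x \<in> carrier (ob X k)" for k x
      using st that i'cl gi unfolding stage_def compS by simp
    moreover have "elementary_extension A S (m + 1) X (?Z (m + 1)) j" using st unfolding stage_def by simp
    ultimately show ?thesis using g' unfolding stage_def by simp
  qed
  have build: "\<exists>Z j i g. stage l Z j i g \<and> perf A N (restrict_cplx A (Z (m + 1 + int l))) \<and>
      (\<forall>k\<le>m + 1 + int l. acyclic_at (cone (Z (m + 1 + int l)) Y g) k)"
    if "m + 1 + int l \<le> N" for l
    using that
  proof (induction l)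
    case 0
    have "inj (prod.swap :: (nat \<Rightarrow> nat \<Rightarrow> 'a) \<times> 'x \<Rightarrow> 'x \<times> (nat \<Rightarrow> nat \<Rightarrow> 'a))" by simp
    from inductive_step[where q = "m + 1", OF common X Y f assms(5,7) pX pY conn this] 0
    obtain Z' :: "(nat \<Rightarrow> 'a, 'x \<times> (nat \<Rightarrow> nat \<Rightarrow> 'a)) cplx" and j g where Z':
      "elementary_extension A S (m + 1) X Z' j" "chain_complex (UP A) Z'" "zmap (UP A) Z' Y g"
      "\<forall>k. \<forall>x\<in>carrier (ob X k). g k (j k x) = f k x" "torsion_cplx S Z'" "perf A N (restrict_cplx A Z')"
      "\<forall>k\<le>m + 1. acyclic_at (cone Z' Y g) k" by auto
    moreover have "j k x \<in> carrier (ob Z' k)" if "x \<in> carrier (ob X k)" for k x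
      using Z'(1) that unfolding elementary_extension_def chain_map_iff by (meson zmap.f_closed)
    ultimately have "stage 0 (\<lambda>q. Z') j (\<lambda>q k x. x) g" unfolding stage_def good_def by auto
    with Z'(6,7) show ?case by auto
  next
    case (Suc l)
    then obtain Z j i g where st: "stage l Z j i g" and p: "perf A N (restrict_cplx A (Z (m + 1 + int l)))"
      and ac: "\<forall>k\<le>m + 1 + int l. acyclic_at (cone (Z (m + 1 + int l)) Y g) k" by auto
    have W: "chain_complex (UP A) (Z (m + 1 + int l))" "torsion_cplx S (Z (m + 1 + int l))"
      "zmap (UP A) (Z (m + 1 + int l)) Y g" using st unfolding stage_def good_def by auto
    have low: "acyclic_at (cone (Z (m + 1 + int l)) Y g) k" if "k < m + 1 + int (Suc l)" for k
      using ac that by auto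
    from inductive_step[where q = "m + 1 + int (Suc l)", OF common W(1) Y W(3,2) assms(7) p pY low inj_interleave Suc.prems]
    obtain Z' :: "(nat \<Rightarrow> 'a, 'x \<times> (nat \<Rightarrow> nat \<Rightarrow> 'a)) cplx" and i' g' where Z':
      "elementary_extension A S (m + 1 + int (Suc l)) (Z (m + 1 + int l)) Z' i'" "chain_complex (UP A) Z'"
      "zmap (UP A) Z' Y g'" "\<forall>k. \<forall>x\<in>carrier (ob (Z (m + 1 + int l)) k). g' k (i' k x) = g k x"
      "torsion_cplx S Z'" "perf A N (restrict_cplx A Z')"
      "\<forall>k\<le>m + 1 + int (Suc l). acyclic_at (cone Z' Y g') k" by blast
    have "good Z'" unfolding good_def using Z'(2,5,6) by blast
    from extend[OF st Z'(1) this Z'(3)] Z'(4)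
    have "stage (Suc l) (Z(m + 1 + int (Suc l) := Z')) j (i(m + 1 + int (Suc l) := i')) g'" by blast
    with Z'(6,7) show ?case by (intro exI conjI) (assumption, simp_all)
  qed
  define l where "l = nat (N - (m + 1))"
  have l: "m + 1 + int l = N" by (simp add: l_def N_def)
  obtain Z j i g where st: "stage l Z j i g" and p: "perf A N (restrict_cplx A (Z N))"
    and ac: "\<forall>k\<le>N. acyclic_at (cone (Z N) Y g) k" using build[of l] by (auto simp: l)
  have W: "chain_complex (UP A) (Z N)" "torsion_cplx S (Z N)" "zmap (UP A) (Z N) Y g"
    using st unfolding stage_def good_def l by (auto simp flip: l)
  have low: "acyclic_at (cone (Z N) Y g) k" if "k < N + 1" for k using ac that by auto
  from last_step[OF common W(1) Y W(3,2) assms(7) p pY low inj_interleave refl]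
  obtain Z' :: "(nat \<Rightarrow> 'a, 'x \<times> (nat \<Rightarrow> nat \<Rightarrow> 'a)) cplx" and i' g' where Z':
    "elementary_extension A S (N + 1) (Z N) Z' i'" "chain_complex (UP A) Z'"
    "zmap (UP A) Z' Y g'" "\<forall>k. \<forall>x\<in>carrier (ob (Z N) k). g' k (i' k x) = g k x"
    "torsion_cplx S Z'" "perf A (N + 1) (restrict_cplx A Z')" "\<forall>k. acyclic_at (cone Z' Y g') k" by blast
  have lS: "m + 1 + int (Suc l) = N + 1" using l by simp
  have good': "good Z'" unfolding good_def using Z'(2,5,6) by blast
  have fin: "stage (Suc l) (Z(N + 1 := Z')) j (i(N + 1 := i')) g'"
    using extend[OF st, of Z' i' g'] Z' good' unfolding lS l by blast
  have qi: "quasi_iso (UP A) Z' Y g'"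
    unfolding quasi_iso_iff using Z'(2,3,7) Y zmap.qi_iff_cone[OF Z'(3)] by blast
  have perfect: "perfect_over TYPE(nat \<Rightarrow> 'a) A Z'' \<and> torsion_cplx S Z''" if "good Z''" for Z''
  proof -
    have "\<forall>k<0. trivial_module (ob (restrict_cplx A Z'') k)"
      using that by (simp add: good_def chain_complex_iff trivial_module_def)
    then show ?thesis using that perf_imp_perfect_over unfolding good_def by blast
  qed
  have nl: "nat (N + 1 - (m + 1)) = Suc l" using l by simp
  show ?thesis
  proof (intro exI[of _ "N + 1"] exI[of _ "Z(N + 1 := Z')"] exI[of _ j] exI[of _ "i(N + 1 := i')"] exI[of _ g'] conjI)
    show "m < N + 1" by (simp add: N_def)
    show "quasi_iso (UP A) ((Z(N + 1 := Z')) (N + 1)) Y g'" using qi by simp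
    show "\<forall>q. m < q \<and> q \<le> N + 1 \<longrightarrow> perfect_over TYPE(nat \<Rightarrow> 'a) A ((Z(N + 1 := Z')) q) \<and>
      torsion_cplx S ((Z(N + 1 := Z')) q)"
      using fin perfect unfolding stage_def lS by blast
  qed (use fin in \<open>unfold stage_def lS nl, blast+\<close>)
qed

end
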